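(* There exists an infinite discrete group $G$ with a cocompact classifying space for proper actions $\underline{E}G$ that admits a compatible collection of complex representations of the finite subgroups of $G$ which cannot be realized as a $G$-equivariant virtual complex vector bundle over $\underline{E}G$, i.e. which is not in the image of $$\varepsilon_G\colon \mathrm{K}^0_G(\underline{E}G)\to \lim_{G/H\in\mathcal{O}_{\mathcal{F}}G}R(H).$$ In particular, $\varepsilon_G$ is not surjective.
   Context: For a discrete group $G$, let $\mathcal{F}$ be the family of finite subgroups of $G$. The orbit category $\mathcal{O}_{\mathcal{F}}G$ has objects the transitive $G$-sets $G/H$ with $H\in\mathcal{F}$ and morphisms the $G$-equivariant maps. A classifying space for proper actions $\underline{E}G$ is a $G$-CW-complex all of whose isotropy groups are finite and such that the fixed point set $\underline{E}G^H$ is contractible for every $H\in\mathcal{F}$; it is cocompact if $G\backslash\underline{E}G$ is compact. $R(H)$ is the complex representation ring of $H$; $G/H\mapsto R(H)$ is a contravariant functor on $\mathcal{O}_{\mathcal{F}}G$ (a map $G/H\to G/K$, $eH\mapsto gK$, induces the pullback $R(K)\to R(H)$ along $h\mapsto g^{-1}hg$). A compatible collection of ($n$-dimensional) complex representations of the finite subgroups of $G$ is an element $([\alpha_H])_{H\in\mathcal{F}}$ of $\lim_{G/H\in\mathcal{O}_{\mathcal{F}}G}\mathrm{Rep}_{\mathrm{U}(n)}(H)\subset\lim_{G/H\in\mathcal{O}_{\mathcal{F}}G}R(H)$ for some $n$, where $\mathrm{Rep}_{\mathrm{U}(n)}(H)=\mathrm{Hom}(H,\mathrm{U}(n))/\mathrm{Inn}(\mathrm{U}(n))$.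 A complex $G$-vector bundle over a $G$-CW-complex $X$ is a complex vector bundle $\pi\colon E\to X$ with a $G$-action on $E$ such that $\pi$ is $G$-equivariant and each $g\in G$ acts by a bundle isomorphism. For a cocompact $X$ with finite isotropy, $\mathrm{K}^0_G(X)$ is the Grothendieck group of the monoid (under direct sum) of isomorphism classes of complex $G$-vector bundles over $X$; its elements are called virtual vector bundles. The homomorphism $\varepsilon_G$ sends the class of a $G$-vector bundle $E\to\underline{E}G$ to the collection whose $H$-component is the class of the $H$-representation on the fiber $E_x$ for any $x\in\underline{E}G^H$ (independent of $x$ since $\underline{E}G^H$ is connected). *)

theory Defs
  imports
    "HOL-Analysis.Analysis"
    "HOL-Algebra.Group_Action"
    "HOL-Algebra.Left_Coset"
    "Jordan_Normal_Form.Matrix"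
    "Jordan_Normal_Form.Schur_Decomposition"
begin

section \<open>Grothendieck group of a commutative monoid\<close>

definition groth_rel :: "('a, 'm) monoid_scheme \<Rightarrow> (('a \<times> 'a) \<times> ('a \<times> 'a)) set" where
  "groth_rel M = {((a, b), (c, d)). a \<in> carrier M \<and> b \<in> carrier M \<and> c \<in> carrier M \<and> d \<in> carrier M \<and>
     (\<exists>k\<in>carrier M. a \<otimes>\<^bsub>M\<^esub> d \<otimes>\<^bsub>M\<^esub> k = c \<otimes>\<^bsub>M\<^esub> b \<otimes>\<^bsub>M\<^esub> k)}"

text \<open>The class of \<open>(a, b)\<close> is the formal difference \<open>a - b\<close>.\<close>

definition groth :: "('a, 'm) monoid_scheme \<Rightarrow> ('a \<times> 'a) set monoid" where
  "groth M = \<lparr>carrier = (carrier M \<times> carrier M) // groth_rel M,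
     mult = (\<lambda>A B. groth_rel M `` {(a \<otimes>\<^bsub>M\<^esub> c, b \<otimes>\<^bsub>M\<^esub> d) | a b c d. (a, b) \<in> A \<and> (c, d) \<in> B}),
     one = groth_rel M `` {(\<one>\<^bsub>M\<^esub>, \<one>\<^bsub>M\<^esub>)}\<rparr>"

definition groth_incl :: "('a, 'm) monoid_scheme \<Rightarrow> 'a \<Rightarrow> ('a \<times> 'a) set" where
  "groth_incl M a = groth_rel M `` {(a, \<one>\<^bsub>M\<^esub>)}"

text \<open>The map \<open>groth M \<rightarrow> groth N\<close> induced by a monoid homomorphism \<open>\<phi>\<close> from \<open>M\<close> to \<open>N\<close>.\<close>

definition groth_map :: "('b, 'n) monoid_scheme \<Rightarrow> ('a \<Rightarrow> 'b) \<Rightarrow> ('a \<times> 'a) set \<Rightarrow> ('b \<times> 'b) set" where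
  "groth_map N \<phi> A = groth_rel N `` (map_prod \<phi> \<phi> ` A)"

section \<open>Representations\<close>

definition GL :: "nat \<Rightarrow> complex Matrix.mat monoid" where
  "GL n = units_of (ring_mat TYPE(complex) n ())"

definition unitary_group :: "nat \<Rightarrow> complex Matrix.mat monoid" where
  "unitary_group n = (GL n)\<lparr>carrier := {A \<in> carrier_mat n n. A * mat_adjoint A = 1\<^sub>m n}\<rparr>"

definition Hom :: "('g, 'm) monoid_scheme \<Rightarrow> 'l monoid \<Rightarrow> ('g \<Rightarrow> 'l) set" where
  "Hom K L = hom K L \<inter> extensional (carrier K)"

definition conj_rel :: "('g, 'm) monoid_scheme \<Rightarrow> 'l monoid \<Rightarrow> (('g \<Rightarrow> 'l) \<times> ('g \<Rightarrow> 'l)) set" where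
  "conj_rel K L = {(\<rho>, \<sigma>). \<rho> \<in> Hom K L \<and> \<sigma> \<in> Hom K L \<and>
     (\<exists>P\<in>carrier L. \<forall>h\<in>carrier K. \<sigma> h = P \<otimes>\<^bsub>L\<^esub> \<rho> h \<otimes>\<^bsub>L\<^esub> inv\<^bsub>L\<^esub> P)}"

definition Rep_U :: "nat \<Rightarrow> ('g, 'm) monoid_scheme \<Rightarrow> ('g \<Rightarrow> complex Matrix.mat) set set" where
  "Rep_U n K = Hom K (unitary_group n) // conj_rel K (unitary_group n)"

text \<open>Finite-dimensional complex representations of all degrees, in matrix form;
  the degree of \<open>\<rho>\<close> is the size of the matrix \<open>\<rho> \<one>\<close>.\<close>

definition reps :: "('g, 'm) monoid_scheme \<Rightarrow> ('g \<Rightarrow> complex Matrix.mat) set" where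
  "reps K = (\<Union>n. Hom K (GL n))"

definition rep_iso ::
    "('g, 'm) monoid_scheme \<Rightarrow> (('g \<Rightarrow> complex Matrix.mat) \<times> ('g \<Rightarrow> complex Matrix.mat)) set" where
  "rep_iso K = (\<Union>n. conj_rel K (GL n))"

definition rep_sum ::
    "('g, 'm) monoid_scheme \<Rightarrow> ('g \<Rightarrow> complex Matrix.mat) \<Rightarrow> ('g \<Rightarrow> complex Matrix.mat) \<Rightarrow> 'g \<Rightarrow> complex Matrix.mat" where
  "rep_sum K \<rho> \<sigma> = (\<lambda>h\<in>carrier K.
     four_block_mat (\<rho> h) (0\<^sub>m (dim_row (\<rho> h)) (dim_col (\<sigma> h)))
                    (0\<^sub>m (dim_row (\<sigma> h)) (dim_col (\<rho> h))) (\<sigma> h))"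

definition rep_monoid :: "('g, 'm) monoid_scheme \<Rightarrow> ('g \<Rightarrow> complex Matrix.mat) set monoid" where
  "rep_monoid K = \<lparr>carrier = reps K // rep_iso K,
     mult = (\<lambda>C D. rep_iso K `` {rep_sum K \<rho> \<sigma> | \<rho> \<sigma>. \<rho> \<in> C \<and> \<sigma> \<in> D}),
     one = rep_iso K `` {\<lambda>h\<in>carrier K. 1\<^sub>m 0}\<rparr>"

text \<open>The additive group of the representation ring. The tensor product plays no role for
  the underlying set of the limit below.\<close>

definition rep_ring :: "('g, 'm) monoid_scheme \<Rightarrow> (('g \<Rightarrow> complex Matrix.mat) set \<times> ('g \<Rightarrow> complex Matrix.mat) set) set monoid" where
  "rep_ring K = groth (rep_monoid K)"

text \<open>Unitary representations that are unitarily conjugate are in particular isomorphic, so the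
  image under \<^term>\<open>rep_iso K\<close> of an element of \<^term>\<open>Rep_U n K\<close> is a single isomorphism class.\<close>

definition Rep_U_incl ::
    "('g, 'm) monoid_scheme \<Rightarrow> ('g \<Rightarrow> complex Matrix.mat) set \<Rightarrow> (('g \<Rightarrow> complex Matrix.mat) set \<times> ('g \<Rightarrow> complex Matrix.mat) set) set" where
  "Rep_U_incl K C = groth_incl (rep_monoid K) (rep_iso K `` C)"

section \<open>Limits over the orbit category of finite subgroups\<close>

definition finite_subgroups :: "('g, 'm) monoid_scheme \<Rightarrow> 'g set set" where
  "finite_subgroups G = {H. subgroup H G \<and> finite H}"

definition sub :: "('g, 'm) monoid_scheme \<Rightarrow> 'g set \<Rightarrow> ('g, 'm) monoid_scheme" where
  "sub G H = G\<lparr>carrier := H\<rparr>"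

definition orbit_maps :: "('g, 'm) monoid_scheme \<Rightarrow> 'g set \<Rightarrow> 'g set \<Rightarrow> ('g set \<Rightarrow> 'g set) set" where
  "orbit_maps G H K = {f \<in> (lcosets\<^bsub>G\<^esub> H) \<rightarrow>\<^sub>E (lcosets\<^bsub>G\<^esub> K).
     \<forall>g\<in>carrier G. \<forall>c\<in>lcosets\<^bsub>G\<^esub> H. f (g <#\<^bsub>G\<^esub> c) = g <#\<^bsub>G\<^esub> f c}"

text \<open>A contravariant functor on the orbit category is given by its values \<open>R H\<close> at \<open>G/H\<close> and,
  for a map \<open>G/H \<rightarrow> G/K\<close> sending \<open>eH\<close> to \<open>gK\<close>, the induced map \<open>pb H g\<close> from \<open>R K\<close> to \<open>R H\<close>.\<close>

definition orbit_lim ::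
    "('g, 'm) monoid_scheme \<Rightarrow> ('g set \<Rightarrow> 'r set) \<Rightarrow> ('g set \<Rightarrow> 'g \<Rightarrow> 'r \<Rightarrow> 'r) \<Rightarrow> ('g set \<Rightarrow> 'r) set" where
  "orbit_lim G R pb = {x \<in> (\<Pi>\<^sub>E H\<in>finite_subgroups G. R H).
     \<forall>H\<in>finite_subgroups G. \<forall>K\<in>finite_subgroups G. \<forall>f\<in>orbit_maps G H K. \<forall>g\<in>carrier G.
       f H = g <#\<^bsub>G\<^esub> K \<longrightarrow> pb H g (x K) = x H}"

definition pullback_hom :: "('g, 'm) monoid_scheme \<Rightarrow> 'g set \<Rightarrow> 'g \<Rightarrow> ('g \<Rightarrow> 'l) \<Rightarrow> 'g \<Rightarrow> 'l" where
  "pullback_hom G H g \<rho> = (\<lambda>h\<in>H. \<rho> (inv\<^bsub>G\<^esub> g \<otimes>\<^bsub>G\<^esub> h \<otimes>\<^bsub>G\<^esub> g))"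

definition pullback_Rep_U where
  "pullback_Rep_U n G H g C = conj_rel (sub G H) (unitary_group n) `` (pullback_hom G H g ` C)"

definition pullback_rep_ring where
  "pullback_rep_ring G H g =
     groth_map (rep_monoid (sub G H)) (\<lambda>C. rep_iso (sub G H) `` (pullback_hom G H g ` C))"

definition lim_Rep_U where
  "lim_Rep_U n G = orbit_lim G (\<lambda>H. Rep_U n (sub G H)) (pullback_Rep_U n G)"

definition lim_rep_ring where
  "lim_rep_ring G = orbit_lim G (\<lambda>H. carrier (rep_ring (sub G H))) (pullback_rep_ring G)"

definition lim_Rep_U_incl where
  "lim_Rep_U_incl G \<alpha> = (\<lambda>H\<in>finite_subgroups G. Rep_U_incl (sub G H) (\<alpha> H))"

section \<open>G-CW-complexes and classifying spaces for proper actions\<close>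

definition G_space :: "('g, 'm) monoid_scheme \<Rightarrow> 'x topology \<Rightarrow> ('g \<Rightarrow> 'x \<Rightarrow> 'x) \<Rightarrow> bool" where
  "G_space G X act \<longleftrightarrow> group_action G (topspace X) act \<and> (\<forall>g\<in>carrier G. continuous_map X X (act g))"

definition norm_sq :: "nat \<Rightarrow> (nat \<Rightarrow> real) \<Rightarrow> real" where
  "norm_sq n v = (\<Sum>i<n. (v i)\<^sup>2)"

definition disc :: "nat \<Rightarrow> (nat \<Rightarrow> real) topology" where
  "disc n = subtopology (Euclidean_space n) {v. norm_sq n v \<le> 1}"

text \<open>\<open>orbit_cell G H n\<close> is \<open>G/H \<times> D\<^sup>n\<close>. For \<open>n = 0\<close> the disc is a point and its bounding
  sphere \<open>norm_sq 0 v = 1\<close> is empty.\<close>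

definition orbit_cell :: "('g, 'm) monoid_scheme \<Rightarrow> 'g set \<Rightarrow> nat \<Rightarrow> ('g set \<times> (nat \<Rightarrow> real)) topology" where
  "orbit_cell G H n = prod_topology (discrete_topology (lcosets\<^bsub>G\<^esub> H)) (disc n)"

text \<open>The subspace \<open>B\<close> of \<open>X\<close> arises from its subspace \<open>A\<close> by attaching equivariant \<open>n\<close>-cells
  \<open>G/St j \<times> D\<^sup>n\<close> for \<open>j \<in> J\<close>, with characteristic maps \<open>Q j\<close>: the last two conjuncts say that
  \<open>B\<close> is the pushout as a set and as a topological space. Indexing the cells by points of the
  space is no restriction, since distinct cells have distinct centres \<open>Q j (St j, 0)\<close>.\<close>

definition attaches_cells ::
    "('g, 'm) monoid_scheme \<Rightarrow> 'x topology \<Rightarrow> ('g \<Rightarrow> 'x \<Rightarrow> 'x) \<Rightarrow> nat \<Rightarrow> 'x set \<Rightarrow> 'x set \<Rightarrow> bool" where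
  "attaches_cells G X act n A B \<longleftrightarrow> A \<subseteq> B \<and> B \<subseteq> topspace X \<and>
    (\<exists>(J :: 'x set) (St :: 'x \<Rightarrow> 'g set) Q.
      (\<forall>j\<in>J. subgroup (St j) G \<and>
         continuous_map (orbit_cell G (St j) n) (subtopology X B) (Q j) \<and>
         (\<forall>g\<in>carrier G. \<forall>(c, v)\<in>topspace (orbit_cell G (St j) n). Q j (g <#\<^bsub>G\<^esub> c, v) = act g (Q j (c, v))) \<and>
         (\<forall>(c, v)\<in>topspace (orbit_cell G (St j) n). norm_sq n v = 1 \<longrightarrow> Q j (c, v) \<in> A)) \<and>
      bij_betw (\<lambda>(j, p). Q j p)
        (SIGMA j:J. {(c, v) \<in> topspace (orbit_cell G (St j) n). norm_sq n v < 1}) (B - A) \<and>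
      (\<forall>S\<subseteq>B. closedin (subtopology X B) S \<longleftrightarrow>
         closedin (subtopology X A) (S \<inter> A) \<and>
         (\<forall>j\<in>J. closedin (orbit_cell G (St j) n) {p \<in> topspace (orbit_cell G (St j) n). Q j p \<in> S})))"

definition G_CW_complex :: "('g, 'm) monoid_scheme \<Rightarrow> 'x topology \<Rightarrow> ('g \<Rightarrow> 'x \<Rightarrow> 'x) \<Rightarrow> bool" where
  "G_CW_complex G X act \<longleftrightarrow> G_space G X act \<and>
    (\<exists>sk :: nat \<Rightarrow> 'x set.
      attaches_cells G X act 0 {} (sk 0) \<and>
      (\<forall>n. attaches_cells G X act (Suc n) (sk n) (sk (Suc n))) \<and>
      (\<Union>n. sk n) = topspace X \<and>
      (\<forall>S\<subseteq>topspace X. closedin X S \<longleftrightarrow> (\<forall>n. closedin (subtopology X (sk n)) (S \<inter> sk n))))"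

definition fixed_points :: "'x topology \<Rightarrow> ('g \<Rightarrow> 'x \<Rightarrow> 'x) \<Rightarrow> 'g set \<Rightarrow> 'x set" where
  "fixed_points X act H = {x \<in> topspace X. \<forall>h\<in>H. act h x = x}"

text \<open>In the library the empty space counts as contractible, hence the explicit nonemptiness.\<close>

definition classifying_space_proper :: "('g, 'm) monoid_scheme \<Rightarrow> 'x topology \<Rightarrow> ('g \<Rightarrow> 'x \<Rightarrow> 'x) \<Rightarrow> bool" where
  "classifying_space_proper G X act \<longleftrightarrow> G_CW_complex G X act \<and>
     (\<forall>x\<in>topspace X. finite (stabilizer G act x)) \<and>
     (\<forall>H\<in>finite_subgroups G. fixed_points X act H \<noteq> {} \<and>
        contractible_space (subtopology X (fixed_points X act H)))"

definition orbit_space :: "('g, 'm) monoid_scheme \<Rightarrow> 'x topology \<Rightarrow> ('g \<Rightarrow> 'x \<Rightarrow> 'x) \<Rightarrow> 'x set topology" where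
  "orbit_space G X act = topology (\<lambda>U. U \<subseteq> orbits G (topspace X) act \<and>
     openin X {x \<in> topspace X. orbit G act x \<in> U})"

lemma openin_orbit_space:
  "openin (orbit_space G X act) U \<longleftrightarrow>
     U \<subseteq> orbits G (topspace X) act \<and> openin X {x \<in> topspace X. orbit G act x \<in> U}"
proof -
  let ?P = "\<lambda>U. U \<subseteq> orbits G (topspace X) act \<and> openin X {x \<in> topspace X. orbit G act x \<in> U}"
  have "istopology ?P"
    unfolding istopology_def
  proof (intro conjI allI impI)
    fix S T assume "?P S" "?P T"
    moreover have "{x \<in> topspace X. orbit G act x \<in> S \<inter> T} =
        {x \<in> topspace X. orbit G act x \<in> S} \<inter> {x \<in> topspace X. orbit G act x \<in> T}" by auto
    ultimately show "S \<inter> T \<subseteq> orbits G (topspace X) act"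
      and "openin X {x \<in> topspace X. orbit G act x \<in> S \<inter> T}" by auto
  next
    fix \<K> assume K: "\<forall>S\<in>\<K>. ?P S"
    have "{x \<in> topspace X. orbit G act x \<in> \<Union>\<K>} =
        (\<Union>S\<in>\<K>. {x \<in> topspace X. orbit G act x \<in> S})" by auto
    with K show "openin X {x \<in> topspace X. orbit G act x \<in> \<Union>\<K>}" by auto
    from K show "\<Union>\<K> \<subseteq> orbits G (topspace X) act" by auto
  qed
  then show ?thesis by (simp add: orbit_space_def)
qed

lemma topspace_orbit_space: "topspace (orbit_space G X act) = orbits G (topspace X) act"
proof -
  have "{x \<in> topspace X. orbit G act x \<in> orbits G (topspace X) act} = topspace X"
    by (auto simp: orbits_def)
  then have "openin (orbit_space G X act) (orbits G (topspace X) act)"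
    by (simp add: openin_orbit_space)
  moreover have "topspace (orbit_space G X act) \<subseteq> orbits G (topspace X) act"
    using openin_orbit_space[of G X act "topspace (orbit_space G X act)"] by auto
  ultimately show ?thesis
    by (meson openin_subset subset_antisym)
qed

lemma quotient_map_orbit_space: "quotient_map X (orbit_space G X act) (orbit G act)"
  by (auto simp: quotient_map_def topspace_orbit_space openin_orbit_space orbits_def)

section \<open>Equivariant complex vector bundles\<close>

definition cvec_topology :: "nat \<Rightarrow> complex Matrix.vec topology" where
  "cvec_topology n = pullback_topology (carrier_vec n) (\<lambda>v. \<lambda>i\<in>{..<n}. vec_index v i)
     (product_topology (\<lambda>_. euclidean) {..<n})"

record ('g, 'x, 'e) vbundle =
  total :: "'e topology"
  proj :: "'e \<Rightarrow> 'x"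
  add :: "'e \<Rightarrow> 'e \<Rightarrow> 'e"
  scale :: "complex \<Rightarrow> 'e \<Rightarrow> 'e"
  action :: "'g \<Rightarrow> 'e \<Rightarrow> 'e"

definition fibre :: "('g, 'x, 'e) vbundle \<Rightarrow> 'x \<Rightarrow> 'e set" where
  "fibre E x = {e \<in> topspace (total E). proj E e = x}"

definition frame :: "('g, 'x, 'e) vbundle \<Rightarrow> 'x \<Rightarrow> nat \<Rightarrow> (complex Matrix.vec \<Rightarrow> 'e) \<Rightarrow> bool" where
  "frame E x n \<phi> \<longleftrightarrow> bij_betw \<phi> (carrier_vec n) (fibre E x) \<and>
     (\<forall>u\<in>carrier_vec n. \<forall>v\<in>carrier_vec n. \<phi> (u + v) = add E (\<phi> u) (\<phi> v)) \<and>
     (\<forall>c. \<forall>v\<in>carrier_vec n. \<phi> (c \<cdot>\<^sub>v v) = scale E c (\<phi> v))"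

text \<open>The vector space axioms for the fibres are not listed since they follow from the
  existence of a frame at each point, which is part of local triviality. The rank may vary
  between components.\<close>

definition G_vector_bundle ::
    "('g, 'm) monoid_scheme \<Rightarrow> 'x topology \<Rightarrow> ('g \<Rightarrow> 'x \<Rightarrow> 'x) \<Rightarrow> ('g, 'x, 'e) vbundle \<Rightarrow> bool" where
  "G_vector_bundle G X act E \<longleftrightarrow>
     continuous_map (total E) X (proj E) \<and>
     (\<forall>x\<in>topspace X. \<exists>U n \<psi>. openin X U \<and> x \<in> U \<and>
        homeomorphic_map (prod_topology (subtopology X U) (cvec_topology n))
          (subtopology (total E) {e. proj E e \<in> U}) \<psi> \<and>
        (\<forall>y\<in>U. frame E y n (\<lambda>v. \<psi> (y, v)))) \<and>
     G_space G (total E) (action E) \<and>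
     (\<forall>g\<in>carrier G. \<forall>e\<in>topspace (total E). proj E (action E g e) = act g (proj E e)) \<and>
     (\<forall>g\<in>carrier G. \<forall>x\<in>topspace X. \<forall>e\<in>fibre E x.
        (\<forall>e'\<in>fibre E x. action E g (add E e e') = add E (action E g e) (action E g e')) \<and>
        (\<forall>c. action E g (scale E c e) = scale E c (action E g e)))"

definition bundle_iso ::
    "('g, 'm) monoid_scheme \<Rightarrow> ('g, 'x, 'e) vbundle \<Rightarrow> ('g, 'x, 'f) vbundle \<Rightarrow> bool" where
  "bundle_iso G E F \<longleftrightarrow> (\<exists>f. homeomorphic_map (total E) (total F) f \<and>
     (\<forall>e\<in>topspace (total E). proj F (f e) = proj E e \<and>
        (\<forall>e'\<in>fibre E (proj E e). f (add E e e') = add F (f e) (f e')) \<and>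
        (\<forall>c. f (scale E c e) = scale F c (f e)) \<and>
        (\<forall>g\<in>carrier G. f (action E g e) = action F g (f e))))"

definition whitney_sum :: "('g, 'x, 'e) vbundle \<Rightarrow> ('g, 'x, 'f) vbundle \<Rightarrow> ('g, 'x, 'e \<times> 'f) vbundle" where
  "whitney_sum E F =
    (let T = subtopology (prod_topology (total E) (total F)) {(e, f). proj E e = proj F f} in
     \<lparr>total = T,
      proj = (\<lambda>(e, f). proj E e),
      add = (\<lambda>(e, f) (e', f'). (add E e e', add F f f')),
      scale = (\<lambda>c (e, f). (scale E c e, scale F c f)),
      action = (\<lambda>g. \<lambda>(e, f)\<in>topspace T. (action E g e, action F g f))\<rparr>)"

definition zero_bundle :: "'x topology \<Rightarrow> ('g \<Rightarrow> 'x \<Rightarrow> 'x) \<Rightarrow> ('g, 'x, 'x) vbundle" where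
  "zero_bundle X act = \<lparr>total = X, proj = (\<lambda>x. x), add = (\<lambda>x _. x), scale = (\<lambda>_ x. x), action = act\<rparr>"

text \<open>To form a set of isomorphism classes, total spaces are taken in the fixed type
  \<open>'x \<times> complex vec\<close>. Every bundle over \<open>X\<close>, of whatever total type, is isomorphic to one of this
  kind: choose a frame in each fibre and transport the structure to the set of all \<open>(x, v)\<close> with
  \<open>v\<close> of dimension the rank at \<open>x\<close>.\<close>

type_synonym ('g, 'x) std_bundle = "('g, 'x, 'x \<times> complex Matrix.vec) vbundle"

definition G_bundles ::
    "('g, 'm) monoid_scheme \<Rightarrow> 'x topology \<Rightarrow> ('g \<Rightarrow> 'x \<Rightarrow> 'x) \<Rightarrow> ('g, 'x) std_bundle set" where
  "G_bundles G X act = {E. G_vector_bundle G X act E}"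

definition bundle_class ::
    "('g, 'm) monoid_scheme \<Rightarrow> 'x topology \<Rightarrow> ('g \<Rightarrow> 'x \<Rightarrow> 'x) \<Rightarrow> ('g, 'x, 'e) vbundle \<Rightarrow> ('g, 'x) std_bundle set" where
  "bundle_class G X act E = {F \<in> G_bundles G X act. bundle_iso G E F}"

definition Vect ::
    "('g, 'm) monoid_scheme \<Rightarrow> 'x topology \<Rightarrow> ('g \<Rightarrow> 'x \<Rightarrow> 'x) \<Rightarrow> ('g, 'x) std_bundle set monoid" where
  "Vect G X act = \<lparr>carrier = bundle_class G X act ` G_bundles G X act,
     mult = (\<lambda>C D. \<Union>E\<in>C. \<Union>F\<in>D. bundle_class G X act (whitney_sum E F)),
     one = bundle_class G X act (zero_bundle X act)\<rparr>"

definition K0 ::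
    "('g, 'm) monoid_scheme \<Rightarrow> 'x topology \<Rightarrow> ('g \<Rightarrow> 'x \<Rightarrow> 'x) \<Rightarrow> (('g, 'x) std_bundle set \<times> ('g, 'x) std_bundle set) set monoid" where
  "K0 G X act = groth (Vect G X act)"

section \<open>The homomorphism to the limit of the representation rings\<close>

text \<open>The isomorphism class of the representation of \<open>H\<close> on the fibre at an \<open>H\<close>-fixed point \<open>x\<close>.\<close>

definition fibre_rep ::
    "('g, 'm) monoid_scheme \<Rightarrow> 'g set \<Rightarrow> ('g, 'x, 'e) vbundle \<Rightarrow> 'x \<Rightarrow> ('g \<Rightarrow> complex Matrix.mat) set" where
  "fibre_rep G H E x = {\<rho>. \<exists>n \<phi>. \<rho> \<in> Hom (sub G H) (GL n) \<and> frame E x n \<phi> \<and>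
     (\<forall>h\<in>H. \<forall>v\<in>carrier_vec n. action E h (\<phi> v) = \<phi> (\<rho> h *\<^sub>v v))}"

text \<open>The union is over \<open>E\<close> in an isomorphism class and all \<open>H\<close>-fixed points \<open>x\<close>. It is a single
  isomorphism class, as the class of the fibre representation depends on neither choice when the
  fixed point set is nonempty and connected.\<close>

definition fibre_rep_class ::
    "('g, 'm) monoid_scheme \<Rightarrow> 'x topology \<Rightarrow> ('g \<Rightarrow> 'x \<Rightarrow> 'x) \<Rightarrow> 'g set \<Rightarrow> ('g, 'x) std_bundle set \<Rightarrow> ('g \<Rightarrow> complex Matrix.mat) set" where
  "fibre_rep_class G X act H C = (\<Union>E\<in>C. \<Union>x\<in>fixed_points X act H. fibre_rep G H E x)"

definition epsilon where
  "epsilon G X act \<xi> = (\<lambda>H\<in>finite_subgroups G.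
     groth_map (rep_monoid (sub G H)) (fibre_rep_class G X act H) \<xi>)"

end

(*
  Let G be the central extension of the product of the Klein bottle group <x, y> and <t> by
  Z = {1, z} in which [t, x] = z. Its quotient by Z acts freely on R^3, a cubical classifying space
  for proper actions of G, and every finite subgroup of G lies in Z. The sign character of Z is a
  compatible collection. For a G-vector bundle E over R^3, z acts on the line bundle det E by a
  constant sign. This sign is 1: otherwise the x-t-planes would carry a twisted line bundle whose
  first Chern number over a fundamental domain is half an odd integer, whereas y reverses the
  orientation of these planes, so that this number vanishes. Hence z has determinant 1 on every
  virtual G-vector bundle, but determinant -1 on the sign character.
*)
theory Submission
  imports Defs
begin

subsection \<open>Line bundles over boxes\<close>

text \<open>The class of the extension is the mod 2 cup product of the exponents of x and t, and a
  twisted line bundle exists only if its integral Bockstein vanishes in H^3 of the quotient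
  manifold. For an orientable closed 3-manifold that group is Z and has no torsion; the Klein bottle
  factor makes it Z/2, which is why y is present at all. The class has order two, so the obstruction
  does not exclude twisted bundles of even rank, and the determinant is the invariant that sees the
  parity of the rank. It is multiplicative with nonzero values, hence passes to formal differences.
  No Chern class is formed. Over a box the line bundle is trivial, the generators act by functions
  with continuous logarithms, and the integrality argument becomes an identity between constants.
  Exterior powers are avoided as well: a determinant line is recorded by comparing frames with one
  frame chosen in each fibre without any continuity, and only ratios of the resulting determinants
  are continuous.\<close>

lemma continuous_on_locally:
  fixes f :: "'a::topological_space \<Rightarrow> 'b::topological_space"
  assumes "\<And>p. p \<in> S \<Longrightarrow> \<exists>U. open U \<and> p \<in> U \<and> continuous_on (S \<inter> U) f"
  shows "continuous_on S f"
  unfolding continuous_on_def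
proof
  fix p assume "p \<in> S"
  then obtain U where U: "open U" "p \<in> U" "continuous_on (S \<inter> U) f" using assms by blast
  then have "(f \<longlongrightarrow> f p) (at p within S \<inter> U)"
    using \<open>p \<in> S\<close> by (auto simp: continuous_on_def)
  moreover have "at p within S \<inter> U = at p within S"
    by (rule at_within_nhd[of _ U]) (use U in auto)
  ultimately show "(f \<longlongrightarrow> f p) (at p within S)" by simp
qed

text \<open>Two logarithms of the same number differ by a multiple of 2 pi i, so distinct values of
  \<open>h\<close> are at least 1 apart and connectedness leaves only one. This turns relations that
  hold after \<open>exp\<close> into relations between logarithms with a constant error.\<close>

lemma continuous_exp_constant_imp_constant:
  fixes h :: "'a::topological_space \<Rightarrow> complex"
  assumes "connected S" "continuous_on S h" "\<And>p. p \<in> S \<Longrightarrow> exp (h p) = s" "p \<in> S" "q \<in> S"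
  shows "h p = h q"
proof -
  have "\<exists>e>0. \<forall>y\<in>S. h y \<noteq> h x \<longrightarrow> e \<le> norm (h y - h x)" if "x \<in> S" for x
  proof (intro exI[of _ 1] conjI ballI impI)
    fix y assume "y \<in> S" "h y \<noteq> h x"
    then have "exp (h y) = exp (h x)" using assms that by simp
    then obtain n :: int where n: "h y = h x + of_int (2 * n) * of_real pi * \<i>"
      unfolding exp_eq by auto
    with \<open>h y \<noteq> h x\<close> have "n \<noteq> 0" by auto
    then have "1 \<le> \<bar>real_of_int n\<bar>" by linarith
    have "norm (h y - h x) = 2 * \<bar>real_of_int n\<bar> * pi"
      using n by (simp add: norm_mult)
    then show "1 \<le> norm (h y - h x)"
      using mult_mono[of 1 "2 * \<bar>real_of_int n\<bar>" 1 pi] \<open>1 \<le> \<bar>real_of_int n\<bar>\<close> pi_ge_two by auto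
  qed auto
  then have "h constant_on S"
    using continuous_discrete_range_constant[OF assms(1,2)] by blast
  then show ?thesis using assms(4,5) by (auto simp: constant_on_def)
qed

text \<open>A line bundle is given by the ratios \<open>d\<close> of its local nonvanishing sections to one fixed,
  possibly discontinuous, nonvanishing section; \<open>u\<close> is a nonvanishing section of the dual over \<open>B\<close>.\<close>

definition nonvanishing_section :: "('p::topological_space set \<times> ('p \<Rightarrow> complex)) set \<Rightarrow> 'p set \<Rightarrow> ('p \<Rightarrow> complex) \<Rightarrow> bool" where
  "nonvanishing_section D B u \<longleftrightarrow> (\<forall>p\<in>B. u p \<noteq> 0) \<and> (\<forall>(U, d)\<in>D. continuous_on (B \<inter> U) (\<lambda>p. u p * d p))"

locale line_bundle_atlas =
  fixes D :: "('p::topological_space set \<times> ('p \<Rightarrow> complex)) set"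
  assumes open_dom: "(U, d) \<in> D \<Longrightarrow> open U"
    and nonzero: "(U, d) \<in> D \<Longrightarrow> p \<in> U \<Longrightarrow> d p \<noteq> 0"
    and compatible: "(U, d) \<in> D \<Longrightarrow> (V, e) \<in> D \<Longrightarrow> continuous_on (U \<inter> V) (\<lambda>p. e p / d p)"
    and covers: "\<exists>(U, d)\<in>D. p \<in> U"
begin

lemma nonvanishing_section_subset:
  "nonvanishing_section D B u \<Longrightarrow> A \<subseteq> B \<Longrightarrow> nonvanishing_section D A u"
  unfolding nonvanishing_section_def
  by (fastforce elim: continuous_on_subset)

text \<open>The reciprocal of \<open>d\<close> is the coframe dual to the local section; its
  products with the other charts are the transition functions.\<close>

lemma nonvanishing_section_local: "(U, d) \<in> D \<Longrightarrow> nonvanishing_section D U (\<lambda>p. 1 / d p)"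
  unfolding nonvanishing_section_def using nonzero compatible by auto

text \<open>Two nonvanishing sections differ on the overlap by a continuous function without zeros.
  The retraction \<open>r\<close> of \<open>B\<close> onto the overlap extends this function over
  \<open>B\<close>, where it corrects \<open>v\<close> so as to agree with \<open>u\<close>.\<close>

lemma nonvanishing_section_glue:
  assumes u: "nonvanishing_section D A u" and v: "nonvanishing_section D B v"
    and cl: "closed A" "closed B"
    and r: "continuous_on B r" "r ` B \<subseteq> A \<inter> B" "\<And>p. p \<in> A \<inter> B \<Longrightarrow> r p = p"
  shows "\<exists>w. nonvanishing_section D (A \<union> B) w"
proof -
  define q where "q p = u p / v p" for p
  have "continuous_on (A \<inter> B) q"
  proof (rule continuous_on_locally)
    fix p assume "p \<in> A \<inter> B"
    obtain U d where U: "(U, d) \<in> D" "p \<in> U" using covers by blast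
    have "continuous_on (A \<inter> B \<inter> U) (\<lambda>p. u p * d p)" "continuous_on (A \<inter> B \<inter> U) (\<lambda>p. v p * d p)"
      using nonvanishing_section_subset[OF u, of "A \<inter> B"] nonvanishing_section_subset[OF v, of "A \<inter> B"] U(1)
      unfolding nonvanishing_section_def by auto
    \<comment> \<open>Neither \<open>u\<close> nor \<open>v\<close> need be continuous; only their
      products with a chart are, and the chart cancels in the quotient.\<close>
    then have "continuous_on (A \<inter> B \<inter> U) (\<lambda>p. (u p * d p) / (v p * d p))"
      using v nonzero[OF U(1)] by (intro continuous_on_divide) (auto simp: nonvanishing_section_def)
    then have "continuous_on (A \<inter> B \<inter> U) q"
      by (rule continuous_on_eq) (use nonzero[OF U(1)] in \<open>auto simp: q_def\<close>)
    then show "\<exists>U. open U \<and> p \<in> U \<and> continuous_on (A \<inter> B \<inter> U) q"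
      using U open_dom by blast
  qed
  then have qr: "continuous_on B (q \<circ> r)"
    using r by (meson continuous_on_compose continuous_on_subset)
  define w where "w p = (if p \<in> A then u p else v p * q (r p))" for p
  have wB: "w p = v p * q (r p)" if "p \<in> B" for p
    using that r(3)[of p] u v by (auto simp: w_def q_def nonvanishing_section_def)
  have "nonvanishing_section D (A \<union> B) w"
    unfolding nonvanishing_section_def
  proof safe
    fix p assume "p \<in> A" "w p = 0" then show False using u by (auto simp: w_def nonvanishing_section_def)
  next
    fix p assume "p \<in> B" "w p = 0"
    moreover from \<open>p \<in> B\<close> have "r p \<in> A \<inter> B" using r by auto
    ultimately show False using u v by (auto simp: wB q_def nonvanishing_section_def)
  next
    fix U d assume U: "(U, d) \<in> D"
    have 1: "continuous_on (A \<inter> U) (\<lambda>p. w p * d p)"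
    proof (rule continuous_on_eq)
      show "continuous_on (A \<inter> U) (\<lambda>p. u p * d p)" using u U by (auto simp: nonvanishing_section_def)
    qed (auto simp: w_def)
    have 2: "continuous_on (B \<inter> U) (\<lambda>p. w p * d p)"
    proof (rule continuous_on_eq)
      have "continuous_on (B \<inter> U) (\<lambda>p. v p * d p)" using v U by (auto simp: nonvanishing_section_def)
      moreover have "continuous_on (B \<inter> U) (q \<circ> r)" by (rule continuous_on_subset[OF qr]) auto
      ultimately show "continuous_on (B \<inter> U) (\<lambda>p. (v p * d p) * (q \<circ> r) p)"
        by (rule continuous_on_mult)
    qed (auto simp: wB)
    have "continuous_on ((A \<inter> U) \<union> (B \<inter> U)) (\<lambda>p. if p \<in> A \<inter> U then w p * d p else w p * d p)"
    proof (rule continuous_on_cases_local)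
      show "closedin (top_of_set (A \<inter> U \<union> B \<inter> U)) (A \<inter> U)"
        using cl unfolding closedin_closed by (intro exI[of _ A]) auto
      show "closedin (top_of_set (A \<inter> U \<union> B \<inter> U)) (B \<inter> U)"
        using cl unfolding closedin_closed by (intro exI[of _ B]) auto
    qed (use 1 2 in auto)
    then show "continuous_on ((A \<union> B) \<inter> U) (\<lambda>p. w p * d p)"
      by (simp add: Int_Un_distrib2)
  qed
  then show ?thesis by blast
qed

end

text \<open>Bolzano's bisection principle, one coordinate after the other. What is bisected is the
  existence of a positive thickness in the coordinates not yet treated; two adjacent pieces are
  first shrunk to the smaller thickness and then joined.\<close>

lemma box_induct:
  fixes P :: "real \<Rightarrow> real \<Rightarrow> real \<Rightarrow> real \<Rightarrow> real \<Rightarrow> real \<Rightarrow> bool"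
  assumes mono: "\<And>a b c d e f a' b' c' d' e' f'. P a b c d e f \<Longrightarrow> a \<le> a' \<Longrightarrow> b' \<le> b \<Longrightarrow> c \<le> c' \<Longrightarrow> d' \<le> d \<Longrightarrow> e \<le> e' \<Longrightarrow> f' \<le> f \<Longrightarrow> P a' b' c' d' e' f'"
    and m1: "\<And>a b b' c d e f. P a b c d e f \<Longrightarrow> P b b' c d e f \<Longrightarrow> a \<le> b \<Longrightarrow> b \<le> b' \<Longrightarrow> P a b' c d e f"
    and m2: "\<And>a b c d d' e f. P a b c d e f \<Longrightarrow> P a b d d' e f \<Longrightarrow> c \<le> d \<Longrightarrow> d \<le> d' \<Longrightarrow> P a b c d' e f"
    and m3: "\<And>a b c d e f f'. P a b c d e f \<Longrightarrow> P a b c d f f' \<Longrightarrow> e \<le> f \<Longrightarrow> f \<le> f' \<Longrightarrow> P a b c d e f'"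
    and loc: "\<And>x y z. \<exists>\<epsilon>>0. P (x - \<epsilon>) (x + \<epsilon>) (y - \<epsilon>) (y + \<epsilon>) (z - \<epsilon>) (z + \<epsilon>)"
    and "a \<le> b" "c \<le> d" "e \<le> f"
  shows "P a b c d e f"
proof -
  have 1: "\<exists>\<epsilon>>0. P a b (y - \<epsilon>) (y + \<epsilon>) (z - \<epsilon>) (z + \<epsilon>)" for y z
    using \<open>a \<le> b\<close>
  proof (induction rule: Bolzano)
    case (trans a b c)
    then obtain e1 e2 where e: "e1 > 0" "P a b (y - e1) (y + e1) (z - e1) (z + e1)" 
        "e2 > 0" "P b c (y - e2) (y + e2) (z - e2) (z + e2)" by blast
    let ?e = "min e1 e2"
    have "P a b (y - ?e) (y + ?e) (z - ?e) (z + ?e)" by (rule mono[OF e(2)]) simp_all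
    moreover have "P b c (y - ?e) (y + ?e) (z - ?e) (z + ?e)" by (rule mono[OF e(4)]) simp_all
    ultimately have "P a c (y - ?e) (y + ?e) (z - ?e) (z + ?e)" using m1 trans by blast
    then show ?case using e by (intro exI[of _ ?e]) auto
  next
    case (local x)
    obtain \<epsilon> where e: "\<epsilon> > 0" "P (x - \<epsilon>) (x + \<epsilon>) (y - \<epsilon>) (y + \<epsilon>) (z - \<epsilon>) (z + \<epsilon>)" using loc by blast
    show ?case
    proof (intro exI[of _ \<epsilon>] conjI allI impI)
      fix a b assume "a \<le> x \<and> x \<le> b \<and> b - a < \<epsilon>"
      then show "P a b (y - \<epsilon>) (y + \<epsilon>) (z - \<epsilon>) (z + \<epsilon>)" by (intro mono[OF e(2)]) auto
    qed (use e in auto)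
  qed
  have 2: "\<exists>\<epsilon>>0. P a b c d (z - \<epsilon>) (z + \<epsilon>)" for z
    using \<open>c \<le> d\<close>
  proof (induction rule: Bolzano)
    case (trans c d d')
    then obtain e1 e2 where e: "e1 > 0" "P a b c d (z - e1) (z + e1)" 
        "e2 > 0" "P a b d d' (z - e2) (z + e2)" by blast
    let ?e = "min e1 e2"
    have "P a b c d (z - ?e) (z + ?e)" by (rule mono[OF e(2)]) simp_all
    moreover have "P a b d d' (z - ?e) (z + ?e)" by (rule mono[OF e(4)]) simp_all
    ultimately have "P a b c d' (z - ?e) (z + ?e)" using m2 trans by blast
    then show ?case using e by (intro exI[of _ ?e]) auto
  next
    case (local y)
    obtain \<epsilon> where e: "\<epsilon> > 0" "P a b (y - \<epsilon>) (y + \<epsilon>) (z - \<epsilon>) (z + \<epsilon>)" using 1 by blast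
    show ?case
    proof (intro exI[of _ \<epsilon>] conjI allI impI)
      fix c d assume "c \<le> y \<and> y \<le> d \<and> d - c < \<epsilon>"
      then show "P a b c d (z - \<epsilon>) (z + \<epsilon>)" by (intro mono[OF e(2)]) auto
    qed (use e in auto)
  qed
  show ?thesis
    using \<open>e \<le> f\<close>
  proof (induction rule: Bolzano)
    case (trans e f f') then show ?case using m3 by blast
  next
    case (local z)
    obtain \<epsilon> where e: "\<epsilon> > 0" "P a b c d (z - \<epsilon>) (z + \<epsilon>)" using 2 by blast
    show ?case
    proof (intro exI[of _ \<epsilon>] conjI allI impI)
      fix e' f assume "e' \<le> z \<and> z \<le> f \<and> f - e' < \<epsilon>"
      then show "P a b c d e' f" by (intro mono[OF e(2)]) auto
    qed (use e in auto)
  qed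
qed

text \<open>Sections over two boxes with a common face can be glued, because the projection to the
  face is a retraction; \<open>box_induct\<close> then passes from charts to arbitrary
  boxes.\<close>

lemma nonvanishing_section_box:
  fixes D :: "((real \<times> real \<times> real) set \<times> (real \<times> real \<times> real \<Rightarrow> complex)) set"
  assumes "line_bundle_atlas D" "a \<le> b" "c \<le> d" "e \<le> f"
  shows "\<exists>u. nonvanishing_section D ({a..b} \<times> {c..d} \<times> {e..f}) u"
proof -
  interpret line_bundle_atlas D by fact
  let ?B = "\<lambda>a b c d e f. {a..b} \<times> {c..d} \<times> {e..f} :: (real \<times> real \<times> real) set"
  let ?P = "\<lambda>a b c d e f. \<exists>u. nonvanishing_section D (?B a b c d e f) u"
  have cl: "closed (?B a b c d e f)" for a b c d e f
    by (intro closed_Times closed_atLeastAtMost)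
  have "?P a b c d e f"
  proof (rule box_induct[where P = ?P])
    fix a b c d e f a' b' c' d' e' f' :: real
    assume "?P a b c d e f" "a \<le> a'" "b' \<le> b" "c \<le> c'" "d' \<le> d" "e \<le> e'" "f' \<le> f"
    moreover from this have "?B a' b' c' d' e' f' \<subseteq> ?B a b c d e f" by auto
    ultimately show "?P a' b' c' d' e' f'" using nonvanishing_section_subset by blast
  next
    fix a b b' c d e f :: real
    assume *: "?P a b c d e f" "?P b b' c d e f" "a \<le> b" "b \<le> b'"
    then obtain u v where uv: "nonvanishing_section D (?B a b c d e f) u" "nonvanishing_section D (?B b b' c d e f) v" by blast
    have "\<exists>w. nonvanishing_section D (?B a b c d e f \<union> ?B b b' c d e f) w"
      by (rule nonvanishing_section_glue[OF uv cl cl, where r = "\<lambda>p. (b, snd p)"])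
        (use * in \<open>auto intro!: continuous_intros\<close>)
    moreover have "?B a b c d e f \<union> ?B b b' c d e f = ?B a b' c d e f" using * by auto
    ultimately show "?P a b' c d e f" by simp
  next
    fix a b c d d' e f :: real
    assume *: "?P a b c d e f" "?P a b d d' e f" "c \<le> d" "d \<le> d'"
    then obtain u v where uv: "nonvanishing_section D (?B a b c d e f) u" "nonvanishing_section D (?B a b d d' e f) v" by blast
    have "\<exists>w. nonvanishing_section D (?B a b c d e f \<union> ?B a b d d' e f) w"
      by (rule nonvanishing_section_glue[OF uv cl cl, where r = "\<lambda>p. (fst p, d, snd (snd p))"])
        (use * in \<open>auto intro!: continuous_intros\<close>)
    moreover have "?B a b c d e f \<union> ?B a b d d' e f = ?B a b c d' e f" using * by auto
    ultimately show "?P a b c d' e f" by simp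
  next
    fix a b c d e f f' :: real
    assume *: "?P a b c d e f" "?P a b c d f f'" "e \<le> f" "f \<le> f'"
    then obtain u v where uv: "nonvanishing_section D (?B a b c d e f) u" "nonvanishing_section D (?B a b c d f f') v" by blast
    have "\<exists>w. nonvanishing_section D (?B a b c d e f \<union> ?B a b c d f f') w"
      by (rule nonvanishing_section_glue[OF uv cl cl, where r = "\<lambda>p. (fst p, fst (snd p), f)"])
        (use * in \<open>auto intro!: continuous_intros\<close>)
    moreover have "?B a b c d e f \<union> ?B a b c d f f' = ?B a b c d e f'" using * by auto
    ultimately show "?P a b c d e f'" by simp
  next
    fix x y z :: real
    obtain U d where U: "(U, d) \<in> D" "(x, y, z) \<in> U" using covers by blast
    obtain A V where A: "open A" "open V" "x \<in> A" "(y, z) \<in> V" "A \<times> V \<subseteq> U"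
      using open_prod_elim[OF open_dom[OF U(1)] U(2)] by (metis mem_Sigma_iff)
    obtain B C where B: "open B" "open C" "y \<in> B" "z \<in> C" "B \<times> C \<subseteq> V"
      using open_prod_elim[OF A(2,4)] by (metis mem_Sigma_iff)
    obtain e1 e2 e3 where e: "e1 > 0" "cball x e1 \<subseteq> A" "e2 > 0" "cball y e2 \<subseteq> B" "e3 > 0" "cball z e3 \<subseteq> C"
      using A B open_contains_cball by metis
    let ?e = "min e1 (min e2 e3)"
    have "{x - ?e..x + ?e} \<subseteq> cball x e1" "{y - ?e..y + ?e} \<subseteq> cball y e2"
        "{z - ?e..z + ?e} \<subseteq> cball z e3"
      unfolding cball_eq_atLeastAtMost by auto
    then have "{x - ?e..x + ?e} \<subseteq> A" "{y - ?e..y + ?e} \<subseteq> B" "{z - ?e..z + ?e} \<subseteq> C"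
      using e by blast+
    then have "?B (x - ?e) (x + ?e) (y - ?e) (y + ?e) (z - ?e) (z + ?e) \<subseteq> U"
      using A B by blast
    then have "?P (x - ?e) (x + ?e) (y - ?e) (y + ?e) (z - ?e) (z + ?e)"
      using nonvanishing_section_subset[OF nonvanishing_section_local[OF U(1)]] by blast
    then show "\<exists>\<epsilon>>0. ?P (x - \<epsilon>) (x + \<epsilon>) (y - \<epsilon>) (y + \<epsilon>) (z - \<epsilon>) (z + \<epsilon>)"
      using e by (intro exI[of _ ?e]) auto
  qed (use assms in auto)
  then show ?thesis .
qed

text \<open>Over a large box the line bundle has a nonvanishing section, and with respect to it \<open>x\<close>, \<open>y\<close>, \<open>t\<close>
  act by functions with logarithms. The relations turn into equations between logarithms with the
  constant errors \<open>C\<close>, \<open>A\<close>, \<open>B\<close>; since \<open>y\<close> inverts \<open>x\<close>, they combine to \<open>2 C = 0\<close>, while \<open>exp C\<close> is the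
  sign by which \<open>z\<close> acts.\<close>

theorem central_sign_trivial:
  fixes D :: "((real \<times> real \<times> real) set \<times> (real \<times> real \<times> real \<Rightarrow> complex)) set"
    and X Y T :: "real \<times> real \<times> real \<Rightarrow> real \<times> real \<times> real"
    and \<theta>x \<theta>y \<theta>t \<theta>z :: "real \<times> real \<times> real \<Rightarrow> complex"
  assumes D: "line_bundle_atlas D"
    and X: "\<And>a b c. X (a, b, c) = (a + 1, b, c)"
    and Y: "\<And>a b c. Y (a, b, c) = (- a, b + 1, c)"
    and T: "\<And>a b c. T (a, b, c) = (a, b, c + 1)"
    and nz: "\<And>p. \<theta>x p \<noteq> 0" "\<And>p. \<theta>y p \<noteq> 0" "\<And>p. \<theta>t p \<noteq> 0" "\<And>p. \<theta>z p \<noteq> 0"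
    and Dx: "\<And>U d. (U, d) \<in> D \<Longrightarrow> \<exists>(V, e)\<in>D. \<forall>p\<in>U. X p \<in> V \<and> e (X p) = d p * \<theta>x p"
    and Dy: "\<And>U d. (U, d) \<in> D \<Longrightarrow> \<exists>(V, e)\<in>D. \<forall>p\<in>U. Y p \<in> V \<and> e (Y p) = d p * \<theta>y p"
    and Dt: "\<And>U d. (U, d) \<in> D \<Longrightarrow> \<exists>(V, e)\<in>D. \<forall>p\<in>U. T p \<in> V \<and> e (T p) = d p * \<theta>t p"
    and Dz: "\<And>U d. (U, d) \<in> D \<Longrightarrow> \<exists>(V, e)\<in>D. \<forall>p\<in>U. p \<in> V \<and> e p = d p * \<theta>z p"
    and xyx: "\<And>p. \<theta>x (Y (X p)) * \<theta>y (X p) * \<theta>x p = \<theta>y p"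
    and tx: "\<And>p. \<theta>t (X p) * \<theta>x p = \<theta>z (X (T p)) * \<theta>x (T p) * \<theta>t p"
    and ty: "\<And>p. \<theta>t (Y p) * \<theta>y p = \<theta>y (T p) * \<theta>t p"
    and zz: "\<And>p. \<theta>z p * \<theta>z p = 1"
  shows "\<theta>z p = 1"
proof -
  interpret line_bundle_atlas D by fact
  define Q where "Q r = {-r..r} \<times> {-r..r} \<times> {-r..r}" for r :: real
  have convQ: "convex (Q r)" for r
    unfolding Q_def by (intro convex_Times convex_real_interval)
  have contX: "continuous_on S X" for S
  proof -
    have "X = (\<lambda>p. (fst p + 1, snd p))" using X by auto
    then show ?thesis by (auto intro!: continuous_intros)
  qed
  have contY: "continuous_on S Y" for S
  proof -
    have "Y = (\<lambda>p. (- fst p, fst (snd p) + 1, snd (snd p)))" using Y by auto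
    then show ?thesis by (auto intro!: continuous_intros)
  qed
  have contT: "continuous_on S T" for S
  proof -
    have "T = (\<lambda>p. (fst p, fst (snd p), snd (snd p) + 1))" using T by auto
    then show ?thesis by (auto intro!: continuous_intros)
  qed
  have XQ: "p \<in> Q r \<Longrightarrow> X p \<in> Q (r + 1)" for p r by (cases p) (auto simp: Q_def X)
  have YQ: "p \<in> Q r \<Longrightarrow> Y p \<in> Q (r + 1)" for p r by (cases p) (auto simp: Q_def Y)
  have TQ: "p \<in> Q r \<Longrightarrow> T p \<in> Q (r + 1)" for p r by (cases p) (auto simp: Q_def T)
  \<comment> \<open>The factor of z squares to 1, so it is a sign at each point; its continuity,
    read off in charts, makes the sign constant over the connected space.\<close>
  have "continuous_on UNIV \<theta>z"
  proof (rule continuous_on_locally)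
    fix p
    obtain U d where U: "(U, d) \<in> D" "p \<in> U" using covers by blast
    obtain V e where V: "(V, e) \<in> D" "\<forall>p\<in>U. p \<in> V \<and> e p = d p * \<theta>z p" using Dz[OF U(1)] by blast
    have "continuous_on U (\<lambda>p. e p / d p)"
      using compatible[OF U(1) V(1)] V(2) by (elim continuous_on_subset) auto
    then have "continuous_on U \<theta>z"
      by (rule continuous_on_eq) (use V nonzero[OF U(1)] in auto)
    then show "\<exists>U. open U \<and> p \<in> U \<and> continuous_on (UNIV \<inter> U) \<theta>z"
      using U open_dom by auto
  qed
  moreover have "range \<theta>z \<subseteq> {1, -1}"
  proof
    fix w assume "w \<in> range \<theta>z"
    then have "w * w = 1" using zz by auto
    then show "w \<in> {1, -1}" using square_eq_1_iff by auto
  qed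
  then have "finite (range \<theta>z)" by (rule finite_subset) auto
  ultimately have "\<theta>z constant_on UNIV"
    using continuous_finite_range_constant[of UNIV \<theta>z] by auto
  then obtain s where s: "\<And>p. \<theta>z p = s" by (auto simp: constant_on_def)

  \<comment> \<open>Each of \<open>X\<close>, \<open>Y\<close>, \<open>T\<close> enlarges a box by
    at most 1. Logarithms are wanted on \<open>Q 3\<close>, so the section must reach
    \<open>Q 4\<close>; the relations are evaluated on \<open>Q 1\<close>, from which words of
    length two stay in \<open>Q 3\<close>.\<close>
  obtain u where u: "nonvanishing_section D (Q 4) u"
    using nonvanishing_section_box[OF D, of "-4" 4 "-4" 4 "-4" 4] unfolding Q_def by auto
  have u0: "u p \<noteq> 0" if "p \<in> Q 4" for p using u that by (auto simp: nonvanishing_section_def)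
  have log: "\<exists>\<phi>. continuous_on (Q 3) \<phi> \<and> (\<forall>p\<in>Q 3. u (g p) * \<theta> p / u p = exp (\<phi> p))"
    if g: "continuous_on UNIV g" "\<And>p. p \<in> Q 3 \<Longrightarrow> g p \<in> Q 4" and nz: "\<And>p. \<theta> p \<noteq> 0"
      and D': "\<And>U d. (U, d) \<in> D \<Longrightarrow> \<exists>(V, e)\<in>D. \<forall>p\<in>U. g p \<in> V \<and> e (g p) = d p * \<theta> p"
    for g and \<theta> :: "real \<times> real \<times> real \<Rightarrow> complex"
  proof -
    have Q34: "Q 3 \<subseteq> Q 4" by (auto simp: Q_def)
    have "continuous_on (Q 3) (\<lambda>p. u (g p) * \<theta> p / u p)"
    proof (rule continuous_on_locally)
      fix p assume "p \<in> Q 3"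
      obtain U d where U: "(U, d) \<in> D" "p \<in> U" using covers by blast
      obtain V e where V: "(V, e) \<in> D" "\<forall>p\<in>U. g p \<in> V \<and> e (g p) = d p * \<theta> p" using D'[OF U(1)] by blast
      have "continuous_on (Q 4 \<inter> V) (\<lambda>p. u p * e p)"
        using u V unfolding nonvanishing_section_def by auto
      then have "continuous_on (Q 3 \<inter> U) (\<lambda>p. u (g p) * e (g p))"
        by (rule continuous_on_compose2) (use g V in \<open>auto elim: continuous_on_subset\<close>)
      moreover have "continuous_on (Q 3 \<inter> U) (\<lambda>p. u p * d p)"
        using u U Q34 unfolding nonvanishing_section_def by (auto intro: continuous_on_subset)
      \<comment> \<open>The chart over the image satisfies
        \<open>e (g p) = d p * \<theta> p\<close>, so \<open>d p\<close> cancels and the quotient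
        becomes the factor by which \<open>g\<close> acts in the trivialization
        \<open>u\<close>.\<close>
      ultimately have "continuous_on (Q 3 \<inter> U) (\<lambda>p. (u (g p) * e (g p)) / (u p * d p))"
        using Q34 u0 nonzero[OF U(1)] by (intro continuous_on_divide) auto
      then have "continuous_on (Q 3 \<inter> U) (\<lambda>p. u (g p) * \<theta> p / u p)"
        by (rule continuous_on_eq) (use V nonzero[OF U(1)] in auto)
      then show "\<exists>U. open U \<and> p \<in> U \<and> continuous_on (Q 3 \<inter> U) (\<lambda>p. u (g p) * \<theta> p / u p)"
        using U open_dom by auto
    qed
    moreover have "contractible (Q 3)" by (rule convex_imp_contractible[OF convQ])
    moreover have "u (g p) * \<theta> p / u p \<noteq> 0" if "p \<in> Q 3" for p
    proof -
      have "u (g p) \<noteq> 0" "u p \<noteq> 0" using that u0 g Q34 by blast+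
      then show ?thesis using nz[of p] by simp
    qed
    ultimately obtain \<phi> where "continuous_on (Q 3) \<phi>" "\<And>p. p \<in> Q 3 \<Longrightarrow> u (g p) * \<theta> p / u p = exp (\<phi> p)"
      by (rule continuous_logarithm_on_contractible) auto
    then show ?thesis by blast
  qed
  obtain \<phi>x where x: "continuous_on (Q 3) \<phi>x" "\<And>p. p \<in> Q 3 \<Longrightarrow> u (X p) * \<theta>x p / u p = exp (\<phi>x p)"
    using log[OF contX _ nz(1) Dx] XQ[of _ 3] by auto
  obtain \<phi>y where y: "continuous_on (Q 3) \<phi>y" "\<And>p. p \<in> Q 3 \<Longrightarrow> u (Y p) * \<theta>y p / u p = exp (\<phi>y p)"
    using log[OF contY _ nz(2) Dy] YQ[of _ 3] by auto
  obtain \<phi>t where t: "continuous_on (Q 3) \<phi>t" "\<And>p. p \<in> Q 3 \<Longrightarrow> u (T p) * \<theta>t p / u p = exp (\<phi>t p)"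
    using log[OF contT _ nz(3) Dt] TQ[of _ 3] by auto
  have sub: "p \<in> Q a \<Longrightarrow> a \<le> b \<Longrightarrow> p \<in> Q b" for p a b by (auto simp: Q_def)
  have comp: "continuous_on (Q 1) (\<lambda>p. f (g p))"
    if "continuous_on (Q 3) f" "continuous_on UNIV g" "\<And>p. p \<in> Q 1 \<Longrightarrow> g p \<in> Q 3"
    for f :: "real \<times> real \<times> real \<Rightarrow> complex" and g
    by (rule continuous_on_compose2[OF that(1)]) (use that in \<open>auto elim: continuous_on_subset\<close>)
  have XY: "continuous_on UNIV (\<lambda>p. Y (X p))" 
    by (rule continuous_on_compose2[OF contY[of UNIV] contX]) auto
  have pt: "X p \<in> Q 3" "Y p \<in> Q 3" "T p \<in> Q 3" "Y (X p) \<in> Q 3" "p \<in> Q 3" if "p \<in> Q 1" for p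
    using XQ[OF that] YQ[OF that] TQ[OF that] YQ[OF XQ[OF that]] that sub[of _ 2 3] sub[of _ 1 3] by auto
  \<comment> \<open>Logarithmic forms of the relations \<open>tx\<close>, \<open>xyx\<close> and
    \<open>ty\<close>, in this order. They vanish up to the ambiguity of the logarithm and, for
    \<open>C\<close>, up to the sign of z.\<close>
  define C where "C p = \<phi>t (X p) + \<phi>x p - \<phi>x (T p) - \<phi>t p" for p
  define A where "A p = \<phi>x (Y (X p)) + \<phi>y (X p) + \<phi>x p - \<phi>y p" for p
  define B where "B p = \<phi>t (Y p) + \<phi>y p - \<phi>y (T p) - \<phi>t p" for p
  have nzu: "u p \<noteq> 0" "u (X p) \<noteq> 0" "u (Y p) \<noteq> 0" "u (T p) \<noteq> 0" "u (T (X p)) \<noteq> 0" "u (Y (X p)) \<noteq> 0" "u (T (Y p)) \<noteq> 0" if "p \<in> Q 1" for p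
    using XQ[OF that] YQ[OF that] TQ[OF that] YQ[OF XQ[OF that]] TQ[OF XQ[OF that]] TQ[OF YQ[OF that]] that sub[of _ 2 4] sub[of _ 1 4] sub[of _ 3 4] u0 by auto
  have TX: "T (X p) = X (T p)" "T (Y p) = Y (T p)" "X (Y (X p)) = Y p" for p by (cases p; simp add: X Y T)+
  \<comment> \<open>The values of \<open>u\<close> telescope along the two paths from
    \<open>p\<close> to \<open>T (X p)\<close>, so only the factors of the action remain.\<close>
  have eC: "exp (C p) = s" if "p \<in> Q 1" for p
  proof -
    have "exp (C p) = (u (T (X p)) * \<theta>t (X p) / u (X p)) * (u (X p) * \<theta>x p / u p) /
        (u (X (T p)) * \<theta>x (T p) / u (T p)) / (u (T p) * \<theta>t p / u p)"
      unfolding C_def exp_diff exp_add using x(2) t(2) pt[OF that] by simp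
    also have "\<dots> = (\<theta>t (X p) * \<theta>x p) / (\<theta>x (T p) * \<theta>t p)"
      using nzu[OF that] nz by (simp add: TX field_simps)
    also have "\<dots> = s" using tx[of p] nz by (simp add: s)
    finally show ?thesis .
  qed
  have eA: "exp (A p) = 1" if "p \<in> Q 1" for p
  proof -
    have "exp (A p) = (u (X (Y (X p))) * \<theta>x (Y (X p)) / u (Y (X p))) * (u (Y (X p)) * \<theta>y (X p) / u (X p)) *
        (u (X p) * \<theta>x p / u p) / (u (Y p) * \<theta>y p / u p)"
      unfolding A_def exp_diff exp_add using x(2) y(2) pt[OF that] by simp
    also have "\<dots> = (\<theta>x (Y (X p)) * \<theta>y (X p) * \<theta>x p) / \<theta>y p"
      using nzu[OF that] nz by (simp add: TX field_simps)
    also have "\<dots> = 1" using xyx[of p] nz by simp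
    finally show ?thesis .
  qed
  have eB: "exp (B p) = 1" if "p \<in> Q 1" for p
  proof -
    have "exp (B p) = (u (T (Y p)) * \<theta>t (Y p) / u (Y p)) * (u (Y p) * \<theta>y p / u p) /
        (u (Y (T p)) * \<theta>y (T p) / u (T p)) / (u (T p) * \<theta>t p / u p)"
      unfolding B_def exp_diff exp_add using y(2) t(2) pt[OF that] by simp
    also have "\<dots> = (\<theta>t (Y p) * \<theta>y p) / (\<theta>y (T p) * \<theta>t p)"
      using nzu[OF that] nz by (simp add: TX field_simps)
    also have "\<dots> = 1" using ty[of p] nz by simp
    finally show ?thesis .
  qed
  have Q1: "connected (Q 1)" by (rule convex_connected[OF convQ])
  have cid: "continuous_on UNIV (\<lambda>p. p)" by (rule continuous_on_id)
  have "continuous_on (Q 1) C" unfolding C_def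
    by (intro continuous_intros comp[OF t(1) contX] comp[OF x(1) cid] comp[OF x(1) contT] comp[OF t(1) cid])
      (auto dest: pt)
  from continuous_exp_constant_imp_constant[OF Q1 this eC]
  have C: "C p = C q" if "p \<in> Q 1" "q \<in> Q 1" for p q using that by blast
  have "continuous_on (Q 1) A" unfolding A_def
    by (intro continuous_intros comp[OF x(1) XY] comp[OF x(1) cid] comp[OF y(1) contX] comp[OF y(1) cid])
      (auto dest: pt)
  from continuous_exp_constant_imp_constant[OF Q1 this eA]
  have A: "A p = A q" if "p \<in> Q 1" "q \<in> Q 1" for p q using that by blast
  have "continuous_on (Q 1) B" unfolding B_def
    by (intro continuous_intros comp[OF t(1) contY] comp[OF y(1) cid] comp[OF y(1) contT] comp[OF t(1) cid])
      (auto dest: pt)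
  from continuous_exp_constant_imp_constant[OF Q1 this eB]
  have B: "B p = B q" if "p \<in> Q 1" "q \<in> Q 1" for p q using that by blast
  define p0 where "p0 = (0 :: real, 0 :: real, 0 :: real)"
  have mem: "p0 \<in> Q 1" "X p0 \<in> Q 1" "T p0 \<in> Q 1" "Y (X p0) \<in> Q 1" by (auto simp: Q_def p0_def X Y T)
  have maps: "X (T p0) = T (X p0)" "Y (T (X p0)) = T (Y (X p0))" "X (Y (X p0)) = Y p0"
    by (auto simp: p0_def X Y T)
  \<comment> \<open>The difference of \<open>A\<close> in the t-direction and that of
    \<open>B\<close> in the x-direction vanish by constancy. Their sum compares the x-t-square at
    \<open>p0\<close> with the one at \<open>Y (X p0)\<close>, whose orientation is reversed, so the
    constant \<open>C\<close> equals its own negative.\<close>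
  have "A (T p0) - A p0 = 0" "B (X p0) - B p0 = 0" "C (Y (X p0)) = C p0"
    using A[of "T p0" p0] B[of "X p0" p0] C[of "Y (X p0)" p0] mem by auto
  moreover have "A (T p0) - A p0 + (B (X p0) - B p0) + C (Y (X p0)) = - C p0"
    unfolding A_def B_def C_def maps by simp
  ultimately have "C p0 + C p0 = 0" by (simp add: add_eq_0_iff2)
  then have "C p0 = 0" by simp
  then show ?thesis using eC[OF mem(1)] s by simp
qed

subsection \<open>The group\<close>

text \<open>The effect of the n-th power of y on the x-direction, needed both for integer exponents
  and for real coordinates.\<close>

definition sg :: "int \<Rightarrow> 'a::ab_group_add \<Rightarrow> 'a" where
  "sg n x = (if even n then x else - x)"

lemma sg_0 [simp]: "sg 0 x = x" "sg n 0 = 0"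
  by (simp_all add: sg_def)

text \<open>\<open>(m, n, k, e)\<close> stands for \<open>x\<^sup>m y\<^sup>n t\<^sup>k z\<^sup>e\<close> in the group generated by \<open>x, y, t, z\<close> subject to
  \<open>z\<^sup>2 = 1\<close>, \<open>z\<close> central, \<open>y x y\<^sup>-\<^sup>1 = x\<^sup>-\<^sup>1\<close>, \<open>[t, x] = z\<close> and \<open>[t, y] = 1\<close>.\<close>

fun cmul :: "int \<times> int \<times> int \<times> bool \<Rightarrow> int \<times> int \<times> int \<times> bool \<Rightarrow> int \<times> int \<times> int \<times> bool" where
  "cmul (m, n, k, e) (m', n', k', e') = (m + sg n m', n + n', k + k', (e \<noteq> e') \<noteq> odd (k * m'))"

text \<open>The carrier of the witness is to be a set of natural numbers, so the group of quadruples
  is transported along a bijection.\<close>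

definition enc :: "int \<times> int \<times> int \<times> bool \<Rightarrow> nat" where
  "enc = to_nat_on UNIV"

definition dec :: "nat \<Rightarrow> int \<times> int \<times> int \<times> bool" where
  "dec = inv_into UNIV enc"

definition crys :: "nat monoid" where
  "crys = \<lparr>carrier = UNIV, mult = (\<lambda>a b. enc (cmul (dec a) (dec b))), one = enc (0, 0, 0, False)\<rparr>"

lemma bij_enc: "bij enc"
proof -
  have "infinite (UNIV :: (int \<times> int \<times> int \<times> bool) set)"
    by (simp add: finite_prod infinite_UNIV_int)
  then show ?thesis unfolding enc_def by (intro to_nat_on_infinite) auto
qed

lemma dec_enc [simp]: "dec (enc q) = q"
  using bij_enc by (simp add: dec_def bij_is_inj)

lemma enc_dec [simp]: "enc (dec g) = g"
  using bij_enc by (simp add: dec_def bij_is_surj surj_f_inv_f)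

lemma enc_eq_iff [simp]: "enc q = enc q' \<longleftrightarrow> q = q'"
  by (metis dec_enc)

lemma enc_cases [cases type]: obtains m n k e where "g = enc (m, n, k, e)"
  by (metis enc_dec prod_cases4)

lemma carrier_crys [simp]: "carrier crys = UNIV"
  by (simp add: crys_def)

lemma mult_crys: "enc q \<otimes>\<^bsub>crys\<^esub> enc q' = enc (cmul q q')"
  by (simp add: crys_def)

lemma one_crys: "\<one>\<^bsub>crys\<^esub> = enc (0, 0, 0, False)"
  by (simp add: crys_def)

text \<open>The twist \<open>odd (k * m')\<close> is bilinear modulo 2, hence a cocycle:
  \<open>sg\<close> does not change parities, so the inversion of x by y leaves it alone.\<close>

lemma group_crys: "group crys"
proof (rule groupI)
  fix x y z :: nat
  obtain a b c d where [simp]: "x = enc (a, b, c, d)" by (rule enc_cases)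
  obtain a' b' c' d' where [simp]: "y = enc (a', b', c', d')" by (rule enc_cases)
  obtain a'' b'' c'' d'' where [simp]: "z = enc (a'', b'', c'', d'')" by (rule enc_cases)
  show "x \<otimes>\<^bsub>crys\<^esub> y \<otimes>\<^bsub>crys\<^esub> z = x \<otimes>\<^bsub>crys\<^esub> (y \<otimes>\<^bsub>crys\<^esub> z)"
    by (auto simp: mult_crys sg_def algebra_simps)
  show "\<one>\<^bsub>crys\<^esub> \<otimes>\<^bsub>crys\<^esub> x = x"
    by (simp add: mult_crys one_crys)
  \<comment> \<open>The last entry compensates the sign that arises when the power of t is moved
    past the power of x.\<close>
  have "enc (- sg b a, - b, - c, d \<noteq> odd (c * a)) \<otimes>\<^bsub>crys\<^esub> x = \<one>\<^bsub>crys\<^esub>"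
    by (auto simp: mult_crys one_crys sg_def)
  then show "\<exists>y\<in>carrier crys. y \<otimes>\<^bsub>crys\<^esub> x = \<one>\<^bsub>crys\<^esub>" by auto
qed auto

text \<open>Only the subgroup generated by z; the squares of y and of t are central as well.\<close>

definition centre :: "nat set" where
  "centre = {enc (0, 0, 0, e) | e. True}"

lemma centre_eq: "centre = {enc (0, 0, 0, False), enc (0, 0, 0, True)}"
  by (auto simp: centre_def)

lemma finite_centre: "finite centre"
  by (simp add: centre_eq)

lemma centre_commutes: "g \<in> centre \<Longrightarrow> g \<otimes>\<^bsub>crys\<^esub> h = h \<otimes>\<^bsub>crys\<^esub> g"
  by (cases h) (auto simp: centre_eq mult_crys)

lemma inv_centre: "g \<in> centre \<Longrightarrow> inv\<^bsub>crys\<^esub> g = g"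
  by (rule group.inv_equality[OF group_crys]) (auto simp: centre_eq mult_crys one_crys)

lemma subgroup_centre: "subgroup centre crys"
  by (rule group.subgroupI[OF group_crys]) (auto simp: inv_centre centre_eq mult_crys)

text \<open>At an element where the absolute value of \<open>f\<close> is maximal on
  \<open>H\<close>, doubling cannot increase it, so the maximum is 0. It is applied with squaring as
  \<open>d\<close> and an exponent as \<open>f\<close>.\<close>

lemma doubling_finite_imp_0:
  fixes f :: "'a \<Rightarrow> int"
  assumes "finite H" "\<And>h. h \<in> H \<Longrightarrow> d h \<in> H" "\<And>h. h \<in> H \<Longrightarrow> f (d h) = 2 * f h" "h \<in> H"
  shows "f h = 0"
proof -
  have "Max ((\<lambda>h. \<bar>f h\<bar>) ` H) \<in> (\<lambda>h. \<bar>f h\<bar>) ` H"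
    using assms(1,4) by (intro Max_in) auto
  then obtain k where k: "k \<in> H" "\<bar>f k\<bar> = Max ((\<lambda>h. \<bar>f h\<bar>) ` H)" by auto
  then have k: "k \<in> H" "\<And>h. h \<in> H \<Longrightarrow> \<bar>f h\<bar> \<le> \<bar>f k\<bar>"
    using assms(1) by auto
  have "\<bar>2 * f k\<bar> \<le> \<bar>f k\<bar>" using k(2)[OF assms(2)[OF k(1)]] assms(3)[OF k(1)] by simp
  then have "f k = 0" by linarith
  then show ?thesis using k(2)[OF assms(4)] by simp
qed

text \<open>Squaring doubles the exponents of y and t in every element, but that of x only when the
  exponent of y is even; for odd powers of y it cancels. Hence the x-exponent comes last.\<close>

lemma finite_subgroup_subset_centre:
  assumes "subgroup H crys" "finite H"
  shows "H \<subseteq> centre"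
proof
  fix h assume h: "h \<in> H"
  let ?d = "\<lambda>h. h \<otimes>\<^bsub>crys\<^esub> h"
  have d: "h \<in> H \<Longrightarrow> ?d h \<in> H" for h using assms(1) by (rule subgroup.m_closed)
  have dn: "fst (snd (dec (?d h))) = 2 * fst (snd (dec h))"
    and dk: "fst (snd (snd (dec (?d h)))) = 2 * fst (snd (snd (dec h)))" for h
    by (cases h; simp add: mult_crys)+
  have n: "fst (snd (dec h)) = 0" if "h \<in> H" for h
    by (rule doubling_finite_imp_0[where d = ?d and f = "\<lambda>h. fst (snd (dec h))", OF assms(2) d dn that])
  have k: "fst (snd (snd (dec h))) = 0" if "h \<in> H" for h
    by (rule doubling_finite_imp_0[where d = ?d and f = "\<lambda>h. fst (snd (snd (dec h)))", OF assms(2) d dk that])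
  have m: "fst (dec (?d h)) = 2 * fst (dec h)" if "h \<in> H" for h
    using n[OF that] by (cases h) (auto simp: mult_crys)
  have "fst (dec h) = 0"
    by (rule doubling_finite_imp_0[where d = ?d and f = "\<lambda>h. fst (dec h)", OF assms(2) d m h])
  then show "h \<in> centre"
    using n[OF h] k[OF h] by (cases h) (auto simp: centre_def)
qed

lemma finite_subgroups_crys: "finite_subgroups crys = {{\<one>\<^bsub>crys\<^esub>}, centre}"
proof -
  have "H = {\<one>\<^bsub>crys\<^esub>} \<or> H = centre" if "subgroup H crys" "finite H" for H
    using finite_subgroup_subset_centre[OF that] subgroup.one_closed[OF that(1)]
    by (auto simp: centre_eq one_crys)
  then show ?thesis
    using subgroup_centre finite_centre group.triv_subgroup[OF group_crys]
    by (auto simp: finite_subgroups_def)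
qed

subsection \<open>The action on Euclidean space\<close>

abbreviation R3 :: "(nat \<Rightarrow> real) set" where
  "R3 \<equiv> {v. \<forall>i\<ge>3. v i = 0}"

lemma less_3_iff: "i < 3 \<longleftrightarrow> i = 0 \<or> i = 1 \<or> i = (2 :: nat)"
  by auto

lemma R3_eqI: "v \<in> R3 \<Longrightarrow> w \<in> R3 \<Longrightarrow> v 0 = w 0 \<Longrightarrow> v 1 = w 1 \<Longrightarrow> v 2 = w 2 \<Longrightarrow> v = w"
proof
  fix i :: nat assume *: "v \<in> R3" "w \<in> R3" "v 0 = w 0" "v 1 = w 1" "v 2 = w 2"
  consider "i = 0" | "i = 1" | "i = 2" | "i \<ge> 3" by linarith
  then show "v i = w i" by cases (use * in auto)
qed

text \<open>The deck group of R^3 over the Klein bottle times a circle: y is a glide reflection, and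
  z acts trivially.\<close>

fun move :: "int \<times> int \<times> int \<times> bool \<Rightarrow> (nat \<Rightarrow> real) \<Rightarrow> nat \<Rightarrow> real" where
  "move (m, n, k, e) v = (\<lambda>i. if i = 0 then of_int m + sg n (v 0) else if i = 1 then v 1 + of_int n
     else if i = 2 then v 2 + of_int k else 0)"

lemma move_R3 [simp]: "move q v \<in> R3" by (cases q) auto

lemma move_R3' [simp]: "i \<ge> 3 \<Longrightarrow> move q v i = 0" using move_R3[of q v] by simp

lemma move_cmul: "v \<in> R3 \<Longrightarrow> move (cmul q q') v = move q (move q' v)"
  by (cases q; cases q') (rule R3_eqI; auto simp: sg_def)

lemma move_zero: "v \<in> R3 \<Longrightarrow> move (0, 0, 0, e) v = v"
  by (rule R3_eqI) auto

lemma move_eq_iff: "v \<in> R3 \<Longrightarrow> w \<in> R3 \<Longrightarrow> move q v = move q w \<longleftrightarrow> v = w"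
proof
  assume *: "v \<in> R3" "w \<in> R3" "move q v = move q w"
  obtain m n k e where q: "q = (m, n, k, e)" by (cases q)
  have "move q v i = move q w i" for i using * by simp
  from this[of 0] this[of 1] this[of 2] show "v = w"
    using * by (intro R3_eqI) (auto simp: q sg_def split: if_splits)
qed auto

lemma continuous_move: "continuous_on S (move q)"
proof -
  obtain m n k e where q: "q = (m, n, k, e)" by (cases q)
  have *: "continuous_on S (\<lambda>v :: nat \<Rightarrow> real. v i)" for i
    by (rule continuous_on_product_then_coordinatewise[OF continuous_on_id])
  show ?thesis
  proof (rule continuous_on_coordinatewise_then_product)
    fix i :: nat
    consider "i = 0" | "i = 1" | "i = 2" | "i \<ge> 3" by linarith
    then show "continuous_on S (\<lambda>v. move q v i)"
      by cases (cases "even n"; auto simp: q sg_def intro!: continuous_intros *)+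
  qed
qed

text \<open>Restricted because the group of bijections that receives a \<open>group_action\<close>
  consists of extensional functions.\<close>

definition act :: "nat \<Rightarrow> (nat \<Rightarrow> real) \<Rightarrow> nat \<Rightarrow> real" where
  "act g = (\<lambda>v\<in>R3. move (dec g) v)"

lemma act_enc: "v \<in> R3 \<Longrightarrow> act (enc q) v = move q v"
  by (simp add: act_def)

lemma act_R3: "v \<in> R3 \<Longrightarrow> act g v \<in> R3"
  by (simp add: act_def)

lemma act_mult: "v \<in> R3 \<Longrightarrow> act (g \<otimes>\<^bsub>crys\<^esub> h) v = act g (act h v)"
  by (cases g; cases h) (simp only: mult_crys act_enc move_cmul move_R3)

lemma act_centre: "g \<in> centre \<Longrightarrow> v \<in> R3 \<Longrightarrow> act g v = v"
  by (auto simp: centre_def act_enc move_zero simp del: move.simps)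

lemma act_one: "v \<in> R3 \<Longrightarrow> act \<one>\<^bsub>crys\<^esub> v = v"
  using act_centre subgroup.one_closed[OF subgroup_centre] by blast

lemma act_inv: "v \<in> R3 \<Longrightarrow> act g (act (inv\<^bsub>crys\<^esub> g) v) = v" "v \<in> R3 \<Longrightarrow> act (inv\<^bsub>crys\<^esub> g) (act g v) = v"
  using act_mult[of v g "inv\<^bsub>crys\<^esub> g"] act_mult[of v "inv\<^bsub>crys\<^esub> g" g] group.r_inv[OF group_crys, of g]
    group.l_inv[OF group_crys, of g] act_one[of v] by auto

abbreviation E3 :: "(nat \<Rightarrow> real) topology" where
  "E3 \<equiv> Euclidean_space 3"

lemma topspace_Euclidean_3 [simp]: "topspace E3 = R3"
  by (simp add: topspace_Euclidean_space)

lemma Euclidean_space_eq: "Euclidean_space n = top_of_set {v. \<forall>i\<ge>n. v i = 0}"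
  by (simp add: Euclidean_space_def euclidean_product_topology)

lemma continuous_act: "continuous_map E3 E3 (act g)"
proof -
  have "continuous_on R3 (act g)"
    by (rule continuous_on_eq[OF continuous_move]) (auto simp: act_def)
  moreover have "act g ` R3 \<subseteq> R3" using act_R3 by blast
  ultimately show ?thesis by (simp add: Euclidean_space_eq image_subset_iff_funcset)
qed

lemma group_action_act: "group_action crys R3 act"
proof -
  have "act g \<in> Bij R3" for g
    unfolding Bij_def
  proof (intro IntI CollectI bij_betw_byWitness[where f' = "act (inv\<^bsub>crys\<^esub> g)"] ballI)
    show "act g \<in> extensional R3" by (simp add: act_def)
  qed (use act_inv act_R3 in blast)+
  moreover have "act (g \<otimes>\<^bsub>crys\<^esub> h) = compose R3 (act g) (act h)" for g h
    by (rule extensionalityI[of _ R3]) (auto simp: compose_def act_mult, simp_all add: act_def)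
  ultimately have "act \<in> hom crys (BijGroup R3)"
    by (auto simp: hom_def BijGroup_def)
  then show ?thesis
    by (simp add: group_action_def group_hom_def group_hom_axioms_def group_crys group_BijGroup)
qed

lemma G_space_act: "G_space crys E3 act"
  using group_action_act continuous_act by (simp add: G_space_def)

lemma stabilizer_act:
  assumes "v \<in> R3"
  shows "stabilizer crys act v \<subseteq> centre"
proof
  fix g assume "g \<in> stabilizer crys act v"
  then have g: "act g v = v" by (simp add: stabilizer_def)
  obtain m n k e where q: "g = enc (m, n, k, e)" by (cases g)
  have "move (m, n, k, e) v i = v i" for i using g assms by (simp add: q act_enc)
  from this[of 0] this[of 1] this[of 2] have "m = 0" "n = 0" "k = 0" by (auto simp: sg_def)
  then show "g \<in> centre" by (auto simp: q centre_def)
qed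

lemma fixed_points_act:
  assumes "H \<in> finite_subgroups crys"
  shows "fixed_points E3 act H = R3"
proof -
  have "H \<subseteq> centre"
    using assms finite_subgroup_subset_centre by (auto simp: finite_subgroups_def)
  then show ?thesis using act_centre by (auto simp: fixed_points_def)
qed

text \<open>Tychonoff's theorem in the full product over all indices: the factors are intervals
  below \<open>n\<close> and single points from \<open>n\<close> on.\<close>

lemma compact_cube:
  fixes n :: nat
  shows "compact {v. (\<forall>i<n. \<bar>v i\<bar> \<le> r) \<and> (\<forall>i\<ge>n. v i = (0 :: real))}"
proof -
  have "compactin (product_topology (\<lambda>i :: nat. euclideanreal) UNIV) (PiE UNIV (\<lambda>i :: nat. if i < n then {- r..r} else {0}))"
    by (subst compactin_PiE) auto
  moreover have "PiE UNIV (\<lambda>i :: nat. if i < n then {- r..r} else {0}) = {v. (\<forall>i<n. \<bar>v i\<bar> \<le> r) \<and> (\<forall>i\<ge>n. v i = (0 :: real))}"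
    by (auto simp: PiE_iff abs_le_iff split: if_splits) (smt (verit) not_less)+
  ultimately show ?thesis
    by (simp add: euclidean_product_topology)
qed

lemma orbit_act:
  assumes v: "v \<in> R3"
  shows "orbit crys act (act g v) = orbit crys act v"
proof -
  have 1: "act h (act g v) = act (h \<otimes>\<^bsub>crys\<^esub> g) v" for h by (simp only: act_mult[OF v])
  have 2: "act h v = act (h \<otimes>\<^bsub>crys\<^esub> inv\<^bsub>crys\<^esub> g) (act g v)" for h
    by (simp only: act_mult[OF act_R3[OF v]] act_inv(2)[OF v])
  have orb: "orbit crys act w = range (\<lambda>h. act h w)" for w
    by (simp add: orbit_def full_SetCompr_eq)
  show ?thesis
    unfolding orb
  proof (intro equalityI image_subsetI)
    fix h
    show "act h (act g v) \<in> range (\<lambda>h. act h v)" unfolding 1 by (rule rangeI)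
    show "act h v \<in> range (\<lambda>h. act h (act g v))" unfolding 2[of h] by (rule rangeI)
  qed
qed

lemma compact_orbit_space_act: "compact_space (orbit_space crys E3 act)"
proof -
  let ?X = E3
  let ?B = "{v. (\<forall>i<3. \<bar>v i\<bar> \<le> 1) \<and> (\<forall>i\<ge>3. v i = (0 :: real))}"
  interpret group_action crys R3 act by (rule group_action_act)
  have "compactin ?X ?B"
    using compact_cube[of 3 1] by (auto simp: Euclidean_space_eq compactin_subtopology)
  then have "compactin (orbit_space crys ?X act) (orbit crys act ` ?B)"
    using image_compactin quotient_imp_continuous_map[OF quotient_map_orbit_space] by blast
  moreover have "orbit crys act ` ?B = topspace (orbit_space crys ?X act)"
  proof -
    have "\<exists>w\<in>?B. orbit crys act w = orbit crys act v" if v: "v \<in> R3" for v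
    proof -
      \<comment> \<open>The y-exponent is fixed first: it decides whether the first coordinate is
        reflected before \<open>?m\<close> brings it into the unit interval.\<close>
      let ?n = "- \<lfloor>v 1\<rfloor>"
      let ?m = "- \<lfloor>sg ?n (v 0)\<rfloor>"
      let ?g = "enc (?m, ?n, - \<lfloor>v 2\<rfloor>, False)"
      have "orbit crys act (act ?g v) = orbit crys act v" by (rule orbit_act[OF v])
      moreover have "act ?g v \<in> ?B"
      proof -
        have "\<bar>move (?m, ?n, - \<lfloor>v 2\<rfloor>, False) v i\<bar> \<le> 1" if "i < 3" for i
        proof -
          have *: "\<bar>t - real_of_int \<lfloor>t\<rfloor>\<bar> \<le> 1" for t :: real by linarith
          from that consider "i = 0" | "i = 1" | "i = 2" by linarith
          then show ?thesis
            using *[of "sg ?n (v 0)"] *[of "v 1"] *[of "v 2"] by cases auto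
        qed
        then show ?thesis using v by (simp add: act_enc del: move.simps)
      qed
      ultimately show ?thesis by blast
    qed
    then have "orbit crys act ` R3 \<subseteq> orbit crys act ` ?B" by (metis (no_types, lifting) image_eqI image_subsetI)
    moreover have "orbit crys act ` ?B \<subseteq> orbit crys act ` R3" by (intro image_mono) auto
    moreover have "topspace (orbit_space crys ?X act) = orbit crys act ` R3"
      by (simp only: topspace_orbit_space orbits_def topspace_Euclidean_3 Setcompr_eq_image Collect_mem_eq)
    ultimately show ?thesis by simp
  qed
  ultimately show ?thesis by (simp add: compact_space_def)
qed

subsection \<open>The cubical structure\<close>

text \<open>The directions of the open unit cube that contains \<open>v\<close>; the cardinality is
  its dimension.\<close>

definition nonint :: "(nat \<Rightarrow> real) \<Rightarrow> nat set" where
  "nonint v = {i. v i \<notin> \<int>}"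

text \<open>Coordinatewise, this sends a point to the centre of its open cube, which identifies the
  cell that the point belongs to.\<close>

definition mid :: "real \<Rightarrow> real" where
  "mid t = (if t \<in> \<int> then t else of_int \<lfloor>t\<rfloor> + 1/2)"

lemma nonint_subset: "v \<in> R3 \<Longrightarrow> nonint v \<subseteq> {..<3}"
  by (auto simp: nonint_def) (metis Ints_0 not_less)

lemma finite_nonint: "v \<in> R3 \<Longrightarrow> finite (nonint v)"
  using nonint_subset finite_subset by blast

lemma card_nonint: "v \<in> R3 \<Longrightarrow> card (nonint v) \<le> 3"
  using card_mono[OF _ nonint_subset, of v] by simp

lemma Ints_sg_iff: "sg n t \<in> \<int> \<longleftrightarrow> t \<in> (\<int> :: real set)"
  by (simp add: sg_def minus_in_Ints_iff)

lemma Ints_add_of_int_iff: "t + of_int m \<in> \<int> \<longleftrightarrow> t \<in> (\<int> :: real set)" "of_int m + t \<in> \<int> \<longleftrightarrow> t \<in> (\<int> :: real set)"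
  by (metis Ints_add Ints_diff Ints_of_int add_diff_cancel_right')
    (metis Ints_add Ints_diff Ints_of_int add_diff_cancel_left')

lemma nonint_move: "v \<in> R3 \<Longrightarrow> nonint (move q v) = nonint v"
proof -
  assume v: "v \<in> R3"
  obtain m n k e where q: "q = (m, n, k, e)" by (cases q)
  have "move q v i \<in> \<int> \<longleftrightarrow> v i \<in> \<int>" for i
  proof -
    consider "i = 0" | "i = 1" | "i = 2" | "i \<ge> 3" by linarith
    then show ?thesis
      by cases (use v in \<open>auto simp: q Ints_add_of_int_iff Ints_sg_iff\<close>)
  qed
  then show ?thesis by (simp add: nonint_def)
qed

lemma half_not_int: "1/2 \<notin> (\<int> :: real set)"
proof
  assume "1/2 \<in> (\<int> :: real set)"
  then obtain n :: int where "1/2 = real_of_int n" by (auto elim: Ints_cases)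
  then have "1 = 2 * n" by linarith
  then show False by presburger
qed

lemma mid_add: "mid (t + of_int m) = mid t + of_int m"
  by (simp add: mid_def Ints_add_of_int_iff)

text \<open>Reflection permutes the open intervals between integers and hence their midpoints; in
  terms of floors, \<open>\<lfloor>- t\<rfloor> = - \<lfloor>t\<rfloor> - 1\<close> for nonintegral
  \<open>t\<close>.\<close>

lemma mid_sg: "mid (sg n t) = sg n (mid t)"
proof (cases "t \<in> \<int>")
  case False
  then have "\<lceil>t\<rceil> = \<lfloor>t\<rfloor> + 1" by (simp add: ceiling_altdef) (metis Ints_of_int)
  then have "\<lfloor>- t\<rfloor> = - \<lfloor>t\<rfloor> - 1" by (simp add: ceiling_def)
  then show ?thesis using False by (auto simp: sg_def mid_def minus_in_Ints_iff)
qed (auto simp: sg_def mid_def minus_in_Ints_iff)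

lemma mid_0 [simp]: "mid 0 = 0" by (simp add: mid_def)

lemma mid_move: "v \<in> R3 \<Longrightarrow> mid (move q v i) = move q (\<lambda>i. mid (v i)) i"
proof -
  assume v: "v \<in> R3"
  obtain m n k e where q: "q = (m, n, k, e)" by (cases q)
  consider "i = 0" | "i = 1" | "i = 2" | "i \<ge> 3" by linarith
  then show ?thesis
    by cases (use v in \<open>auto simp: q mid_add mid_sg add.commute[of "real_of_int m"]\<close>)
qed

text \<open>One cube at the origin for each choice of \<open>n\<close> of the three axes. These
  represent the orbits of \<open>n\<close>-cubes, and their centres serve as the indices of the
  cells.\<close>

definition cell_centres :: "nat \<Rightarrow> (nat \<Rightarrow> real) set" where
  "cell_centres n = {j \<in> R3. (\<forall>i. j i \<in> {0, 1/2}) \<and> card (nonint j) = n}"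

text \<open>Twice a coordinate is an integer whose parity distinguishes \<open>0\<close> from
  \<open>1/2\<close>, after which the translation can be read off. The first coordinate is treated
  last because its sign depends on \<open>b\<close>.\<close>

lemma move_cell_centre_inj:
  assumes "j \<in> cell_centres n" "j' \<in> cell_centres n'" "move (a, b, c, e) j = move (a', b', c', e') j'"
  shows "j = j' \<and> (a, b, c) = (a', b', c')"
proof -
  have eq: "move (a, b, c, e) j i = move (a', b', c', e') j' i" for i using assms(3) by simp
  have j: "j i = 0 \<or> j i = 1/2" "j' i = 0 \<or> j' i = 1/2" for i
    using assms(1,2) by (auto simp: cell_centres_def)
  define x where "x i = (if j i = 0 then 0 else 1 :: int)" for i
  define y where "y i = (if j' i = 0 then 0 else 1 :: int)" for i
  have xy: "x i = 0 \<or> x i = 1" "y i = 0 \<or> y i = 1" "j i = x i / 2" "j' i = y i / 2" for i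
    using j[of i] by (auto simp: x_def y_def)
  have "real_of_int (x 1 + 2 * b) = real_of_int (y 1 + 2 * b')" using eq[of 1] by (simp add: xy)
  then have "x 1 + 2 * b = y 1 + 2 * b'" by (simp only: of_int_eq_iff)
  then have 1: "x 1 = y 1 \<and> b = b'" using xy(1,2)[of 1] by auto presburger+
  have "real_of_int (x 2 + 2 * c) = real_of_int (y 2 + 2 * c')" using eq[of 2] by (simp add: xy)
  then have "x 2 + 2 * c = y 2 + 2 * c'" by (simp only: of_int_eq_iff)
  then have 2: "x 2 = y 2 \<and> c = c'" using xy(1,2)[of 2] by auto presburger+
  have "real_of_int (sg b (x 0) + 2 * a) = real_of_int (sg b (y 0) + 2 * a')"
    using eq[of 0] 1 by (simp add: xy sg_def split: if_splits)
  then have "sg b (x 0) + 2 * a = sg b (y 0) + 2 * a'" by (simp only: of_int_eq_iff)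
  then have 0: "x 0 = y 0 \<and> a = a'" using xy(1,2)[of 0] by (auto simp: sg_def split: if_splits; presburger)
  have "j = j'"
    by (rule R3_eqI) (use 0 1 2 assms(1,2) in \<open>auto simp: cell_centres_def xy(3,4)\<close>)
  then show ?thesis using 0 1 2 by simp
qed

lemma mid_eq_move_cell_centre:
  assumes v: "v \<in> R3"
  obtains j q where "j \<in> cell_centres (card (nonint v))" "nonint j = nonint v" "(\<lambda>i. mid (v i)) = move q j"
proof -
  define j where "j i = (if v i \<in> \<int> then 0 else 1/2 :: real)" for i
  have nj: "nonint j = nonint v" using half_not_int by (auto simp: nonint_def j_def)
  have j3: "j \<in> R3" using v by (auto simp: j_def)
  define n where "n = \<lfloor>v 1\<rfloor>"
  \<comment> \<open>An odd power of y turns \<open>1/2\<close> into \<open>-1/2\<close>, so the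
    translation has to be larger by one to reach the same midpoint.\<close>
  define m where "m = (if v 0 \<in> \<int> \<or> even n then \<lfloor>v 0\<rfloor> else \<lfloor>v 0\<rfloor> + 1)"
  have "(\<lambda>i. mid (v i)) = move (m, n, \<lfloor>v 2\<rfloor>, False) j"
  proof (rule R3_eqI)
    show "(\<lambda>i. mid (v i)) \<in> R3" using v by simp
  qed (auto simp: mid_def j_def m_def sg_def n_def)
  then show thesis using that[of j] nj j3 by (auto simp: cell_centres_def j_def)
qed

section \<open>The radial map from the ball to the cube\<close>

definition max3 :: "(nat \<Rightarrow> real) \<Rightarrow> real" where
  "max3 w = max \<bar>w 0\<bar> (max \<bar>w 1\<bar> \<bar>w 2\<bar>)"

text \<open>Radial rescaling that takes the Euclidean ball onto the cube: the square of the Euclidean norm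
  becomes the maximum norm.\<close>

definition puff :: "(nat \<Rightarrow> real) \<Rightarrow> nat \<Rightarrow> real" where
  "puff w = (\<lambda>i. w i * (norm_sq 3 w / max3 w))"

lemma norm_sq_3: "norm_sq 3 w = (w 0)\<^sup>2 + (w 1)\<^sup>2 + (w 2)\<^sup>2"
  by (simp add: norm_sq_def eval_nat_numeral)

lemma norm_sq_nonneg: "0 \<le> norm_sq n w"
  by (simp add: norm_sq_def sum_nonneg)

lemma max3_nonneg: "0 \<le> max3 w"
  by (simp add: max3_def)

lemma max3_ge: "w \<in> R3 \<Longrightarrow> \<bar>w i\<bar> \<le> max3 w"
proof -
  assume w: "w \<in> R3"
  consider "i = 0" | "i = 1" | "i = 2" | "i \<ge> 3" by linarith
  then show ?thesis by cases (use w in \<open>auto simp: max3_def\<close>)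
qed

lemma max3_attained: obtains i where "i < 3" "\<bar>w i\<bar> = max3 w"
proof -
  have "\<bar>w 0\<bar> = max3 w \<or> \<bar>w 1\<bar> = max3 w \<or> \<bar>w 2\<bar> = max3 w"
    by (simp add: max3_def max_def)
  then show ?thesis using that[of 0] that[of 1] that[of 2] by auto
qed

lemma max3_scale: "max3 (\<lambda>i. w i * t) = max3 w * \<bar>t\<bar>"
  by (simp add: max3_def abs_mult max_mult_distrib_right)

lemma norm_sq_scale: "norm_sq n (\<lambda>i. w i * t) = norm_sq n w * t\<^sup>2"
  by (simp add: norm_sq_def power_mult_distrib sum_distrib_right)

lemma max3_eq_0: "w \<in> R3 \<Longrightarrow> max3 w = 0 \<longleftrightarrow> w = (\<lambda>_. 0)"
proof
  assume "w \<in> R3" "max3 w = 0"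
  then show "w = (\<lambda>_. 0)" using max3_ge[of w] by (intro ext) (metis abs_le_zero_iff)
qed (simp add: max3_def)

lemma norm_sq_3_eq_0: "w \<in> R3 \<Longrightarrow> norm_sq 3 w = 0 \<longleftrightarrow> w = (\<lambda>_. 0)"
proof
  assume "w \<in> R3" "norm_sq 3 w = 0"
  then have "w 0 = 0" "w 1 = 0" "w 2 = 0" "w \<in> R3"
    unfolding norm_sq_3 by (smt (verit) power2_less_eq_zero_iff zero_le_power2)+
  then show "w = (\<lambda>_. 0)" by (intro R3_eqI) auto
qed (simp add: norm_sq_def)

lemma max3_puff:
  assumes "w \<in> R3"
  shows "max3 (puff w) = norm_sq 3 w"
proof (cases "w = (\<lambda>_. 0)")
  case True
  then show ?thesis by (simp add: max3_def puff_def norm_sq_def)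
next
  case False
  then have "max3 w > 0" using max3_eq_0[OF assms] max3_nonneg[of w] by linarith
  then show ?thesis unfolding puff_def max3_scale using norm_sq_nonneg[of 3 w] by simp
qed

lemma puff_eq_0_iff: "w \<in> R3 \<Longrightarrow> puff w i = 0 \<longleftrightarrow> w i = 0"
  using max3_eq_0[of w] norm_sq_3_eq_0[of w] by (auto simp: puff_def)

lemma puff_R3: "w \<in> R3 \<Longrightarrow> puff w \<in> R3"
  by (simp add: puff_def)

text \<open>\<open>puff\<close> preserves rays, so away from the origin \<open>w\<close> and
  \<open>w'\<close> differ by a positive factor, and by \<open>max3_puff\<close> they have the same
  Euclidean norm.\<close>

lemma puff_inj:
  assumes "w \<in> R3" "w' \<in> R3" "puff w = puff w'"
  shows "w = w'"
proof (cases "w = (\<lambda>_. 0) \<or> w' = (\<lambda>_. 0)")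
  case True
  have "w i = 0 \<longleftrightarrow> w' i = 0" for i
    using puff_eq_0_iff[OF assms(1), of i] puff_eq_0_iff[OF assms(2), of i] assms(3) by simp
  then show ?thesis using True by auto
next
  case False
  then have pos: "max3 w > 0" "max3 w' > 0" "norm_sq 3 w > 0" "norm_sq 3 w' > 0"
    using max3_eq_0[OF assms(1)] norm_sq_3_eq_0[OF assms(1)] max3_eq_0[OF assms(2)] norm_sq_3_eq_0[OF assms(2)]
      max3_nonneg[of w] max3_nonneg[of w'] norm_sq_nonneg[of 3 w] norm_sq_nonneg[of 3 w']
    by (simp_all add: order_less_le)
  have N: "norm_sq 3 w = norm_sq 3 w'"
    using max3_puff[OF assms(1)] max3_puff[OF assms(2)] assms(3) by simp
  define l where "l = max3 w / max3 w'"
  have w: "w = (\<lambda>i. w' i * l)"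
  proof
    fix i
    have "w i * (norm_sq 3 w / max3 w) = w' i * (norm_sq 3 w' / max3 w')"
      using assms(3) by (metis puff_def)
    then show "w i = w' i * l" using pos N by (simp add: l_def field_simps)
  qed
  have "norm_sq 3 w = norm_sq 3 w' * l\<^sup>2" by (subst w) (rule norm_sq_scale)
  then have "l\<^sup>2 = 1" using N pos by simp
  moreover have "l > 0" using pos by (simp add: l_def)
  ultimately have "l = 1" using power2_eq_1_iff[of l] by linarith
  then show ?thesis using w by simp
qed

lemma puff_surj:
  assumes "y \<in> R3"
  obtains w where "w \<in> R3" "puff w = y"
proof (cases "y = (\<lambda>_. 0)")
  case True
  then show ?thesis using that[of "\<lambda>_. 0"] by (simp add: puff_def)
next
  case False
  then have pos: "max3 y > 0" "norm_sq 3 y > 0"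
    using max3_eq_0[OF assms] norm_sq_3_eq_0[OF assms] max3_nonneg[of y] norm_sq_nonneg[of 3 y] by linarith+
  \<comment> \<open>Along a ray \<open>puff\<close> is quadratic: it sends the multiple of
    \<open>y\<close> by \<open>t\<close> to \<open>y\<close> times
    \<open>t^2 * norm_sq 3 y / max3 y\<close>, which determines \<open>t\<close>.\<close>
  define t where "t = sqrt (max3 y / norm_sq 3 y)"
  have t: "t > 0" "t\<^sup>2 = max3 y / norm_sq 3 y" using pos by (auto simp: t_def)
  have "puff (\<lambda>i. y i * t) = y"
  proof
    fix i
    have "puff (\<lambda>i. y i * t) i = y i * t * (norm_sq 3 y * t\<^sup>2 / (max3 y * t))"
      using t(1) by (simp add: puff_def norm_sq_scale max3_scale)
    also have "\<dots> = y i" unfolding t(2) using t(1) pos by simp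
    finally show "puff (\<lambda>i. y i * t) i = y i" .
  qed
  moreover have "(\<lambda>i. y i * t) \<in> R3" using assms by simp
  ultimately show ?thesis by (intro that)
qed

lemma abs_puff_le:
  assumes "w \<in> R3"
  shows "\<bar>puff w i\<bar> \<le> norm_sq 3 w"
  using max3_ge[OF puff_R3[OF assms], of i] max3_puff[OF assms] by simp

text \<open>Only the origin needs care, where \<open>puff\<close> is 0 by the convention on division
  by zero; there \<open>norm_sq 3\<close> dominates every coordinate and tends to 0.\<close>

lemma continuous_puff: "continuous_on R3 puff"
proof (rule continuous_on_coordinatewise_then_product)
  fix i
  have c: "continuous_on R3 (\<lambda>w :: nat \<Rightarrow> real. w k)" for k
    by (rule continuous_on_subset[OF continuous_on_product_coordinates]) auto
  have cn: "continuous_on R3 (norm_sq 3)"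
    unfolding norm_sq_3[abs_def] by (intro continuous_intros c)
  have cm: "continuous_on R3 max3"
    unfolding max3_def[abs_def] by (intro continuous_intros c)
  show "continuous_on R3 (\<lambda>w. puff w i)"
    unfolding continuous_on_def
  proof
    fix w :: "nat \<Rightarrow> real" assume w: "w \<in> R3"
    show "((\<lambda>w. puff w i) \<longlongrightarrow> puff w i) (at w within R3)"
    proof (cases "max3 w = 0")
      case False
      then show ?thesis
        unfolding puff_def using c[of i] cn cm w
        by (intro tendsto_mult tendsto_divide) (auto simp: continuous_on_def)
    next
      case True
      then have "norm_sq 3 w = 0" "puff w i = 0" 
        using max3_eq_0[OF w] norm_sq_3_eq_0[OF w] by (auto simp: puff_def)
      moreover have "(norm_sq 3 \<longlongrightarrow> norm_sq 3 w) (at w within R3)"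
        using cn w by (auto simp: continuous_on_def)
      ultimately show ?thesis
        using Lim_null_comparison[of "\<lambda>w. puff w i" "norm_sq 3" "at w within R3"] abs_puff_le
        by (auto simp: eventually_at_filter)
    qed
  qed
qed

section \<open>Characteristic maps of the cubes\<close>

definition idx :: "(nat \<Rightarrow> real) \<Rightarrow> nat \<Rightarrow> nat" where
  "idx j = (SOME f. bij_betw f (nonint j) {..<card (nonint j)})"

text \<open>Distributes the coordinates of the disc over the axes along which the cube extends; any
  bijection would serve as \<open>idx j\<close>.\<close>

definition spread :: "(nat \<Rightarrow> real) \<Rightarrow> (nat \<Rightarrow> real) \<Rightarrow> nat \<Rightarrow> real" where
  "spread j v = (\<lambda>i. if i \<in> nonint j then v (idx j i) else 0)"

text \<open>The factor 1/2 gives a cube of side 1 around its centre \<open>j\<close>.\<close>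

definition cell :: "(nat \<Rightarrow> real) \<Rightarrow> (nat \<Rightarrow> real) \<Rightarrow> nat \<Rightarrow> real" where
  "cell j v = (\<lambda>i. j i + puff (spread j v) i / 2)"

context
  fixes j n assumes j: "j \<in> cell_centres n"
begin

lemma cell_centre_R3: "j \<in> R3" and cell_centre_val: "j i = 0 \<or> j i = 1/2" and card_nonint_cell_centre: "card (nonint j) = n"
  using j by (auto simp: cell_centres_def)

lemma mem_nonint_cell_centre: "i \<in> nonint j \<longleftrightarrow> j i = 1/2"
proof (cases "j i = 0")
  case False
  then have *: "j i = 1/2" using cell_centre_val by blast
  then have "j i \<notin> \<int>" using half_not_int by (simp only: not_False_eq_True)
  then show ?thesis using * unfolding nonint_def by blast
qed (simp add: nonint_def)

lemma idx_bij: "bij_betw (idx j) (nonint j) {..<n}"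
proof -
  have "\<exists>f. bij_betw f (nonint j) {..<card (nonint j)}"
    using ex_bij_betw_finite_nat[OF finite_nonint[OF cell_centre_R3]] by (simp add: atLeast0LessThan)
  then show ?thesis unfolding idx_def card_nonint_cell_centre by (rule someI_ex)
qed

lemma spread_R3: "spread j v \<in> R3"
  using nonint_subset[OF cell_centre_R3] by (auto simp: spread_def)

lemma norm_sq_spread: "norm_sq 3 (spread j v) = norm_sq n v"
proof -
  have "norm_sq 3 (spread j v) = (\<Sum>i\<in>nonint j. (v (idx j i))\<^sup>2)"
    unfolding norm_sq_def
    by (rule sum.mono_neutral_cong_right) (use nonint_subset[OF cell_centre_R3] in \<open>auto simp: spread_def\<close>)
  also have "\<dots> = norm_sq n v"
    unfolding norm_sq_def by (rule sum.reindex_bij_betw[OF idx_bij])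
  finally show ?thesis .
qed

lemma spread_inj:
  assumes "\<forall>i\<ge>n. v i = 0" "\<forall>i\<ge>n. v' i = 0" "spread j v = spread j v'"
  shows "v = v'"
proof
  fix k
  show "v k = v' k"
  proof (cases "k < n")
    case True
    then obtain i where "i \<in> nonint j" "k = idx j i"
      using idx_bij by (auto simp: bij_betw_def)
    then show ?thesis using fun_cong[OF assms(3), of i] by (simp add: spread_def)
  qed (use assms in auto)
qed

lemma spread_surj:
  assumes "\<And>i. i \<notin> nonint j \<Longrightarrow> w i = 0"
  obtains v where "\<forall>i\<ge>n. v i = 0" "spread j v = w"
proof -
  define v where "v k = (if k < n then w (inv_into (nonint j) (idx j) k) else 0)" for k
  have "spread j v i = w i" for i
    using assms[of i] idx_bij by (auto simp: spread_def v_def bij_betw_def)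
  then show ?thesis using that[of v] by (auto simp: v_def)
qed

lemma cell_R3: "cell j v \<in> R3"
  using cell_centre_R3 puff_R3[OF spread_R3] by (auto simp: cell_def)

lemma cell_outside: "i \<notin> nonint j \<Longrightarrow> cell j v i = j i"
  using puff_eq_0_iff[OF spread_R3] by (auto simp: cell_def spread_def)

lemma cell_dist: "\<bar>cell j v i - j i\<bar> \<le> norm_sq n v / 2"
  using abs_puff_le[OF spread_R3, of v i] by (simp add: cell_def norm_sq_spread)

lemma nonint_cell_subset: "nonint (cell j v) \<subseteq> nonint j"
  using cell_outside by (auto simp: nonint_def)

text \<open>Interior points of the disc stay less than 1/2 away from the centre, so in the
  directions of the cube they do not reach an integer. The index of an open cell can thus be
  recovered from any of its points.\<close>

lemma mid_cell:
  assumes "norm_sq n v < 1"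
  shows "mid (cell j v i) = j i"
proof (cases "i \<in> nonint j")
  case True
  then have ji: "j i = 1/2" by (simp only: mem_nonint_cell_centre)
  have *: "0 < cell j v i" "cell j v i < 1"
    using cell_dist[of v i] assms unfolding ji abs_le_iff by linarith+
  then have "\<lfloor>cell j v i\<rfloor> = 0" by (simp add: floor_eq_iff)
  moreover have "cell j v i \<notin> \<int>"
    using * by (auto elim!: Ints_cases)
  ultimately show ?thesis using ji by (simp add: mid_def)
next
  case False
  then show ?thesis by (simp add: cell_outside) (simp add: mid_def nonint_def)
qed

lemma nonint_cell:
  assumes "norm_sq n v < 1"
  shows "nonint (cell j v) = nonint j"
proof -
  have "mid t \<in> \<int> \<longleftrightarrow> t \<in> \<int>" for t
    using half_not_int Ints_add_of_int_iff(2)[of "\<lfloor>t\<rfloor>" "1/2"] by (simp add: mid_def)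
  then show ?thesis using mid_cell[OF assms] by (metis (no_types, lifting) nonint_def Collect_cong)
qed

text \<open>On the unit sphere the maximum norm of the rescaled point is 1, so some coordinate sits
  on a face of the cube and becomes an integer.\<close>

lemma nonint_cell_boundary:
  assumes "norm_sq n v = 1"
  shows "nonint (cell j v) \<subset> nonint j"
proof -
  obtain i where i: "\<bar>puff (spread j v) i\<bar> = 1"
    using max3_attained[of "puff (spread j v)"] unfolding max3_puff[OF spread_R3] norm_sq_spread assms by blast
  then have "i \<in> nonint j" using puff_eq_0_iff[OF spread_R3, of v i] by (auto simp: spread_def split: if_splits)
  moreover from this have "j i = 1/2" by (simp only: mem_nonint_cell_centre)
  then have "cell j v i = 0 \<or> cell j v i = 1" using i by (auto simp: cell_def abs_if split: if_splits)
  then have "i \<notin> nonint (cell j v)" by (auto simp: nonint_def)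
  ultimately show ?thesis using nonint_cell_subset[of v] by blast
qed

lemma cell_inj:
  assumes "\<forall>i\<ge>n. v i = 0" "\<forall>i\<ge>n. v' i = 0" "cell j v = cell j v'"
  shows "v = v'"
proof -
  have "puff (spread j v) = puff (spread j v')"
    using assms(3) by (auto simp: cell_def fun_eq_iff)
  then show ?thesis using puff_inj[OF spread_R3 spread_R3] spread_inj assms(1,2) by blast
qed

text \<open>Undoes the stages of \<open>cell\<close> in turn: centring and scaling, then
  \<open>puff\<close>, then \<open>spread\<close>. The strict bound on \<open>y\<close> puts the
  preimage into the open disc.\<close>

lemma cell_surj:
  assumes x: "x \<in> R3" "\<And>i. mid (x i) = j i"
  obtains v where "\<forall>i\<ge>n. v i = 0" "norm_sq n v < 1" "cell j v = x"
proof -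
  define y where "y i = 2 * (x i - j i)" for i
  have y3: "y \<in> R3" using x cell_centre_R3 by (simp add: y_def)
  have yout: "y i = 0" if "i \<notin> nonint j" for i
  proof -
    have "real_of_int \<lfloor>x i\<rfloor> + 1/2 \<notin> \<int>" unfolding Ints_add_of_int_iff by (rule half_not_int)
    moreover have "mid (x i) \<in> \<int>" using x(2)[of i] that by (simp add: nonint_def)
    ultimately have "x i \<in> \<int>" unfolding mid_def by presburger
    then show ?thesis using x(2)[of i] by (simp add: mid_def y_def)
  qed
  have *: "\<bar>2 * (a - b)\<bar> < 1" if "f < a" "b = f + 1/2" "a < f + 1" for a b f :: real
    using that by (simp add: abs_if)
  have yabs: "\<bar>y i\<bar> < 1" for i
  proof (cases "x i \<in> \<int>")
    case False
    then have "real_of_int \<lfloor>x i\<rfloor> < x i" by (metis Ints_of_int of_int_floor_le order_le_less)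
    moreover have "j i = real_of_int \<lfloor>x i\<rfloor> + 1/2" using x(2)[of i] False by (simp add: mid_def)
    ultimately show ?thesis unfolding y_def using real_of_int_floor_add_one_gt[of "x i"] * by blast
  next
    case True
    then show ?thesis using x(2)[of i] by (simp add: mid_def y_def)
  qed
  obtain w where w: "w \<in> R3" "puff w = y" using puff_surj[OF y3] by blast
  have "w i = 0" if "i \<notin> nonint j" for i
    using yout[OF that] puff_eq_0_iff[OF w(1), of i] by (simp add: w(2))
  then obtain v where v: "\<forall>i\<ge>n. v i = 0" "spread j v = w"
    by (rule spread_surj)
  have "norm_sq n v = max3 y" using max3_puff[OF w(1)] norm_sq_spread[of v] unfolding w(2) v(2) by simp
  moreover obtain i where "\<bar>y i\<bar> = max3 y" using max3_attained by blast
  then have "max3 y < 1" using yabs[of i] by simp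
  ultimately have "norm_sq n v < 1" by simp
  moreover have "cell j v = x" unfolding cell_def v(2) w(2) by (simp add: y_def fun_eq_iff field_simps)
  ultimately show ?thesis using that[OF v(1)] by blast
qed

lemma continuous_cell: "continuous_on S (cell j)"
proof -
  have c: "continuous_on UNIV (\<lambda>v. spread j v)"
  proof (rule continuous_on_coordinatewise_then_product)
    show "continuous_on UNIV (\<lambda>v. spread j v i)" for i
      by (cases "i \<in> nonint j") (simp_all add: spread_def)
  qed
  have "continuous_on UNIV (\<lambda>v. puff (spread j v))"
    by (rule continuous_on_compose2[OF continuous_puff c]) (use spread_R3 in blast)
  then have "continuous_on UNIV (\<lambda>v. puff (spread j v) i)" for i
    by (rule continuous_on_product_then_coordinatewise)
  then have "continuous_on UNIV (cell j)"
    by (intro continuous_on_coordinatewise_then_product) (auto simp: cell_def intro!: continuous_intros)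
  then show ?thesis by (rule continuous_on_subset) auto
qed

end

section \<open>Translates of the cells by cosets of the centre\<close>

definition coset :: "int \<Rightarrow> int \<Rightarrow> int \<Rightarrow> nat set" where
  "coset a b c = {enc (a, b, c, e) | e. True}"

lemma l_coset_centre: "enc (a, b, c, e) <#\<^bsub>crys\<^esub> centre = coset a b c"
proof -
  have "x \<in> enc (a, b, c, e) <#\<^bsub>crys\<^esub> centre \<longleftrightarrow> x \<in> coset a b c" for x
    by (auto simp: l_coset_def centre_eq coset_def mult_crys)
  then show ?thesis by blast
qed

lemma l_coset_coset: "enc (a, b, c, e) <#\<^bsub>crys\<^esub> coset a' b' c' = coset (a + sg b a') (b + b') (c + c')"
proof -
  have "x \<in> enc (a, b, c, e) <#\<^bsub>crys\<^esub> coset a' b' c' \<longleftrightarrow> x \<in> coset (a + sg b a') (b + b') (c + c')" for x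
  proof
    assume "x \<in> coset (a + sg b a') (b + b') (c + c')"
    then obtain f where "x = enc (a + sg b a', b + b', c + c', f)" by (auto simp: coset_def)
    then have "x = enc (a, b, c, e) \<otimes>\<^bsub>crys\<^esub> enc (a', b', c', (f \<noteq> odd (c * a')) \<noteq> e)"
      by (auto simp: mult_crys)
    then show "x \<in> enc (a, b, c, e) <#\<^bsub>crys\<^esub> coset a' b' c'"
      unfolding l_coset_def coset_def by blast
  qed (auto simp: l_coset_def coset_def mult_crys)
  then show ?thesis by blast
qed

lemma lcosets_centre: "lcosets\<^bsub>crys\<^esub> centre = {coset a b c | a b c. True}"
  unfolding LCOSETS_def
proof safe
  fix g
  show "\<exists>a b c. g <#\<^bsub>crys\<^esub> centre = coset a b c \<and> True"
    by (cases g) (use l_coset_centre in blast)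
next
  fix a b c
  show "coset a b c \<in> (\<Union>g\<in>carrier crys. {g <#\<^bsub>crys\<^esub> centre})"
    using l_coset_centre[of a b c False] by auto
qed

text \<open>Members of one coset of \<open>centre\<close> differ only in the last entry, which
  \<open>move\<close> ignores, so the choice of a representative has no influence.\<close>

definition move_by :: "nat set \<Rightarrow> (nat \<Rightarrow> real) \<Rightarrow> nat \<Rightarrow> real" where
  "move_by C = move (dec (SOME g. g \<in> C))"

lemma move_by_coset: "move_by (coset a b c) = move (a, b, c, e)"
proof -
  have "(SOME g. g \<in> coset a b c) \<in> coset a b c"
    by (rule someI[of _ "enc (a, b, c, False)"]) (auto simp: coset_def)
  then obtain f where "(SOME g. g \<in> coset a b c) = enc (a, b, c, f)" by (auto simp: coset_def)
  then have "move_by (coset a b c) = move (a, b, c, f)" by (simp add: move_by_def del: move.simps)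
  then show ?thesis by (simp add: fun_eq_iff)
qed

lemma move_by_l_coset:
  assumes "C \<in> lcosets\<^bsub>crys\<^esub> centre" "v \<in> R3"
  shows "move_by (g <#\<^bsub>crys\<^esub> C) v = act g (move_by C v)"
proof -
  obtain a b c where C: "C = coset a b c" using assms by (auto simp: lcosets_centre)
  obtain a' b' c' e where g: "g = enc (a', b', c', e)" by (cases g)
  have "act g (move_by C v) = move (a', b', c', e) (move (a, b, c, False) v)"
    unfolding g C move_by_coset[of a b c False] by (rule act_enc) (rule move_R3)
  also have "\<dots> = move (cmul (a', b', c', e) (a, b, c, False)) v"
    by (rule move_cmul[symmetric]) fact
  also have "\<dots> = move_by (g <#\<^bsub>crys\<^esub> C) v"
    unfolding g C l_coset_coset cmul.simps move_by_coset[of _ _ _ "(e \<noteq> False) \<noteq> odd (c' * a)"] ..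
  finally show ?thesis by simp
qed

lemma move_by_R3: "move_by C v \<in> R3"
  unfolding move_by_def by (rule move_R3)

lemma continuous_move_by: "continuous_on S (move_by C)"
  unfolding move_by_def by (rule continuous_move)

lemma nonint_move_by: "v \<in> R3 \<Longrightarrow> nonint (move_by C v) = nonint v"
  unfolding move_by_def by (rule nonint_move)

lemma mid_move_by: "v \<in> R3 \<Longrightarrow> (\<lambda>i. mid (move_by C v i)) = move_by C (\<lambda>i. mid (v i))"
  unfolding move_by_def by (intro ext mid_move)

lemma move_by_eq_iff: "v \<in> R3 \<Longrightarrow> w \<in> R3 \<Longrightarrow> move_by C v = move_by C w \<longleftrightarrow> v = w"
  unfolding move_by_def by (rule move_eq_iff)

lemma move_dist: "v \<in> R3 \<Longrightarrow> w \<in> R3 \<Longrightarrow> \<bar>move q v i - move q w i\<bar> = \<bar>v i - w i\<bar>"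
  by (cases q) (auto simp: sg_def)

lemma move_by_dist: "v \<in> R3 \<Longrightarrow> w \<in> R3 \<Longrightarrow> \<bar>move_by C v i - move_by C w i\<bar> = \<bar>v i - w i\<bar>"
  unfolding move_by_def by (rule move_dist)

text \<open>The quotient by \<open>centre\<close> acts freely on the cubes, so the centre of a cell
  determines both its orbit representative and the coset that moves it there.\<close>

lemma move_by_cell_centre_inj:
  assumes "j \<in> cell_centres n" "j' \<in> cell_centres n'" "C \<in> lcosets\<^bsub>crys\<^esub> centre" "C' \<in> lcosets\<^bsub>crys\<^esub> centre"
    and "move_by C j = move_by C' j'"
  shows "j = j' \<and> C = C'"
proof -
  obtain a b c where C: "C = coset a b c" using assms by (auto simp: lcosets_centre)
  obtain a' b' c' where C': "C' = coset a' b' c'" using assms by (auto simp: lcosets_centre)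
  have "move (a, b, c, False) j = move (a', b', c', False) j'"
    using assms(5) unfolding C C' move_by_coset[of _ _ _ False] .
  from move_cell_centre_inj[OF assms(1,2) this] show ?thesis by (auto simp: C C')
qed

lemma mid_eq_move_by:
  assumes "v \<in> R3"
  obtains j C where "j \<in> cell_centres (card (nonint v))" "nonint j = nonint v"
    "C \<in> lcosets\<^bsub>crys\<^esub> centre" "(\<lambda>i. mid (v i)) = move_by C j"
proof -
  obtain j q where j: "j \<in> cell_centres (card (nonint v))" "nonint j = nonint v" "(\<lambda>i. mid (v i)) = move q j"
    using mid_eq_move_cell_centre[OF assms] by blast
  obtain a b c e where q: "q = (a, b, c, e)" by (cases q)
  have "(\<lambda>i. mid (v i)) = move_by (coset a b c) j" using j(3) unfolding q move_by_coset[of a b c e] .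
  then show thesis using that[OF j(1,2), of "coset a b c"] by (auto simp: lcosets_centre)
qed

lemma move_by_surj:
  assumes "C \<in> lcosets\<^bsub>crys\<^esub> centre" "x \<in> R3"
  obtains y where "y \<in> R3" "move_by C y = x"
proof -
  obtain a b c where C: "C = coset a b c" using assms by (auto simp: lcosets_centre)
  have "move (a, b, c, False) (act (inv\<^bsub>crys\<^esub> enc (a, b, c, False)) x) = x"
    using act_inv(1)[OF assms(2), of "enc (a, b, c, False)"]
      act_enc[OF act_R3[OF assms(2)], of "(a, b, c, False)" "inv\<^bsub>crys\<^esub> enc (a, b, c, False)"] by (simp only:)
  then show thesis using that[OF act_R3[OF assms(2)]] unfolding C move_by_coset[of a b c False] by blast
qed

section \<open>Discs, skeleta and local finiteness\<close>

lemma continuous_map_discrete_prod: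
  assumes "\<And>a. a \<in> A \<Longrightarrow> continuous_map Y Z (\<lambda>y. f (a, y))"
  shows "continuous_map (prod_topology (discrete_topology A) Y) Z f"
  unfolding continuous_map_def
proof (intro conjI allI impI funcsetI)
  fix x assume "x \<in> topspace (prod_topology (discrete_topology A) Y)"
  then show "f x \<in> topspace Z" using assms by (auto simp: continuous_map_def Pi_iff)
next
  fix U assume U: "openin Z U"
  have "{x \<in> topspace (prod_topology (discrete_topology A) Y). f x \<in> U} =
      (\<Union>a\<in>A. {a} \<times> {y \<in> topspace Y. f (a, y) \<in> U})" by auto
  moreover have "openin (prod_topology (discrete_topology A) Y) ({a} \<times> {y \<in> topspace Y. f (a, y) \<in> U})" if "a \<in> A" for a
    using assms[OF that] U that by (auto simp: openin_prod_Times_iff continuous_map_def)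
  ultimately show "openin (prod_topology (discrete_topology A) Y) {x \<in> topspace (prod_topology (discrete_topology A) Y). f x \<in> U}"
    by auto
qed

lemma closedin_prod_slice:
  assumes "closedin (prod_topology X Y) T" "a \<in> topspace X"
  shows "closedin Y {y \<in> topspace Y. (a, y) \<in> T}"
proof -
  have "continuous_map Y (prod_topology X Y) (\<lambda>y. (a, y))"
    using assms by (intro continuous_map_pairedI) auto
  from closedin_continuous_map_preimage[OF this assms(1)] show ?thesis .
qed

abbreviation disc_set :: "nat \<Rightarrow> (nat \<Rightarrow> real) set" where
  "disc_set n \<equiv> {v. (\<forall>i\<ge>n. v i = 0) \<and> norm_sq n v \<le> 1}"

lemma disc_eq: "disc n = top_of_set (disc_set n)"
  unfolding disc_def Euclidean_space_eq subtopology_subtopology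
  by (rule arg_cong[where f = top_of_set]) auto

lemma topspace_disc: "topspace (disc n) = disc_set n"
  by (simp add: disc_eq)

lemma topspace_orbit_cell: "topspace (orbit_cell crys centre n) = (lcosets\<^bsub>crys\<^esub> centre) \<times> disc_set n"
  by (simp add: orbit_cell_def topspace_disc)

lemma compact_disc_set: "compact (disc_set n)"
proof -
  have c: "continuous_on UNIV (norm_sq n)"
    unfolding norm_sq_def[abs_def] by (intro continuous_intros continuous_on_product_coordinates)
  have "\<bar>v i\<bar> \<le> 1" if "norm_sq n v \<le> 1" "i < n" for v i
  proof -
    have "(v i)\<^sup>2 \<le> norm_sq n v"
      unfolding norm_sq_def using that(2) by (intro member_le_sum) auto
    then have "(v i)\<^sup>2 \<le> 1\<^sup>2" using that(1) by simp
    then show ?thesis by (simp only: power2_le_iff_abs_le[OF zero_le_one])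
  qed
  then have "disc_set n = {v. (\<forall>i<n. \<bar>v i\<bar> \<le> 1) \<and> (\<forall>i\<ge>n. v i = (0 :: real))} \<inter> {v. norm_sq n v \<le> 1}"
    by auto
  moreover have "closed {v. norm_sq n v \<le> 1}"
    by (rule closed_Collect_le[OF c continuous_on_const])
  ultimately show ?thesis
    using compact_Int_closed[OF compact_cube[of n 1]] by simp
qed

lemma closed_R3: "closed R3"
  using closedin_Euclidean_space_iff[of 3 R3] closedin_topspace[of E3] by simp

text \<open>To have at least \<open>n\<close> nonintegral coordinates is an open condition, being a
  union of finite intersections of open conditions.\<close>

lemma closed_skeleton: "closed {v \<in> R3. card (nonint v) < n}"
proof -
  let ?W = "\<Union>I\<in>{I. finite I \<and> card I = n}. \<Inter>i\<in>I. {v :: nat \<Rightarrow> real. v i \<notin> \<int>}"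
  have "open {v :: nat \<Rightarrow> real. v i \<notin> \<int>}" for i
  proof -
    have "open ((\<lambda>v :: nat \<Rightarrow> real. v i) -` (- \<int>))"
      by (rule open_vimage) (auto simp: open_closed[of "- \<int>"] intro: closed_Ints continuous_on_product_coordinates)
    then show ?thesis by (simp add: vimage_def)
  qed
  then have "open (\<Inter>i\<in>I. {v :: nat \<Rightarrow> real. v i \<notin> \<int>})" if "finite I" for I
    using that by (intro open_INT) auto
  then have "open ?W"
    by (intro open_UN) auto
  moreover have "{v \<in> R3. card (nonint v) < n} =
      R3 - ?W"
  proof (intro equalityI subsetI DiffI)
    fix v assume v: "v \<in> {v \<in> R3. card (nonint v) < n}"
    then show "v \<in> R3" by simp
    show "v \<notin> ?W"
    proof
      assume "v \<in> ?W"
      then obtain I where "card I = n" "I \<subseteq> nonint v" by (auto simp: nonint_def)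
      then show False using v card_mono[OF finite_nonint, of v I] by auto
    qed
  next
    fix v assume v: "v \<in> R3 - ?W"
    have "card (nonint v) < n"
    proof (rule ccontr)
      assume "\<not> card (nonint v) < n"
      then obtain I where "I \<subseteq> nonint v" "card I = n" "finite I"
        using obtain_subset_with_card_n[of n "nonint v"] by auto
      then show False using v by (auto simp: nonint_def)
    qed
    then show "v \<in> {v \<in> R3. card (nonint v) < n}" using v by simp
  qed
  ultimately show ?thesis using closed_R3 by (simp add: closed_Diff)
qed

lemma subtopology_Euclidean_3: "B \<subseteq> R3 \<Longrightarrow> subtopology E3 B = top_of_set B"
  unfolding Euclidean_space_eq subtopology_subtopology by (rule arg_cong[where f = top_of_set]) auto

lemma closedin_sub_Euclidean_3:
  "B \<subseteq> R3 \<Longrightarrow> closed B \<Longrightarrow> closedin (subtopology E3 B) S \<longleftrightarrow> closed S \<and> S \<subseteq> B"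
  by (simp add: subtopology_Euclidean_3 closedin_closed_eq)

text \<open>Local finiteness: a cell is determined by its centre, and centres are half-integral
  points, of which a bounded region contains finitely many.\<close>

lemma finite_bounded_cells:
  "finite {(j, C). j \<in> cell_centres n \<and> C \<in> lcosets\<^bsub>crys\<^esub> centre \<and> (\<forall>i<3. \<bar>move_by C j i\<bar> \<le> r)}" (is "finite ?I")
proof -
  let ?m = "\<lambda>(j, C). move_by C j"
  let ?h = "(\<lambda>m :: int. m / 2 :: real) ` {- \<lceil>2 * r\<rceil>..\<lceil>2 * r\<rceil>}"
  have "inj_on ?m ?I"
    by (rule inj_onI) (use move_by_cell_centre_inj in fast)
  moreover have "?m ` ?I \<subseteq> {p. \<forall>i. (i \<in> {..<3} \<longrightarrow> p i \<in> ?h) \<and> (i \<notin> {..<3} \<longrightarrow> p i = 0)}"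
  proof (intro image_subsetI CollectI allI conjI impI)
    fix p i assume "p \<in> ?I" "i \<notin> {..<(3 :: nat)}"
    then show "?m p i = 0" using move_by_R3 by auto
  next
    fix p i assume p: "p \<in> ?I" and i: "i \<in> {..<(3 :: nat)}"
    then obtain j C where p: "p = (j, C)" and j: "j \<in> cell_centres n" and C: "C \<in> lcosets\<^bsub>crys\<^esub> centre"
        and r: "\<forall>i<3. \<bar>move_by C j i\<bar> \<le> r" by blast
    obtain a b c where C: "C = coset a b c" using C by (auto simp: lcosets_centre)
    have "j k = 0 \<or> j k = 1/2" for k using j by (auto simp: cell_centres_def)
    then have "\<exists>m :: int. j k = m / 2" for k by (metis div_0 of_int_0 of_int_1)
    then obtain x :: "nat \<Rightarrow> int" where x: "\<And>k. j k = x k / 2" by metis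
    have "\<exists>m :: int. move (a, b, c, False) j i = m / 2"
    proof -
      from i consider "i = 0" | "i = 1" | "i = 2" by (auto simp: less_3_iff)
      then show ?thesis
      proof cases
        case 1 then show ?thesis by (intro exI[of _ "2 * a + sg b (x 0)"]) (simp add: x sg_def)
      next
        case 2 then show ?thesis by (intro exI[of _ "2 * b + x 1"]) (simp add: x)
      next
        case 3 then show ?thesis by (intro exI[of _ "2 * c + x 2"]) (simp add: x)
      qed
    qed
    then obtain m :: int where m: "move_by C j i = m / 2" unfolding C move_by_coset[of a b c False] by blast
    then have "\<bar>real_of_int m\<bar> \<le> 2 * r" using r i by auto
    then have "m \<in> {- \<lceil>2 * r\<rceil>..\<lceil>2 * r\<rceil>}" by (simp add: abs_le_iff) linarith
    then show "?m p i \<in> ?h" unfolding p prod.case m by blast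
  qed
  moreover have "finite {p :: nat \<Rightarrow> real. \<forall>i. (i \<in> {..<3} \<longrightarrow> p i \<in> ?h) \<and> (i \<notin> {..<3} \<longrightarrow> p i = 0)}"
    by (intro finite_set_of_finite_funs) auto
  ultimately show ?thesis using finite_imageD finite_subset by blast
qed

abbreviation skeleton :: "nat \<Rightarrow> (nat \<Rightarrow> real) set" where
  "skeleton n \<equiv> {v \<in> R3. card (nonint v) \<le> n}"

text \<open>The pushout as a set comes from \<open>mid\<close>, which recovers the cell of a point.
  For the topology, a bounded region meets only finitely many closed cells, and these are compact,
  so closedness can be tested cell by cell.\<close>

lemma attaches_cells_cubes:
  "attaches_cells crys E3 act n {v \<in> R3. card (nonint v) < n} (skeleton n)"
proof -
  define A where "A = {v \<in> R3. card (nonint v) < n}"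
  define B where "B = skeleton n"
  define Q where "Q j p = move_by (fst p) (cell j (snd p))" for j p
  have AB: "A \<subseteq> B" "B \<subseteq> R3" "A \<subseteq> R3" by (auto simp: A_def B_def)
  have clA: "closed A" unfolding A_def by (rule closed_skeleton)
  have clB: "closed B" using closed_skeleton[of "Suc n"] by (simp add: B_def less_Suc_eq_le)
  let ?cell = "orbit_cell crys centre n"
  let ?L = "lcosets\<^bsub>crys\<^esub> centre"
  let ?J = "cell_centres n"
  have QB: "Q j (C, v) \<in> B" if "j \<in> ?J" for j C v
    using that card_mono[OF finite_nonint[OF cell_centre_R3[OF that]] nonint_cell_subset[OF that, of v]]
    by (simp add: Q_def B_def move_by_R3 nonint_move_by[OF cell_R3[OF that]] card_nonint_cell_centre[OF that]) (rule move_by_R3[simplified])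
  have slice: "continuous_on S (\<lambda>v. Q j (C, v))" if "j \<in> ?J" for S j C
    unfolding Q_def fst_conv snd_conv
    by (rule continuous_on_compose2[OF continuous_move_by[of UNIV] continuous_cell[OF that]]) auto
  have contQ: "continuous_map ?cell (subtopology E3 B) (Q j)" if "j \<in> ?J" for j
    unfolding orbit_cell_def subtopology_Euclidean_3[OF AB(2)] disc_eq
    by (rule continuous_map_discrete_prod) (use slice[OF that] QB[OF that] in auto)
  have equiv: "Q j (g <#\<^bsub>crys\<^esub> C, v) = act g (Q j (C, v))" if "j \<in> ?J" "C \<in> ?L" for j g C v
    unfolding Q_def fst_conv snd_conv by (rule move_by_l_coset[OF that(2) cell_R3[OF that(1)]])
  have bdry: "Q j (C, v) \<in> A" if "j \<in> ?J" "norm_sq n v = 1" for j C v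
    using psubset_card_mono[OF finite_nonint[OF cell_centre_R3[OF that(1)]] nonint_cell_boundary[OF that]]
    by (simp add: Q_def A_def nonint_move_by[OF cell_R3[OF that(1)]] card_nonint_cell_centre[OF that(1)]) (rule move_by_R3[simplified])
  have midQ: "(\<lambda>i. mid (Q j (C, v) i)) = move_by C j" if "j \<in> ?J" "norm_sq n v < 1" for j C v
    unfolding Q_def fst_conv snd_conv mid_move_by[OF cell_R3[OF that(1)]] mid_cell[OF that] ..
  have distQ: "\<bar>Q j (C, v) i - move_by C j i\<bar> \<le> 1/2" if "j \<in> ?J" "norm_sq n v \<le> 1" for j C v i
    using cell_dist[OF that(1), of v i] that(2)
    by (simp add: Q_def move_by_dist[OF cell_R3[OF that(1)] cell_centre_R3[OF that(1)]])
  let ?D = "SIGMA j:?J. {(C, v) \<in> topspace ?cell. norm_sq n v < 1}"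
  have surjQ: "\<exists>j\<in>?J. \<exists>C\<in>?L. \<exists>v. (\<forall>i\<ge>n. v i = 0) \<and> norm_sq n v < 1 \<and> Q j (C, v) = x" if "x \<in> B - A" for x
  proof -
    have x: "x \<in> R3" "card (nonint x) = n" using that by (auto simp: A_def B_def)
    obtain j C where j: "j \<in> ?J" "C \<in> ?L" "(\<lambda>i. mid (x i)) = move_by C j"
      using mid_eq_move_by[OF x(1)] x(2) by metis
    obtain y where y: "y \<in> R3" "move_by C y = x" using move_by_surj[OF j(2) x(1)] by blast
    have yR: "(\<lambda>i. mid (y i)) \<in> R3" using y(1) by simp
    have "move_by C (\<lambda>i. mid (y i)) = move_by C j"
      using mid_move_by[OF y(1), of C] j(3) y(2) by simp
    then have "(\<lambda>i. mid (y i)) = j" by (simp only: move_by_eq_iff[OF yR cell_centre_R3[OF j(1)]])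
    then have "mid (y i) = j i" for i by (rule fun_cong)
    then obtain v where "\<forall>i\<ge>n. v i = 0" "norm_sq n v < 1" "cell j v = y"
      by (rule cell_surj[OF j(1) y(1)])
    then show ?thesis using j y(2) by (auto simp: Q_def)
  qed
  have bij: "bij_betw (\<lambda>(j, p). Q j p) ?D (B - A)"
    unfolding bij_betw_def
  proof
    show "inj_on (\<lambda>(j, p). Q j p) ?D"
    proof (rule inj_onI)
      fix p p' assume pp: "p \<in> ?D" "p' \<in> ?D" "(\<lambda>(j, p). Q j p) p = (\<lambda>(j, p). Q j p) p'"
      obtain j C v where p: "p = (j, (C, v))" by (metis surj_pair)
      obtain j' C' v' where p': "p' = (j', (C', v'))" by (metis surj_pair)
      have j: "j \<in> ?J" "(C, v) \<in> topspace ?cell" "norm_sq n v < 1" 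
        and j': "j' \<in> ?J" "(C', v') \<in> topspace ?cell" "norm_sq n v' < 1" and eq: "Q j (C, v) = Q j' (C', v')"
        using pp by (simp_all add: p p')
      have C: "C \<in> ?L" "\<forall>i\<ge>n. v i = 0" "C' \<in> ?L" "\<forall>i\<ge>n. v' i = 0"
        using j(2) j'(2) by (auto simp: topspace_orbit_cell)
      have "move_by C j = move_by C' j'"
        using midQ[OF j(1,3), of C] midQ[OF j'(1,3), of C'] eq by simp
      then have jC: "j = j'" "C = C'" using move_by_cell_centre_inj[OF j(1) j'(1) C(1,3)] by auto
      have "cell j v = cell j v'"
        using eq move_by_eq_iff[OF cell_R3[OF j(1)] cell_R3[OF j(1)]] by (auto simp: Q_def jC)
      then have "v = v'" using cell_inj[OF j(1) C(2,4)] by blast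
      then show "p = p'" using jC by (simp add: p p')
    qed
    show "(\<lambda>(j, p). Q j p) ` ?D = B - A"
    proof (intro equalityI image_subsetI subsetI)
      fix p assume "p \<in> ?D"
      then obtain j C v where p: "p = (j, (C, v))" "j \<in> ?J" "norm_sq n v < 1" by auto
      have "nonint (Q j (C, v)) = nonint j"
        using nonint_cell[OF p(2,3)] nonint_move_by[OF cell_R3[OF p(2)]] by (simp add: Q_def)
      then have "Q j (C, v) \<notin> A" using card_nonint_cell_centre[OF p(2)] by (simp add: A_def)
      then show "(\<lambda>(j, p). Q j p) p \<in> B - A" using QB[OF p(2)] p(1) by simp
    next
      fix x assume "x \<in> B - A"
      from surjQ[OF this] obtain j C v where *: "j \<in> ?J" "C \<in> ?L" "\<forall>i\<ge>n. v i = 0" "norm_sq n v < 1" "Q j (C, v) = x"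
        by blast
      then have "(j, (C, v)) \<in> ?D" by (simp add: topspace_orbit_cell)
      then show "x \<in> (\<lambda>(j, p). Q j p) ` ?D" using *(5) by (intro image_eqI[of _ _ "(j, (C, v))"]) simp_all
    qed
  qed
  have top: "closedin (subtopology E3 B) S \<longleftrightarrow>
         closedin (subtopology E3 A) (S \<inter> A) \<and>
         (\<forall>j\<in>?J. closedin ?cell {p \<in> topspace ?cell. Q j p \<in> S})" if SB: "S \<subseteq> B" for S
  proof
    assume S: "closedin (subtopology E3 B) S"
    then have "closed S" using closedin_sub_Euclidean_3[OF AB(2) clB] by blast
    then have "closedin (subtopology E3 A) (S \<inter> A)"
      using closedin_sub_Euclidean_3[OF AB(3) clA] clA by auto
    then show "closedin (subtopology E3 A) (S \<inter> A) \<and>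
         (\<forall>j\<in>?J. closedin ?cell {p \<in> topspace ?cell. Q j p \<in> S})"
      using closedin_continuous_map_preimage[OF contQ S] by blast
  next
    assume S: "closedin (subtopology E3 A) (S \<inter> A) \<and>
         (\<forall>j\<in>?J. closedin ?cell {p \<in> topspace ?cell. Q j p \<in> S})"
    have clSA: "closed (S \<inter> A)" using S closedin_sub_Euclidean_3[OF AB(3) clA] by blast
    \<comment> \<open>The part of \<open>S\<close> in a single closed cell; it is the image of a
      closed subset of the compact disc.\<close>
    define F where "F = (\<lambda>(j, C). (\<lambda>v. Q j (C, v)) ` {v \<in> disc_set n. Q j (C, v) \<in> S})"
    have clF: "closed (F (j, C))" if "j \<in> ?J" "C \<in> ?L" for j C
    proof -
      have "closedin (disc n) {v \<in> topspace (disc n). (C, v) \<in> {p \<in> topspace ?cell. Q j p \<in> S}}"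
        using S that by (intro closedin_prod_slice[of "discrete_topology ?L"]) (auto simp: orbit_cell_def)
      moreover have "{v \<in> topspace (disc n). (C, v) \<in> {p \<in> topspace ?cell. Q j p \<in> S}} = {v \<in> disc_set n. Q j (C, v) \<in> S}"
        using that(2) by (auto simp: topspace_orbit_cell topspace_disc)
      ultimately have "closedin (top_of_set (disc_set n)) {v \<in> disc_set n. Q j (C, v) \<in> S}"
        by (simp only: disc_eq)
      then have "compact {v \<in> disc_set n. Q j (C, v) \<in> S}"
        by (rule closedin_compact[OF compact_disc_set])
      then have "compact (F (j, C))"
        unfolding F_def prod.case by (rule compact_continuous_image[OF slice[OF that(1)]])
      then show ?thesis by (rule compact_imp_closed)
    qed
    have "closed S"
      unfolding closed_sequential_limits
    proof (intro allI impI, elim conjE)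
      fix x l assume xS: "\<forall>k. x k \<in> S" and lim: "x \<longlonglongrightarrow> l"
      have "\<exists>r. \<forall>k. \<bar>x k i\<bar> \<le> r" for i
      proof -
        have "(\<lambda>k. x k i) \<longlonglongrightarrow> l i"
          by (rule continuous_on_tendsto_compose[OF continuous_on_product_coordinates lim]) auto
        then have "Bseq (\<lambda>k. x k i)" by (intro convergent_imp_Bseq) (auto simp: convergent_def)
        then show ?thesis by (auto simp: Bseq_def)
      qed
      then obtain r where r: "\<And>i k. \<bar>x k i\<bar> \<le> r i" by metis
      \<comment> \<open>A convergent sequence is bounded in each coordinate. The extra 1 exceeds the
        distance 1/2 from a point of a cell to its centre, so the centres of all cells met by the
        sequence lie within \<open>R\<close>.\<close>
      define R where "R = max (r 0) (max (r 1) (r 2)) + 1"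
      have R: "\<bar>x k i\<bar> \<le> R - 1" if "i < 3" for i k
        using that r[of k i] unfolding less_3_iff R_def by fastforce
      let ?I = "{(j, C). j \<in> ?J \<and> C \<in> ?L \<and> (\<forall>i<3. \<bar>move_by C j i\<bar> \<le> R)}"
      define T where "T = (S \<inter> A) \<union> (\<Union>p\<in>?I. F p)"
      have "closed T"
        unfolding T_def using clSA clF by (intro closed_Un closed_UN finite_bounded_cells) auto
      moreover have "x k \<in> T" for k
      proof (cases "x k \<in> A")
        case False
        then have "x k \<in> B - A" using xS SB by blast
        from surjQ[OF this] obtain j C v where *: "j \<in> ?J" "C \<in> ?L" "\<forall>i\<ge>n. v i = 0" "norm_sq n v < 1" "Q j (C, v) = x k"
          by blast
        have "\<bar>move_by C j i\<bar> \<le> R" if "i < 3" for i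
          using distQ[OF *(1) less_imp_le[OF *(4)], of C i] R[OF that, of k] unfolding *(5) by linarith
        then have "(j, C) \<in> ?I" using * by simp
        moreover have "x k \<in> F (j, C)" using * xS by (auto simp: F_def intro!: image_eqI[of _ _ v])
        ultimately show ?thesis unfolding T_def by blast
      qed (use xS in \<open>auto simp: T_def\<close>)
      ultimately have "l \<in> T" using lim closed_sequential_limits by blast
      then show "l \<in> S" by (auto simp: T_def F_def)
    qed
    then show "closedin (subtopology E3 B) S"
      using closedin_sub_Euclidean_3[OF AB(2) clB] SB by blast
  qed
  have "attaches_cells crys E3 act n A B"
    unfolding attaches_cells_def
  proof (intro conjI exI[of _ ?J] exI[of _ "\<lambda>_. centre"] exI[of _ Q] ballI)
    show "A \<subseteq> B" "B \<subseteq> topspace E3" using AB by auto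
    show "bij_betw (\<lambda>(j, p). Q j p) ?D (B - A)" by (rule bij)
    show "\<forall>S\<subseteq>B. closedin (subtopology E3 B) S \<longleftrightarrow>
         closedin (subtopology E3 A) (S \<inter> A) \<and>
         (\<forall>j\<in>?J. closedin ?cell {p \<in> topspace ?cell. Q j p \<in> S})"
      using top by blast
    fix j assume j: "j \<in> ?J"
    show "subgroup centre crys" by (rule subgroup_centre)
    show "continuous_map ?cell (subtopology E3 B) (Q j)" by (rule contQ[OF j])
    show "case p of (C, v) \<Rightarrow> norm_sq n v = 1 \<longrightarrow> Q j (C, v) \<in> A" for p
      using bdry[OF j] by (cases p) simp
    show "case p of (C, v) \<Rightarrow> Q j (g <#\<^bsub>crys\<^esub> C, v) = act g (Q j (C, v))" if "p \<in> topspace ?cell" for p g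
      using equiv[OF j] that by (cases p) (simp add: topspace_orbit_cell)
  qed
  then show ?thesis by (simp only: A_def B_def)
qed

theorem classifying_space_crys: "classifying_space_proper crys E3 act"
proof -
  have "G_CW_complex crys E3 act"
    unfolding G_CW_complex_def
  proof (intro conjI exI[of _ "\<lambda>n. skeleton n"] allI impI G_space_act)
    show "attaches_cells crys E3 act 0 {} (skeleton 0)"
      using attaches_cells_cubes[of 0] by simp
    show "attaches_cells crys E3 act (Suc n) (skeleton n)
      (skeleton (Suc n))" for n
      using attaches_cells_cubes[of "Suc n"] by (simp only: less_Suc_eq_le)
    show "(\<Union>n. skeleton n) = topspace E3" by auto
    \<comment> \<open>The skeleta exhaust the space in dimension three, so this one skeleton tests
      the weak topology.\<close>
    have 3: "skeleton 3 = R3" using card_nonint by blast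
    fix S assume S: "S \<subseteq> topspace E3"
    have cl: "closed (skeleton n)" for n
      using closed_skeleton[of "Suc n"] by (simp only: less_Suc_eq_le)
    have iff: "closedin (subtopology E3 (skeleton n)) (S \<inter> skeleton n)
        \<longleftrightarrow> closed (S \<inter> skeleton n)" for n
      by (subst closedin_sub_Euclidean_3[OF _ cl]) auto
    show "closedin E3 S \<longleftrightarrow>
      (\<forall>n. closedin (subtopology E3 (skeleton n)) (S \<inter> skeleton n))"
      unfolding iff
    proof
      assume "closedin E3 S"
      then show "\<forall>n. closed (S \<inter> skeleton n)"
        using cl by (simp add: closedin_Euclidean_space_iff closed_Int)
    next
      assume "\<forall>n. closed (S \<inter> skeleton n)"
      then have "closed (S \<inter> skeleton 3)" ..
      moreover have "S \<inter> skeleton 3 = S" using S unfolding 3 by auto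
      ultimately show "closedin E3 S" using S by (simp add: closedin_Euclidean_space_iff)
    qed
  qed
  moreover have "contractible_space (subtopology E3 R3)"
    by (metis contractible_Euclidean_space subtopology_topspace topspace_Euclidean_3)
  moreover have "R3 \<noteq> {}" by auto
  moreover have "finite (stabilizer crys act x)" if "x \<in> R3" for x
    using stabilizer_act[OF that] finite_centre finite_subset by blast
  ultimately show ?thesis
    by (simp add: classifying_space_proper_def fixed_points_act)
qed

subsection \<open>Grothendieck groups\<close>

lemma groth_rel_iff:
  fixes M (structure)
  shows "((a, b), (c, d)) \<in> groth_rel M \<longleftrightarrow> a \<in> carrier M \<and> b \<in> carrier M \<and> c \<in> carrier M \<and> d \<in> carrier M \<and>
    (\<exists>k\<in>carrier M. a \<otimes> d \<otimes> k = c \<otimes> b \<otimes> k)"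
  by (simp add: groth_rel_def)

lemma equiv_groth_rel:
  fixes M (structure)
  assumes "comm_monoid M"
  shows "equiv (carrier M \<times> carrier M) (groth_rel M)"
proof -
  interpret comm_monoid M by fact
  show ?thesis
  proof (rule equivI)
    show "groth_rel M \<subseteq> (carrier M \<times> carrier M) \<times> (carrier M \<times> carrier M)"
      by (auto simp: groth_rel_def)
    show "refl_on (carrier M \<times> carrier M) (groth_rel M)"
      by (auto simp: refl_on_def groth_rel_def)
    show "sym (groth_rel M)"
    proof (rule symI, clarify)
      fix a b c d assume "((a, b), (c, d)) \<in> groth_rel M"
      then show "((c, d), (a, b)) \<in> groth_rel M" unfolding groth_rel_iff by metis
    qed
    show "trans (groth_rel M)"
    proof (rule transI, clarify)
      fix a b c d e f
      assume "((a, b), (c, d)) \<in> groth_rel M" "((c, d), (e, f)) \<in> groth_rel M"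
      then obtain k l where *: "a \<in> carrier M" "b \<in> carrier M" "c \<in> carrier M" "d \<in> carrier M" "e \<in> carrier M" "f \<in> carrier M"
          "k \<in> carrier M" "l \<in> carrier M" "a \<otimes> d \<otimes> k = c \<otimes> b \<otimes> k" "c \<otimes> f \<otimes> l = e \<otimes> d \<otimes> l"
        unfolding groth_rel_iff by blast
      have "a \<otimes> f \<otimes> (d \<otimes> k \<otimes> l) = (a \<otimes> d \<otimes> k) \<otimes> (f \<otimes> l)"
        using *(1-8) by (simp add: m_ac)
      also have "\<dots> = (c \<otimes> f \<otimes> l) \<otimes> (b \<otimes> k)"
        unfolding *(9) using *(1-8) by (simp add: m_ac)
      also have "\<dots> = e \<otimes> b \<otimes> (d \<otimes> k \<otimes> l)"
        unfolding *(10) using *(1-8) by (simp add: m_ac)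
      finally show "((a, b), (e, f)) \<in> groth_rel M"
        using *(1-8) unfolding groth_rel_iff by blast
    qed
  qed
qed

lemma groth_incl_in_carrier:
  assumes "comm_monoid M" "a \<in> carrier M"
  shows "groth_incl M a \<in> carrier (groth M)"
proof -
  interpret comm_monoid M by fact
  show ?thesis using assms(2) by (auto simp: groth_incl_def groth_def intro: quotientI)
qed

text \<open>\<open>groth_map\<close>, the pullbacks and \<open>Rep_U_incl\<close> all apply a
  function to a whole class and saturate the result; this evaluates them on one
  representative.\<close>

lemma image_equiv_class:
  assumes R: "equiv B R" and f: "\<And>x y. (x, y) \<in> R' \<Longrightarrow> (f x, f y) \<in> R" and x: "(x, x) \<in> R'"
  shows "R `` (f ` (R' `` {x})) = R `` {f x}"
proof (intro equalityI subsetI)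
  fix z assume "z \<in> R `` (f ` (R' `` {x}))"
  then obtain y where "(x, y) \<in> R'" "(f y, z) \<in> R" by blast
  then have "(f x, z) \<in> R" using f R transD[of R "f x" "f y" z] by (simp add: equiv_def)
  then show "z \<in> R `` {f x}" by simp
next
  fix z assume "z \<in> R `` {f x}"
  then show "z \<in> R `` (f ` (R' `` {x}))" using x by blast
qed

lemma groth_map_groth_incl:
  assumes M: "comm_monoid M" and N: "comm_monoid N" and f: "f \<in> hom M N" "f \<one>\<^bsub>M\<^esub> = \<one>\<^bsub>N\<^esub>" and a: "a \<in> carrier M"
  shows "groth_map N f (groth_incl M a) = groth_incl N (f a)"
proof -
  interpret M: comm_monoid M by fact
  have fc: "f x \<in> carrier N" if "x \<in> carrier M" for x using f(1) that by (auto simp: hom_def)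
  have "(map_prod f f p, map_prod f f q) \<in> groth_rel N" if pq: "(p, q) \<in> groth_rel M" for p q
  proof -
    obtain b d where p: "p = (b, d)" by (cases p)
    obtain b' d' where q: "q = (b', d')" by (cases q)
    obtain k where *: "b \<in> carrier M" "d \<in> carrier M" "b' \<in> carrier M" "d' \<in> carrier M" "k \<in> carrier M"
        "b \<otimes>\<^bsub>M\<^esub> d' \<otimes>\<^bsub>M\<^esub> k = b' \<otimes>\<^bsub>M\<^esub> d \<otimes>\<^bsub>M\<^esub> k"
      using pq unfolding p q groth_rel_iff by blast
    have "f b \<otimes>\<^bsub>N\<^esub> f d' \<otimes>\<^bsub>N\<^esub> f k = f b' \<otimes>\<^bsub>N\<^esub> f d \<otimes>\<^bsub>N\<^esub> f k"
      using arg_cong[OF *(6), of f] *(1-5) by (simp only: hom_mult[OF f(1)] M.m_closed)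
    then show ?thesis
      using *(1-5) fc unfolding p q map_prod_simp groth_rel_iff by blast
  qed
  moreover have "((a, \<one>\<^bsub>M\<^esub>), (a, \<one>\<^bsub>M\<^esub>)) \<in> groth_rel M"
    using a unfolding groth_rel_iff by blast
  ultimately have "groth_rel N `` (map_prod f f ` (groth_rel M `` {(a, \<one>\<^bsub>M\<^esub>)})) = groth_rel N `` {map_prod f f (a, \<one>\<^bsub>M\<^esub>)}"
    by (rule image_equiv_class[OF equiv_groth_rel[OF N]])
  then show ?thesis by (simp add: groth_map_def groth_incl_def f(2))
qed

subsection \<open>Representations up to isomorphism\<close>

lemma carrier_GL: "carrier (GL n) = {A \<in> carrier_mat n n. \<exists>B\<in>carrier_mat n n. B * A = 1\<^sub>m n \<and> A * B = 1\<^sub>m n}"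
  by (auto simp: GL_def units_of_def Units_def ring_mat_simps)

lemma mult_GL: "A \<otimes>\<^bsub>GL n\<^esub> B = A * B"
  by (simp add: GL_def units_of_def ring_mat_simps)

lemma one_GL: "\<one>\<^bsub>GL n\<^esub> = 1\<^sub>m n"
  by (simp add: GL_def units_of_def ring_mat_simps)

lemma group_GL: "group (GL n)"
proof -
  interpret ring "ring_mat TYPE(complex) n ()" by (rule ring_mat)
  show ?thesis unfolding GL_def by (rule units_group)
qed

lemma GL_carrier_mat: "A \<in> carrier (GL n) \<Longrightarrow> A \<in> carrier_mat n n"
  by (simp add: carrier_GL)

lemma GL_I: "A \<in> carrier_mat n n \<Longrightarrow> B \<in> carrier_mat n n \<Longrightarrow> A * B = 1\<^sub>m n \<Longrightarrow> A \<in> carrier (GL n)"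
  using mat_mult_left_right_inverse[of A n B] by (auto simp: carrier_GL)

lemma det_GL:
  assumes "A \<in> carrier (GL n)"
  shows "det A \<noteq> 0"
proof -
  obtain B where "A \<in> carrier_mat n n" "B \<in> carrier_mat n n" "B * A = 1\<^sub>m n"
    using assms unfolding carrier_GL by blast
  then have "det B * det A = 1" using det_mult[of B n A] by simp
  then show ?thesis by auto
qed

lemma equiv_conj_rel:
  fixes L (structure)
  assumes "group L"
  shows "equiv (Hom K L) (conj_rel K L)"
proof -
  interpret group L by fact
  have H: "\<rho> h \<in> carrier L" if "\<rho> \<in> Hom K L" "h \<in> carrier K" for \<rho> h
    using that by (auto simp: Hom_def hom_def)
  show ?thesis
  proof (rule equivI)
    show "conj_rel K L \<subseteq> Hom K L \<times> Hom K L" by (auto simp: conj_rel_def)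
    show "refl_on (Hom K L) (conj_rel K L)"
      by (auto simp: refl_on_def conj_rel_def H intro!: bexI[of _ "\<one>"])
    show "sym (conj_rel K L)"
    proof (rule symI)
      fix \<rho> \<sigma> assume "(\<rho>, \<sigma>) \<in> conj_rel K L"
      then obtain P where *: "\<rho> \<in> Hom K L" "\<sigma> \<in> Hom K L" "P \<in> carrier L"
          "\<And>h. h \<in> carrier K \<Longrightarrow> \<sigma> h = P \<otimes> \<rho> h \<otimes> inv P"
        by (auto simp: conj_rel_def)
      have "\<rho> h = inv P \<otimes> \<sigma> h \<otimes> inv (inv P)" if "h \<in> carrier K" for h
        using *(3) H[OF *(1) that] unfolding *(4)[OF that]
        by (simp add: m_assoc) (simp add: m_assoc[symmetric])
      then show "(\<sigma>, \<rho>) \<in> conj_rel K L" using * by (auto simp: conj_rel_def intro!: bexI[of _ "inv P"])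
    qed
    show "trans (conj_rel K L)"
    proof (rule transI)
      fix \<rho> \<sigma> \<tau> assume "(\<rho>, \<sigma>) \<in> conj_rel K L" "(\<sigma>, \<tau>) \<in> conj_rel K L"
      then obtain P Q where *: "\<rho> \<in> Hom K L" "\<tau> \<in> Hom K L" "P \<in> carrier L" "Q \<in> carrier L"
          "\<And>h. h \<in> carrier K \<Longrightarrow> \<sigma> h = P \<otimes> \<rho> h \<otimes> inv P"
          "\<And>h. h \<in> carrier K \<Longrightarrow> \<tau> h = Q \<otimes> \<sigma> h \<otimes> inv Q"
        unfolding conj_rel_def by blast
      have "\<tau> h = (Q \<otimes> P) \<otimes> \<rho> h \<otimes> inv (Q \<otimes> P)" if "h \<in> carrier K" for h
        using *(3,4) H[OF *(1) that] unfolding *(6)[OF that] *(5)[OF that]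
        by (simp add: m_assoc inv_mult_group)
      then show "(\<rho>, \<tau>) \<in> conj_rel K L" using * by (auto simp: conj_rel_def intro!: bexI[of _ "Q \<otimes> P"])
    qed
  qed
qed

lemma conj_rel_subgroup:
  fixes L (structure)
  assumes "group L" "subgroup S L" "(\<rho>, \<sigma>) \<in> conj_rel K (L\<lparr>carrier := S\<rparr>)"
  shows "(\<rho>, \<sigma>) \<in> conj_rel K L"
proof -
  have S: "S \<subseteq> carrier L" using assms(2) by (rule subgroup.subset)
  obtain P where *: "\<rho> \<in> Hom K (L\<lparr>carrier := S\<rparr>)" "\<sigma> \<in> Hom K (L\<lparr>carrier := S\<rparr>)" "P \<in> S"
      "\<And>h. h \<in> carrier K \<Longrightarrow> \<sigma> h = P \<otimes> \<rho> h \<otimes> inv\<^bsub>L\<lparr>carrier := S\<rparr>\<^esub> P"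
    using assms(3) by (auto simp: conj_rel_def)
  then show ?thesis
    using S group.m_inv_consistent[OF assms(1,2) *(3)]
    by (auto simp: conj_rel_def Hom_def hom_def Pi_iff intro!: bexI[of _ P])
qed

lemma pullback_hom_Hom:
  fixes G (structure)
  assumes G: "group G" and HK: "subgroup H G" "subgroup K G" "g \<in> carrier G"
    and ad: "\<And>h. h \<in> H \<Longrightarrow> inv g \<otimes> h \<otimes> g \<in> K"
    and \<rho>: "\<rho> \<in> Hom (sub G K) L"
  shows "pullback_hom G H g \<rho> \<in> Hom (sub G H) L"
proof -
  interpret group G by fact
  have "\<rho> (inv g \<otimes> (h \<otimes> h') \<otimes> g) = \<rho> (inv g \<otimes> h \<otimes> g) \<otimes>\<^bsub>L\<^esub> \<rho> (inv g \<otimes> h' \<otimes> g)"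
    if h: "h \<in> H" "h' \<in> H" for h h'
  proof -
    have c: "h \<in> carrier G" "h' \<in> carrier G" using h HK(1) subgroup.subset by blast+
    have "inv g \<otimes> (h \<otimes> h') \<otimes> g = (inv g \<otimes> h \<otimes> g) \<otimes> (inv g \<otimes> h' \<otimes> g)"
      using c HK(3) by (simp add: m_assoc inv_solve_left) (simp add: m_assoc[symmetric])
    then show ?thesis using \<rho> ad[OF h(1)] ad[OF h(2)] by (simp add: Hom_def hom_def sub_def)
  qed
  then show ?thesis
    using \<rho> ad subgroup.m_closed[OF HK(1)] by (auto simp: Hom_def hom_def sub_def pullback_hom_def Pi_iff)
qed

lemma pullback_hom_conj_rel:
  fixes G (structure)
  assumes G: "group G" and HK: "subgroup H G" "subgroup K G" "g \<in> carrier G"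
    and ad: "\<And>h. h \<in> H \<Longrightarrow> inv g \<otimes> h \<otimes> g \<in> K"
    and \<rho>\<sigma>: "(\<rho>, \<sigma>) \<in> conj_rel (sub G K) L"
  shows "(pullback_hom G H g \<rho>, pullback_hom G H g \<sigma>) \<in> conj_rel (sub G H) L"
proof -
  obtain P where *: "\<rho> \<in> Hom (sub G K) L" "\<sigma> \<in> Hom (sub G K) L" "P \<in> carrier L"
      "\<And>h. h \<in> K \<Longrightarrow> \<sigma> h = P \<otimes>\<^bsub>L\<^esub> \<rho> h \<otimes>\<^bsub>L\<^esub> inv\<^bsub>L\<^esub> P"
    using \<rho>\<sigma> by (auto simp: conj_rel_def sub_def)
  then have "\<forall>h\<in>carrier (sub G H). pullback_hom G H g \<sigma> h = P \<otimes>\<^bsub>L\<^esub> pullback_hom G H g \<rho> h \<otimes>\<^bsub>L\<^esub> inv\<^bsub>L\<^esub> P"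
    using ad by (simp add: sub_def pullback_hom_def)
  with *(1-3) pullback_hom_Hom[OF G HK ad] show ?thesis
    unfolding conj_rel_def by blast
qed

lemma equiv_rep_iso:
  assumes "group K"
  shows "equiv (reps K) (rep_iso K)"
proof -
  interpret K: group K by fact
  \<comment> \<open>The degree of a representation is the size of its matrix at the identity, so
    isomorphisms in different degrees cannot be chained.\<close>
  have deg: "n = m" if "\<rho> \<in> Hom K (GL n)" "\<rho> \<in> Hom K (GL m)" for \<rho> n m
  proof -
    have "\<rho> \<one>\<^bsub>K\<^esub> \<in> carrier (GL n)" "\<rho> \<one>\<^bsub>K\<^esub> \<in> carrier (GL m)"
      using that K.one_closed unfolding Hom_def hom_def by blast+
    then have "\<rho> \<one>\<^bsub>K\<^esub> \<in> carrier_mat n n" "\<rho> \<one>\<^bsub>K\<^esub> \<in> carrier_mat m m"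
      by (blast dest: GL_carrier_mat)+
    then show ?thesis by auto
  qed
  note eq = equiv_conj_rel[OF group_GL, of K]
  show ?thesis
  proof (rule equivI)
    show "rep_iso K \<subseteq> reps K \<times> reps K"
      unfolding rep_iso_def reps_def by (auto simp: conj_rel_def)
    show "refl_on (reps K) (rep_iso K)"
      using eq unfolding equiv_def refl_on_def rep_iso_def reps_def by blast
    show "sym (rep_iso K)"
      using eq unfolding equiv_def sym_def rep_iso_def by blast
    show "trans (rep_iso K)"
    proof (rule transI)
      fix \<rho> \<sigma> \<tau> assume "(\<rho>, \<sigma>) \<in> rep_iso K" "(\<sigma>, \<tau>) \<in> rep_iso K"
      then obtain n m where *: "(\<rho>, \<sigma>) \<in> conj_rel K (GL n)" "(\<sigma>, \<tau>) \<in> conj_rel K (GL m)"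
        by (auto simp: rep_iso_def)
      then have "n = m" using deg[of \<sigma>] by (auto simp: conj_rel_def)
      then have "(\<rho>, \<tau>) \<in> conj_rel K (GL n)" using * eq[of n] unfolding equiv_def trans_def by blast
      then show "(\<rho>, \<tau>) \<in> rep_iso K" by (auto simp: rep_iso_def)
    qed
  qed
qed

subsection \<open>Direct sums\<close>

definition dirsum :: "complex Matrix.mat \<Rightarrow> complex Matrix.mat \<Rightarrow> complex Matrix.mat" where
  "dirsum A B = four_block_mat A (0\<^sub>m (dim_row A) (dim_col B)) (0\<^sub>m (dim_row B) (dim_col A)) B"

lemma rep_sum_dirsum: "rep_sum K \<rho> \<sigma> = (\<lambda>h\<in>carrier K. dirsum (\<rho> h) (\<sigma> h))"
  by (simp add: rep_sum_def dirsum_def)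

lemma dirsum_eq: "A \<in> carrier_mat n n \<Longrightarrow> B \<in> carrier_mat m m \<Longrightarrow> dirsum A B = four_block_mat A (0\<^sub>m n m) (0\<^sub>m m n) B"
  by (auto simp: dirsum_def)

lemma dirsum_carrier_mat: "A \<in> carrier_mat n n \<Longrightarrow> B \<in> carrier_mat m m \<Longrightarrow> dirsum A B \<in> carrier_mat (n + m) (n + m)"
  by (simp add: dirsum_def)

lemma dirsum_mult:
  assumes "A \<in> carrier_mat n n" "B \<in> carrier_mat m m" "A' \<in> carrier_mat n n" "B' \<in> carrier_mat m m"
  shows "dirsum A B * dirsum A' B' = dirsum (A * A') (B * B')"
proof -
  have "dirsum A B * dirsum A' B' = four_block_mat (A * A' + 0\<^sub>m n m * 0\<^sub>m m n) (A * 0\<^sub>m n m + 0\<^sub>m n m * B')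
      (0\<^sub>m m n * A' + B * 0\<^sub>m m n) (0\<^sub>m m n * 0\<^sub>m n m + B * B')"
    unfolding dirsum_eq[OF assms(1,2)] dirsum_eq[OF assms(3,4)]
    by (rule mult_four_block_mat) (use assms in auto)
  also have "\<dots> = four_block_mat (A * A') (0\<^sub>m n m) (0\<^sub>m m n) (B * B')"
    using assms by (intro cong_four_block_mat) auto
  also have "\<dots> = dirsum (A * A') (B * B')"
    by (rule dirsum_eq[symmetric]) (use assms in auto)
  finally show ?thesis .
qed

lemma dirsum_one: "dirsum (1\<^sub>m n) (1\<^sub>m m) = 1\<^sub>m (n + m)"
  by (simp add: dirsum_def)

lemma dirsum_GL:
  assumes "A \<in> carrier (GL n)" "B \<in> carrier (GL m)"
  shows "dirsum A B \<in> carrier (GL (n + m))"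
proof -
  obtain A' B' where "A' \<in> carrier_mat n n" "A * A' = 1\<^sub>m n" "B' \<in> carrier_mat m m" "B * B' = 1\<^sub>m m"
    using assms by (auto simp: carrier_GL)
  then show ?thesis
    using GL_carrier_mat[OF assms(1)] GL_carrier_mat[OF assms(2)]
    by (intro GL_I[of _ _ "dirsum A' B'"]) (simp_all add: dirsum_carrier_mat dirsum_mult dirsum_one)
qed

lemma det_dirsum: "A \<in> carrier_mat n n \<Longrightarrow> B \<in> carrier_mat m m \<Longrightarrow> det (dirsum A B) = det A * det B"
  by (simp add: dirsum_eq det_four_block_mat_lower_left_zero[of _ n _ m])

lemma dirsum_assoc:
  assumes "A \<in> carrier_mat n n" "B \<in> carrier_mat m m" "C \<in> carrier_mat k k"
  shows "dirsum (dirsum A B) C = dirsum A (dirsum B C)"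
  by (rule eq_matI) (use assms in \<open>auto simp: dirsum_def\<close>)

lemma dirsum_empty: "A \<in> carrier_mat n n \<Longrightarrow> dirsum (1\<^sub>m 0) A = A"
  by (rule eq_matI) (auto simp: dirsum_def)

text \<open>The block permutation matrix that intertwines the two orders of a direct sum.\<close>

definition swap_mat :: "nat \<Rightarrow> nat \<Rightarrow> complex Matrix.mat" where
  "swap_mat n m = four_block_mat (0\<^sub>m m n) (1\<^sub>m m) (1\<^sub>m n) (0\<^sub>m n m)"

lemma swap_mat_carrier_mat: "swap_mat n m \<in> carrier_mat (m + n) (n + m)"
  by (simp add: swap_mat_def)

lemma swap_mat_inverse: "swap_mat m n * swap_mat n m = 1\<^sub>m (n + m)"
proof -
  have "swap_mat m n * swap_mat n m = four_block_mat (0\<^sub>m n m * 0\<^sub>m m n + 1\<^sub>m n * 1\<^sub>m n) (0\<^sub>m n m * 1\<^sub>m m + 1\<^sub>m n * 0\<^sub>m n m)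
     (1\<^sub>m m * 0\<^sub>m m n + 0\<^sub>m m n * 1\<^sub>m n) (1\<^sub>m m * 1\<^sub>m m + 0\<^sub>m m n * 0\<^sub>m n m)"
    unfolding swap_mat_def by (rule mult_four_block_mat) auto
  also have "\<dots> = four_block_mat (1\<^sub>m n) (0\<^sub>m n m) (0\<^sub>m m n) (1\<^sub>m m)"
    by (intro cong_four_block_mat) auto
  finally show ?thesis by simp
qed

lemma swap_mat_GL: "swap_mat n m \<in> carrier (GL (n + m))"
  using swap_mat_carrier_mat[of n m] swap_mat_carrier_mat[of m n] swap_mat_inverse[of n m]
  by (intro GL_I[of _ _ "swap_mat m n"]) (simp_all add: add.commute)

lemma swap_mat_dirsum:
  assumes "A \<in> carrier_mat n n" "B \<in> carrier_mat m m"
  shows "swap_mat n m * dirsum A B = dirsum B A * swap_mat n m"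
proof -
  have "swap_mat n m * dirsum A B = four_block_mat (0\<^sub>m m n * A + 1\<^sub>m m * 0\<^sub>m m n) (0\<^sub>m m n * 0\<^sub>m n m + 1\<^sub>m m * B)
      (1\<^sub>m n * A + 0\<^sub>m n m * 0\<^sub>m m n) (1\<^sub>m n * 0\<^sub>m n m + 0\<^sub>m n m * B)"
    unfolding swap_mat_def dirsum_eq[OF assms] by (rule mult_four_block_mat) (use assms in auto)
  also have "\<dots> = four_block_mat (0\<^sub>m m n) B A (0\<^sub>m n m)"
    using assms by (intro cong_four_block_mat) auto
  also have "\<dots> = four_block_mat (B * 0\<^sub>m m n + 0\<^sub>m m n * 1\<^sub>m n) (B * 1\<^sub>m m + 0\<^sub>m m n * 0\<^sub>m n m)
      (0\<^sub>m n m * 0\<^sub>m m n + A * 1\<^sub>m n) (0\<^sub>m n m * 1\<^sub>m m + A * 0\<^sub>m n m)"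
    using assms by (intro cong_four_block_mat) auto
  also have "\<dots> = dirsum B A * swap_mat n m"
    unfolding swap_mat_def dirsum_eq[OF assms(2,1)] by (rule mult_four_block_mat[symmetric]) (use assms in auto)
  finally show ?thesis .
qed

lemma repsE:
  assumes "\<rho> \<in> reps K"
  obtains n where "\<rho> \<in> Hom K (GL n)" "\<And>h. h \<in> carrier K \<Longrightarrow> \<rho> h \<in> carrier_mat n n"
proof -
  obtain n where n: "\<rho> \<in> Hom K (GL n)" using assms by (auto simp: reps_def)
  then have "\<rho> h \<in> carrier_mat n n" if "h \<in> carrier K" for h
    using that GL_carrier_mat by (auto simp: Hom_def hom_def)
  with n that show thesis by blast
qed

lemma rep_sum_Hom:
  assumes "group K" "\<rho> \<in> Hom K (GL n)" "\<sigma> \<in> Hom K (GL m)"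
  shows "rep_sum K \<rho> \<sigma> \<in> Hom K (GL (n + m))"
proof -
  interpret group K by fact
  have \<rho>: "\<rho> h \<in> carrier (GL n)" "\<sigma> h \<in> carrier (GL m)" if "h \<in> carrier K" for h
    using assms(2,3) that by (auto simp: Hom_def hom_def)
  have "dirsum (\<rho> (h \<otimes>\<^bsub>K\<^esub> k)) (\<sigma> (h \<otimes>\<^bsub>K\<^esub> k)) = dirsum (\<rho> h) (\<sigma> h) * dirsum (\<rho> k) (\<sigma> k)"
    if "h \<in> carrier K" "k \<in> carrier K" for h k
    using assms(2,3) that dirsum_mult[OF \<rho>[OF that(1), THEN GL_carrier_mat] \<rho>[OF that(2), THEN GL_carrier_mat]]
    by (simp add: Hom_def hom_def mult_GL)
  then show ?thesis using \<rho> dirsum_GL by (auto simp: Hom_def hom_def rep_sum_dirsum mult_GL)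
qed

lemma rep_isoE:
  assumes "(\<rho>, \<sigma>) \<in> rep_iso K"
  obtains n P where "\<rho> \<in> Hom K (GL n)" "\<sigma> \<in> Hom K (GL n)" "P \<in> carrier (GL n)"
    "\<And>h. h \<in> carrier K \<Longrightarrow> \<sigma> h * P = P * \<rho> h"
proof -
  obtain n P where *: "\<rho> \<in> Hom K (GL n)" "\<sigma> \<in> Hom K (GL n)" "P \<in> carrier (GL n)"
    "\<And>h. h \<in> carrier K \<Longrightarrow> \<sigma> h = P \<otimes>\<^bsub>GL n\<^esub> \<rho> h \<otimes>\<^bsub>GL n\<^esub> inv\<^bsub>GL n\<^esub> P"
    using assms unfolding rep_iso_def conj_rel_def by blast
  interpret group "GL n" by (rule group_GL)
  have "\<sigma> h \<otimes>\<^bsub>GL n\<^esub> P = P \<otimes>\<^bsub>GL n\<^esub> \<rho> h" if "h \<in> carrier K" for h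
  proof -
    have "\<rho> h \<in> carrier (GL n)" using *(1) that by (auto simp: Hom_def hom_def)
    then show ?thesis unfolding *(4)[OF that] using *(3) by (simp add: m_assoc)
  qed
  then show ?thesis using that[OF *(1-3)] by (simp only: mult_GL)
qed

lemma rep_isoI:
  assumes "\<rho> \<in> Hom K (GL n)" "\<sigma> \<in> Hom K (GL n)" "P \<in> carrier (GL n)"
    and "\<And>h. h \<in> carrier K \<Longrightarrow> \<sigma> h * P = P * \<rho> h"
  shows "(\<rho>, \<sigma>) \<in> rep_iso K"
proof -
  interpret group "GL n" by (rule group_GL)
  have "\<sigma> h = P \<otimes>\<^bsub>GL n\<^esub> \<rho> h \<otimes>\<^bsub>GL n\<^esub> inv\<^bsub>GL n\<^esub> P" if "h \<in> carrier K" for h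
  proof -
    have "\<rho> h \<in> carrier (GL n)" "\<sigma> h \<in> carrier (GL n)" using assms(1,2) that by (auto simp: Hom_def hom_def)
    then have "\<sigma> h = (\<sigma> h \<otimes>\<^bsub>GL n\<^esub> P) \<otimes>\<^bsub>GL n\<^esub> inv\<^bsub>GL n\<^esub> P"
      using assms(3) by (simp add: m_assoc)
    also have "\<sigma> h \<otimes>\<^bsub>GL n\<^esub> P = P \<otimes>\<^bsub>GL n\<^esub> \<rho> h"
      using assms(4)[OF that] by (simp only: mult_GL)
    finally show ?thesis .
  qed
  then show ?thesis using assms(1-3) unfolding rep_iso_def conj_rel_def by blast
qed

lemma rep_sum_iso:
  assumes K: "group K" and "(\<rho>, \<rho>') \<in> rep_iso K" "(\<sigma>, \<sigma>') \<in> rep_iso K"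
  shows "(rep_sum K \<rho> \<sigma>, rep_sum K \<rho>' \<sigma>') \<in> rep_iso K"
proof -
  obtain n P where P: "\<rho> \<in> Hom K (GL n)" "\<rho>' \<in> Hom K (GL n)" "P \<in> carrier (GL n)"
    "\<And>h. h \<in> carrier K \<Longrightarrow> \<rho>' h * P = P * \<rho> h" using rep_isoE[OF assms(2)] by blast
  obtain m Q where Q: "\<sigma> \<in> Hom K (GL m)" "\<sigma>' \<in> Hom K (GL m)" "Q \<in> carrier (GL m)"
    "\<And>h. h \<in> carrier K \<Longrightarrow> \<sigma>' h * Q = Q * \<sigma> h" using rep_isoE[OF assms(3)] by blast
  have mem: "\<tau> h \<in> carrier_mat k k" if "\<tau> \<in> Hom K (GL k)" "h \<in> carrier K" for \<tau> h k
    using that GL_carrier_mat by (auto simp: Hom_def hom_def)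
  have PQ: "P \<in> carrier_mat n n" "Q \<in> carrier_mat m m" using P(3) Q(3) by (auto intro: GL_carrier_mat)
  show ?thesis
  proof (rule rep_isoI)
    show "rep_sum K \<rho> \<sigma> \<in> Hom K (GL (n + m))" "rep_sum K \<rho>' \<sigma>' \<in> Hom K (GL (n + m))"
      using rep_sum_Hom[OF K] P Q by auto
    show "dirsum P Q \<in> carrier (GL (n + m))" using dirsum_GL P Q by blast
    fix h assume h: "h \<in> carrier K"
    have "dirsum (\<rho>' h) (\<sigma>' h) * dirsum P Q = dirsum P Q * dirsum (\<rho> h) (\<sigma> h)"
      unfolding dirsum_mult[OF mem[OF P(2) h] mem[OF Q(2) h] PQ] dirsum_mult[OF PQ mem[OF P(1) h] mem[OF Q(1) h]]
      by (simp only: P(4)[OF h] Q(4)[OF h])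
    then show "rep_sum K \<rho>' \<sigma>' h * dirsum P Q = dirsum P Q * rep_sum K \<rho> \<sigma> h"
      using h by (simp add: rep_sum_dirsum)
  qed
qed

lemma rep_sum_comm:
  assumes K: "group K" and "\<rho> \<in> Hom K (GL n)" "\<sigma> \<in> Hom K (GL m)"
  shows "(rep_sum K \<rho> \<sigma>, rep_sum K \<sigma> \<rho>) \<in> rep_iso K"
proof (rule rep_isoI)
  show "rep_sum K \<rho> \<sigma> \<in> Hom K (GL (n + m))" by (rule rep_sum_Hom[OF assms])
  show "rep_sum K \<sigma> \<rho> \<in> Hom K (GL (n + m))" using rep_sum_Hom[OF K assms(3,2)] by (simp only: add.commute)
  show "swap_mat n m \<in> carrier (GL (n + m))" by (rule swap_mat_GL)
  fix h assume h: "h \<in> carrier K"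
  then have "\<rho> h \<in> carrier_mat n n" "\<sigma> h \<in> carrier_mat m m"
    using assms(2,3) GL_carrier_mat by (auto simp: Hom_def hom_def)
  then show "rep_sum K \<sigma> \<rho> h * swap_mat n m = swap_mat n m * rep_sum K \<rho> \<sigma> h"
    using h swap_mat_dirsum[of "\<rho> h" n "\<sigma> h" m] by (simp add: rep_sum_dirsum)
qed

abbreviation rep_class :: "('g, 'm) monoid_scheme \<Rightarrow> ('g \<Rightarrow> complex Matrix.mat) \<Rightarrow> ('g \<Rightarrow> complex Matrix.mat) set" where
  "rep_class K \<rho> \<equiv> rep_iso K `` {\<rho>}"

lemma carrier_rep_monoid: "carrier (rep_monoid K) = rep_class K ` reps K"
  by (auto simp: rep_monoid_def quotient_def)

lemma one_rep_monoid: "\<one>\<^bsub>rep_monoid K\<^esub> = rep_class K (\<lambda>h\<in>carrier K. 1\<^sub>m 0)"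
  by (simp add: rep_monoid_def)

lemma Hom_reps: "\<rho> \<in> Hom K (GL n) \<Longrightarrow> \<rho> \<in> reps K"
  by (auto simp: reps_def)

lemma rep_sum_reps: "group K \<Longrightarrow> \<rho> \<in> reps K \<Longrightarrow> \<sigma> \<in> reps K \<Longrightarrow> rep_sum K \<rho> \<sigma> \<in> reps K"
  by (elim repsE, rule Hom_reps, rule rep_sum_Hom)

lemma rep_iso_refl: "group K \<Longrightarrow> \<rho> \<in> reps K \<Longrightarrow> (\<rho>, \<rho>) \<in> rep_iso K"
  using equiv_rep_iso by (auto simp: equiv_def refl_on_def)

lemma rep_class_eqI: "group K \<Longrightarrow> (\<rho>, \<sigma>) \<in> rep_iso K \<Longrightarrow> rep_class K \<rho> = rep_class K \<sigma>"
  by (rule equiv_class_eq[OF equiv_rep_iso])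

lemma mult_rep_monoid:
  assumes K: "group K" and \<rho>: "\<rho> \<in> reps K" "\<sigma> \<in> reps K"
  shows "rep_class K \<rho> \<otimes>\<^bsub>rep_monoid K\<^esub> rep_class K \<sigma> = rep_class K (rep_sum K \<rho> \<sigma>)"
proof -
  have "rep_class K (rep_sum K \<rho>' \<sigma>') = rep_class K (rep_sum K \<rho> \<sigma>)"
    if "\<rho>' \<in> rep_class K \<rho>" "\<sigma>' \<in> rep_class K \<sigma>" for \<rho>' \<sigma>'
    using that rep_class_eqI[OF K rep_sum_iso[OF K]] by blast
  moreover have "\<rho> \<in> rep_class K \<rho>" "\<sigma> \<in> rep_class K \<sigma>" using rep_iso_refl[OF K] \<rho> by blast+
  moreover have "rep_class K \<rho> \<otimes>\<^bsub>rep_monoid K\<^esub> rep_class K \<sigma> =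
      (\<Union>\<rho>'\<in>rep_class K \<rho>. \<Union>\<sigma>'\<in>rep_class K \<sigma>. rep_class K (rep_sum K \<rho>' \<sigma>'))"
    unfolding rep_monoid_def by auto
  ultimately show ?thesis by blast
qed

lemma trivial_reps: "(\<lambda>h\<in>carrier K. 1\<^sub>m 0) \<in> reps K" if "group K"
proof -
  interpret group K by fact
  have "1\<^sub>m 0 \<in> carrier (GL 0)" by (rule GL_I[of _ _ "1\<^sub>m 0"]) auto
  then have "(\<lambda>h\<in>carrier K. 1\<^sub>m 0) \<in> Hom K (GL 0)"
    by (auto simp: Hom_def hom_def mult_GL)
  then show ?thesis by (rule Hom_reps)
qed

lemma comm_monoid_rep_monoid:
  assumes K: "group K"
  shows "comm_monoid (rep_monoid K)"
proof (rule comm_monoidI)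
  show "\<one>\<^bsub>rep_monoid K\<^esub> \<in> carrier (rep_monoid K)"
    unfolding one_rep_monoid carrier_rep_monoid using trivial_reps[OF K] by blast
next
  fix x y assume "x \<in> carrier (rep_monoid K)" "y \<in> carrier (rep_monoid K)"
  then obtain \<rho> \<sigma> where *: "x = rep_class K \<rho>" "\<rho> \<in> reps K" "y = rep_class K \<sigma>" "\<sigma> \<in> reps K"
    unfolding carrier_rep_monoid by blast
  show "x \<otimes>\<^bsub>rep_monoid K\<^esub> y \<in> carrier (rep_monoid K)"
    unfolding *(1,3) mult_rep_monoid[OF K *(2,4)] carrier_rep_monoid using rep_sum_reps[OF K *(2,4)] by blast
  show "x \<otimes>\<^bsub>rep_monoid K\<^esub> y = y \<otimes>\<^bsub>rep_monoid K\<^esub> x"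
    unfolding *(1,3) mult_rep_monoid[OF K *(2,4)] mult_rep_monoid[OF K *(4,2)]
    by (rule repsE[OF *(2)], rule repsE[OF *(4)], rule rep_class_eqI[OF K], rule rep_sum_comm[OF K])
next
  fix x y z assume "x \<in> carrier (rep_monoid K)" "y \<in> carrier (rep_monoid K)" "z \<in> carrier (rep_monoid K)"
  then obtain \<rho> \<sigma> \<tau> where *: "x = rep_class K \<rho>" "\<rho> \<in> reps K" "y = rep_class K \<sigma>" "\<sigma> \<in> reps K"
      "z = rep_class K \<tau>" "\<tau> \<in> reps K"
    unfolding carrier_rep_monoid by blast
  have "dirsum (dirsum (\<rho> h) (\<sigma> h)) (\<tau> h) = dirsum (\<rho> h) (dirsum (\<sigma> h) (\<tau> h))" if "h \<in> carrier K" for h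
  proof -
    obtain n m k where "\<rho> h \<in> carrier_mat n n" "\<sigma> h \<in> carrier_mat m m" "\<tau> h \<in> carrier_mat k k"
      using repsE[OF *(2)] repsE[OF *(4)] repsE[OF *(6)] \<open>h \<in> carrier K\<close> by metis
    then show ?thesis by (rule dirsum_assoc)
  qed
  then have "rep_sum K (rep_sum K \<rho> \<sigma>) \<tau> = rep_sum K \<rho> (rep_sum K \<sigma> \<tau>)"
    unfolding rep_sum_dirsum by (intro restrict_ext) simp
  then show "x \<otimes>\<^bsub>rep_monoid K\<^esub> y \<otimes>\<^bsub>rep_monoid K\<^esub> z = x \<otimes>\<^bsub>rep_monoid K\<^esub> (y \<otimes>\<^bsub>rep_monoid K\<^esub> z)"
    using *(2,4,6) by (simp add: *(1,3,5) mult_rep_monoid[OF K] rep_sum_reps[OF K])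
next
  fix x assume "x \<in> carrier (rep_monoid K)"
  then obtain \<rho> where *: "x = rep_class K \<rho>" "\<rho> \<in> reps K" unfolding carrier_rep_monoid by blast
  have "rep_sum K (\<lambda>h\<in>carrier K. 1\<^sub>m 0) \<rho> = \<rho>"
  proof (rule extensionalityI[of _ "carrier K"])
    show "\<rho> \<in> extensional (carrier K)" using *(2) by (auto simp: reps_def Hom_def)
    fix h assume h: "h \<in> carrier K"
    obtain n where "\<rho> h \<in> carrier_mat n n"
      using repsE[OF *(2)] h by metis
    then show "rep_sum K (\<lambda>h\<in>carrier K. 1\<^sub>m 0) \<rho> h = \<rho> h"
      using h by (simp add: rep_sum_dirsum dirsum_empty)
  qed (simp add: rep_sum_dirsum)
  then show "\<one>\<^bsub>rep_monoid K\<^esub> \<otimes>\<^bsub>rep_monoid K\<^esub> x = x"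
    unfolding * one_rep_monoid mult_rep_monoid[OF K trivial_reps[OF K] *(2)] by simp
qed

section \<open>The determinant on classes of representations\<close>

definition rep_det :: "('g \<Rightarrow> complex Matrix.mat) set \<Rightarrow> 'g \<Rightarrow> complex" where
  "rep_det c h = det ((SOME \<rho>. \<rho> \<in> c) h)"

text \<open>Isomorphic representations satisfy an intertwining relation with an invertible matrix,
  whose determinant cancels; so the choice in \<open>rep_det\<close> is harmless.\<close>

lemma rep_det_eq:
  assumes K: "group K" and c: "c \<in> carrier (rep_monoid K)" "\<rho> \<in> c" and h: "h \<in> carrier K"
  shows "rep_det c h = det (\<rho> h)"
proof -
  have "(SOME \<rho>. \<rho> \<in> c) \<in> c" by (rule someI[of "\<lambda>\<rho>. \<rho> \<in> c", OF c(2)])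
  then have "(\<rho>, SOME \<rho>. \<rho> \<in> c) \<in> rep_iso K"
    using c quotient_eq_iff[OF equiv_rep_iso[OF K], of c c] unfolding rep_monoid_def by simp
  then obtain n P where P: "\<rho> \<in> Hom K (GL n)" "(SOME \<rho>. \<rho> \<in> c) \<in> Hom K (GL n)" "P \<in> carrier (GL n)"
    "(SOME \<rho>. \<rho> \<in> c) h * P = P * \<rho> h" using h by (blast elim: rep_isoE)
  then have "\<rho> h \<in> carrier_mat n n" "(SOME \<rho>. \<rho> \<in> c) h \<in> carrier_mat n n" "P \<in> carrier_mat n n"
    using h GL_carrier_mat by (auto simp: Hom_def hom_def)
  then have "det ((SOME \<rho>. \<rho> \<in> c) h) * det P = det P * det (\<rho> h)"
    using arg_cong[OF P(4), of det] by (simp add: det_mult)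
  then show ?thesis using det_GL[OF P(3)] by (simp add: rep_det_def)
qed

lemma rep_det_mult:
  assumes K: "group K" and c: "c \<in> carrier (rep_monoid K)" "d \<in> carrier (rep_monoid K)" and h: "h \<in> carrier K"
  shows "rep_det (c \<otimes>\<^bsub>rep_monoid K\<^esub> d) h = rep_det c h * rep_det d h"
proof -
  interpret comm_monoid "rep_monoid K" by (rule comm_monoid_rep_monoid[OF K])
  obtain \<rho> \<sigma> where *: "c = rep_class K \<rho>" "\<rho> \<in> reps K" "d = rep_class K \<sigma>" "\<sigma> \<in> reps K"
    using c unfolding carrier_rep_monoid by blast
  have mem: "\<rho> \<in> c" "\<sigma> \<in> d" "rep_sum K \<rho> \<sigma> \<in> c \<otimes>\<^bsub>rep_monoid K\<^esub> d"
    using rep_iso_refl[OF K] * rep_sum_reps[OF K *(2,4)] mult_rep_monoid[OF K *(2,4)] by auto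
  obtain n m where "\<rho> h \<in> carrier_mat n n" "\<sigma> h \<in> carrier_mat m m"
    using repsE[OF *(2)] repsE[OF *(4)] h by metis
  then have "det (rep_sum K \<rho> \<sigma> h) = det (\<rho> h) * det (\<sigma> h)"
    using h by (simp add: rep_sum_dirsum det_dirsum)
  then show ?thesis
    using rep_det_eq[OF K c(1) mem(1) h] rep_det_eq[OF K c(2) mem(2) h] rep_det_eq[OF K m_closed[OF c] mem(3) h] by simp
qed

lemma rep_det_nonzero:
  assumes K: "group K" and c: "c \<in> carrier (rep_monoid K)" and h: "h \<in> carrier K"
  shows "rep_det c h \<noteq> 0"
proof -
  obtain \<rho> where *: "c = rep_class K \<rho>" "\<rho> \<in> reps K" using c unfolding carrier_rep_monoid by blast
  then have "\<rho> \<in> c" using rep_iso_refl[OF K] by blast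
  moreover have "det (\<rho> h) \<noteq> 0" using *(2) h det_GL by (auto simp: reps_def Hom_def hom_def)
  ultimately show ?thesis using rep_det_eq[OF K c _ h] by simp
qed

text \<open>Equality in the Grothendieck group holds only after adding some \<open>k\<close>. Its
  determinant is nonzero and cancels, which lets the determinant pass to formal differences.\<close>

lemma rep_det_groth_rel:
  assumes K: "group K" and h: "h \<in> carrier K" and "((c, d), (a, \<one>\<^bsub>rep_monoid K\<^esub>)) \<in> groth_rel (rep_monoid K)"
  shows "rep_det c h = rep_det a h * rep_det d h"
proof -
  interpret comm_monoid "rep_monoid K" by (rule comm_monoid_rep_monoid[OF K])
  obtain k where *: "c \<in> carrier (rep_monoid K)" "d \<in> carrier (rep_monoid K)" "a \<in> carrier (rep_monoid K)"
      "k \<in> carrier (rep_monoid K)"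
      "c \<otimes>\<^bsub>rep_monoid K\<^esub> \<one>\<^bsub>rep_monoid K\<^esub> \<otimes>\<^bsub>rep_monoid K\<^esub> k = a \<otimes>\<^bsub>rep_monoid K\<^esub> d \<otimes>\<^bsub>rep_monoid K\<^esub> k"
    using assms(3) unfolding groth_rel_iff by blast
  have "rep_det (c \<otimes>\<^bsub>rep_monoid K\<^esub> k) h = rep_det (a \<otimes>\<^bsub>rep_monoid K\<^esub> d \<otimes>\<^bsub>rep_monoid K\<^esub> k) h"
    using *(5) r_one[OF *(1)] by simp
  then show ?thesis
    using rep_det_nonzero[OF K *(4) h] *(1-4) h by (simp add: rep_det_mult[OF K])
qed

section \<open>Unitary representations and pullback along orbit maps\<close>

lemma mat_adjoint_carrier_mat: "A \<in> carrier_mat n n \<Longrightarrow> mat_adjoint (A :: complex Matrix.mat) \<in> carrier_mat n n"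
  by (auto simp: mat_adjoint_def)

lemma mat_adjoint_index:
  "A \<in> carrier_mat n n \<Longrightarrow> i < n \<Longrightarrow> j < n \<Longrightarrow> mat_adjoint A $$ (i, j) = cnj (A $$ (j, i))"
  by (auto simp: mat_adjoint_def mat_of_rows_index cols_nth)

lemma mat_adjoint_one: "mat_adjoint (1\<^sub>m n :: complex Matrix.mat) = 1\<^sub>m n"
  by (rule eq_matI) (auto simp: mat_adjoint_index[of _ n] carrier_matD[OF mat_adjoint_carrier_mat[of _ n]])

lemma mat_adjoint_adjoint: "A \<in> carrier_mat n n \<Longrightarrow> mat_adjoint (mat_adjoint A) = (A :: complex Matrix.mat)"
  by (rule eq_matI)
    (auto simp: mat_adjoint_index[of _ n] mat_adjoint_carrier_mat carrier_matD[OF mat_adjoint_carrier_mat[of _ n]])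

lemma mat_adjoint_mult:
  assumes "A \<in> carrier_mat n n" "B \<in> carrier_mat n n"
  shows "mat_adjoint (A * B) = mat_adjoint B * mat_adjoint (A :: complex Matrix.mat)"
proof (rule eq_matI)
  have c: "mat_adjoint A \<in> carrier_mat n n" "mat_adjoint B \<in> carrier_mat n n" "A * B \<in> carrier_mat n n"
    using assms mat_adjoint_carrier_mat by auto
  show "dim_row (mat_adjoint (A * B)) = dim_row (mat_adjoint B * mat_adjoint A)"
    "dim_col (mat_adjoint (A * B)) = dim_col (mat_adjoint B * mat_adjoint A)"
    using c mat_adjoint_carrier_mat[OF c(3)] by auto
  fix i j assume "i < dim_row (mat_adjoint B * mat_adjoint A)" "j < dim_col (mat_adjoint B * mat_adjoint A)"
  then have ij: "i < n" "j < n" using c by auto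
  have "mat_adjoint (A * B) $$ (i, j) = cnj (\<Sum>k = 0..<n. A $$ (j, k) * B $$ (k, i))"
    using assms ij by (simp add: mat_adjoint_index[OF c(3)] scalar_prod_def)
  also have "\<dots> = (\<Sum>k = 0..<n. mat_adjoint B $$ (i, k) * mat_adjoint A $$ (k, j))"
    using ij by (simp add: mat_adjoint_index[OF assms(1)] mat_adjoint_index[OF assms(2)] mult.commute)
  also have "\<dots> = (mat_adjoint B * mat_adjoint A) $$ (i, j)"
    using c ij by (simp add: scalar_prod_def)
  finally show "mat_adjoint (A * B) $$ (i, j) = (mat_adjoint B * mat_adjoint A) $$ (i, j)" .
qed

lemma subgroup_unitary: "subgroup {A \<in> carrier_mat n n. A * mat_adjoint A = 1\<^sub>m n} (GL n)" (is "subgroup ?U _")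
proof (rule group.subgroupI[OF group_GL])
  show "?U \<subseteq> carrier (GL n)" using GL_I mat_adjoint_carrier_mat by blast
  show "?U \<noteq> {}" using mat_adjoint_one by (auto intro!: exI[of _ "1\<^sub>m n"])
next
  fix A assume A: "A \<in> ?U"
  then have A': "mat_adjoint A \<in> carrier_mat n n" "mat_adjoint A * A = 1\<^sub>m n"
    using mat_adjoint_carrier_mat mat_mult_left_right_inverse by blast+
  have "inv\<^bsub>GL n\<^esub> A = mat_adjoint A"
  proof (rule group.inv_equality[OF group_GL])
    show "mat_adjoint A \<otimes>\<^bsub>GL n\<^esub> A = \<one>\<^bsub>GL n\<^esub>" using A' by (simp only: mult_GL one_GL)
    show "A \<in> carrier (GL n)" "mat_adjoint A \<in> carrier (GL n)" using A A' GL_I by blast+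
  qed
  then show "inv\<^bsub>GL n\<^esub> A \<in> ?U" using A A' mat_adjoint_adjoint[of A n] by simp
next
  fix A B assume AB: "A \<in> ?U" "B \<in> ?U"
  then have c: "A \<in> carrier_mat n n" "B \<in> carrier_mat n n" "mat_adjoint A \<in> carrier_mat n n" "mat_adjoint B \<in> carrier_mat n n"
    using mat_adjoint_carrier_mat by blast+
  have "(A * B) * (mat_adjoint B * mat_adjoint A) = A * (B * mat_adjoint B) * mat_adjoint A"
    using c by (simp add: assoc_mult_mat[of _ n n _ n _ n])
  also have "\<dots> = 1\<^sub>m n" using AB c by simp
  finally show "A \<otimes>\<^bsub>GL n\<^esub> B \<in> ?U" using c by (simp add: mult_GL mat_adjoint_mult[OF c(1,2)])
qed

lemma group_unitary_group: "group (unitary_group n)"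
  unfolding unitary_group_def by (rule subgroup.subgroup_is_group[OF subgroup_unitary group_GL])

lemma Hom_unitary_reps: "\<rho> \<in> Hom K (unitary_group n) \<Longrightarrow> \<rho> \<in> reps K"
  using subgroup.subset[OF subgroup_unitary[of n]]
  unfolding reps_def by (auto simp: Hom_def hom_def unitary_group_def Pi_iff intro!: exI[of _ n])

lemma conj_rel_unitary_rep_iso: "(\<rho>, \<sigma>) \<in> conj_rel K (unitary_group n) \<Longrightarrow> (\<rho>, \<sigma>) \<in> rep_iso K"
  using conj_rel_subgroup[OF group_GL subgroup_unitary] unfolding unitary_group_def rep_iso_def by blast

lemma Rep_U_incl_class:
  assumes K: "group K" and \<rho>: "\<rho> \<in> Hom K (unitary_group n)"
  shows "Rep_U_incl K (conj_rel K (unitary_group n) `` {\<rho>}) = groth_incl (rep_monoid K) (rep_class K \<rho>)"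
proof -
  have "(\<rho>, \<rho>) \<in> conj_rel K (unitary_group n)"
    using equiv_conj_rel[OF group_unitary_group] \<rho> by (auto simp: equiv_def refl_on_def)
  then have "rep_iso K `` (conj_rel K (unitary_group n) `` {\<rho>}) = rep_class K \<rho>"
    using image_equiv_class[OF equiv_rep_iso[OF K], of "conj_rel K (unitary_group n)" "\<lambda>x. x" \<rho>]
      conj_rel_unitary_rep_iso[of _ _ K n] by simp
  then show ?thesis by (simp add: Rep_U_incl_def)
qed

lemma group_sub: "group G \<Longrightarrow> H \<in> finite_subgroups G \<Longrightarrow> group (sub G H)"
  unfolding sub_def finite_subgroups_def by (auto intro: subgroup.subgroup_is_group)

text \<open>An element \<open>h\<close> of \<open>H\<close> fixes the coset \<open>H\<close>, hence
  by equivariance its image \<open>g <# K\<close>; so \<open>h \<otimes> g\<close> lies in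
  \<open>g <# K\<close>.\<close>

lemma orbit_map_conj:
  fixes G (structure)
  assumes G: "group G" and H: "subgroup H G" "subgroup K G" and f: "f \<in> orbit_maps G H K" and g: "g \<in> carrier G"
    and fH: "f H = g <# K" and h: "h \<in> H"
  shows "inv g \<otimes> h \<otimes> g \<in> K"
proof -
  interpret group G by fact
  have hc: "h \<in> carrier G" using H h subgroup.subset by blast
  have "\<one> <# H = H" using subgroup.subset[OF H(1)] by (auto simp: l_coset_def subset_iff)
  then have Hl: "H \<in> lcosets H" unfolding LCOSETS_def by auto
  have hH: "h <# H = H"
  proof -
    have "\<one> <# H = h <# H"
      by (rule l_repr_independence) (use h H hc \<open>\<one> <# H = H\<close> in auto)
    then show ?thesis using \<open>\<one> <# H = H\<close> by simp
  qed
  have "f (h <# H) = h <# f H"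
    using f Hl hc unfolding orbit_maps_def by blast
  then have eq: "h <# (g <# K) = g <# K" by (simp only: hH fH)
  have "h \<otimes> g \<in> h <# (g <# K)"
    using subgroup.one_closed[OF H(2)] g hc by (force simp: l_coset_def)
  then have "h \<otimes> g \<in> g <# K" by (simp only: eq)
  then obtain k where k: "k \<in> K" "h \<otimes> g = g \<otimes> k" by (auto simp: l_coset_def)
  have kc: "k \<in> carrier G" using k H(2) subgroup.subset by blast
  have "inv g \<otimes> h \<otimes> g = inv g \<otimes> (g \<otimes> k)" using k(2) g hc by (simp add: m_assoc)
  also have "\<dots> = k" using g kc by (simp add: m_assoc[symmetric])
  finally show ?thesis using k by simp
qed

lemma pullback_rep_class:
  fixes G (structure)
  assumes G: "group G" and HK: "H \<in> finite_subgroups G" "K \<in> finite_subgroups G" "g \<in> carrier G"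
    and ad: "\<And>h. h \<in> H \<Longrightarrow> inv g \<otimes> h \<otimes> g \<in> K" and \<rho>: "\<rho> \<in> reps (sub G K)"
  shows "rep_iso (sub G H) `` (pullback_hom G H g ` rep_class (sub G K) \<rho>) = rep_class (sub G H) (pullback_hom G H g \<rho>)"
proof (rule image_equiv_class[OF equiv_rep_iso[OF group_sub[OF G HK(1)]]])
  show "(\<rho>, \<rho>) \<in> rep_iso (sub G K)" by (rule rep_iso_refl[OF group_sub[OF G HK(2)] \<rho>])
  fix x y assume "(x, y) \<in> rep_iso (sub G K)"
  then show "(pullback_hom G H g x, pullback_hom G H g y) \<in> rep_iso (sub G H)"
    using pullback_hom_conj_rel[OF G _ _ HK(3) ad] HK(1,2) unfolding rep_iso_def finite_subgroups_def by blast
qed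

lemma pullback_rep_monoid_hom:
  fixes G (structure)
  assumes G: "group G" and HK: "H \<in> finite_subgroups G" "K \<in> finite_subgroups G" "g \<in> carrier G"
    and ad: "\<And>h. h \<in> H \<Longrightarrow> inv g \<otimes> h \<otimes> g \<in> K"
  defines "\<phi> \<equiv> \<lambda>C. rep_iso (sub G H) `` (pullback_hom G H g ` C)"
  shows "\<phi> \<in> hom (rep_monoid (sub G K)) (rep_monoid (sub G H))"
    and "\<phi> \<one>\<^bsub>rep_monoid (sub G K)\<^esub> = \<one>\<^bsub>rep_monoid (sub G H)\<^esub>"
proof -
  note cl = pullback_rep_class[OF G HK ad, folded \<phi>_def]
  note gK = group_sub[OF G HK(2)] and gH = group_sub[OF G HK(1)]
  have reps: "pullback_hom G H g \<rho> \<in> reps (sub G H)" if "\<rho> \<in> reps (sub G K)" for \<rho>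
    using that pullback_hom_Hom[OF G _ _ HK(3) ad] HK(1,2) unfolding reps_def finite_subgroups_def by blast
  have cl': "\<phi> (rep_class (sub G K) \<rho>) = rep_class (sub G H) (pullback_hom G H g \<rho>)" if "\<rho> \<in> reps (sub G K)" for \<rho>
    unfolding \<phi>_def by (rule pullback_rep_class[OF G HK ad that])
  show "\<phi> \<in> hom (rep_monoid (sub G K)) (rep_monoid (sub G H))"
  proof (rule homI)
    fix x assume "x \<in> carrier (rep_monoid (sub G K))"
    then show "\<phi> x \<in> carrier (rep_monoid (sub G H))"
      unfolding carrier_rep_monoid using cl' reps by blast
  next
    fix x y assume "x \<in> carrier (rep_monoid (sub G K))" "y \<in> carrier (rep_monoid (sub G K))"
    then obtain \<rho> \<sigma> where *: "x = rep_class (sub G K) \<rho>" "\<rho> \<in> reps (sub G K)" "y = rep_class (sub G K) \<sigma>" "\<sigma> \<in> reps (sub G K)"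
      unfolding carrier_rep_monoid by blast
    have "pullback_hom G H g (rep_sum (sub G K) \<rho> \<sigma>) = rep_sum (sub G H) (pullback_hom G H g \<rho>) (pullback_hom G H g \<sigma>)"
      using ad by (auto simp: pullback_hom_def rep_sum_dirsum sub_def fun_eq_iff)
    then show "\<phi> (x \<otimes>\<^bsub>rep_monoid (sub G K)\<^esub> y) = \<phi> x \<otimes>\<^bsub>rep_monoid (sub G H)\<^esub> \<phi> y"
      unfolding *(1,3) mult_rep_monoid[OF gK *(2,4)] cl'[OF *(2)] cl'[OF *(4)] cl'[OF rep_sum_reps[OF gK *(2,4)]]
        mult_rep_monoid[OF gH reps[OF *(2)] reps[OF *(4)]] by simp
  qed
  have "pullback_hom G H g (\<lambda>h\<in>carrier (sub G K). 1\<^sub>m 0 :: complex Matrix.mat) = (\<lambda>h\<in>carrier (sub G H). 1\<^sub>m 0)"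
    using ad by (auto simp: pullback_hom_def sub_def fun_eq_iff)
  then show "\<phi> \<one>\<^bsub>rep_monoid (sub G K)\<^esub> = \<one>\<^bsub>rep_monoid (sub G H)\<^esub>"
    unfolding one_rep_monoid cl'[OF trivial_reps[OF gK]] by (simp only:)
qed

text \<open>The passage from unitary classes to the representation ring is natural for pullbacks.
  This places the unrealizable family in the target of \<open>epsilon\<close>, as the failure of
  surjectivity requires.\<close>

theorem lim_Rep_U_incl_in_lim_rep_ring:
  fixes G (structure)
  assumes G: "group G" and \<alpha>: "\<alpha> \<in> lim_Rep_U n G"
  shows "lim_Rep_U_incl G \<alpha> \<in> lim_rep_ring G"
proof -
  let ?cU = "\<lambda>H. conj_rel (sub G H) (unitary_group n)"
  have \<alpha>H: "\<exists>\<rho>. \<rho> \<in> Hom (sub G H) (unitary_group n) \<and> \<alpha> H = ?cU H `` {\<rho>}" if "H \<in> finite_subgroups G" for H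
  proof -
    have "\<alpha> H \<in> Rep_U n (sub G H)"
      using \<alpha> that unfolding lim_Rep_U_def orbit_lim_def by (auto dest: PiE_mem)
    then show ?thesis unfolding Rep_U_def by (rule quotientE) blast
  qed
  have incl: "lim_Rep_U_incl G \<alpha> H = groth_incl (rep_monoid (sub G H)) (rep_class (sub G H) \<rho>)"
    if "H \<in> finite_subgroups G" "\<rho> \<in> Hom (sub G H) (unitary_group n)" "\<alpha> H = ?cU H `` {\<rho>}" for H \<rho>
    using that Rep_U_incl_class[OF group_sub[OF G that(1)] that(2)] by (simp add: lim_Rep_U_incl_def)
  have "lim_Rep_U_incl G \<alpha> H \<in> carrier (rep_ring (sub G H))" if H: "H \<in> finite_subgroups G" for H
  proof -
    obtain \<rho> where \<rho>: "\<rho> \<in> Hom (sub G H) (unitary_group n)" "\<alpha> H = ?cU H `` {\<rho>}" using \<alpha>H[OF H] by blast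
    have "rep_class (sub G H) \<rho> \<in> carrier (rep_monoid (sub G H))"
      unfolding carrier_rep_monoid using Hom_unitary_reps[OF \<rho>(1)] by blast
    then show ?thesis
      unfolding incl[OF H \<rho>] rep_ring_def by (rule groth_incl_in_carrier[OF comm_monoid_rep_monoid[OF group_sub[OF G H]]])
  qed
  moreover have "pullback_rep_ring G H g (lim_Rep_U_incl G \<alpha> K) = lim_Rep_U_incl G \<alpha> H"
    if HK: "H \<in> finite_subgroups G" "K \<in> finite_subgroups G" and f: "f \<in> orbit_maps G H K" and g: "g \<in> carrier G"
      and fH: "f H = g <# K" for H K f g
  proof -
    have sub: "subgroup H G" "subgroup K G" using HK by (auto simp: finite_subgroups_def)
    note ad = orbit_map_conj[OF G sub f g fH]
    obtain \<rho> where \<rho>: "\<rho> \<in> Hom (sub G K) (unitary_group n)" "\<alpha> K = ?cU K `` {\<rho>}" using \<alpha>H[OF HK(2)] by blast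
    have "?cU H `` (pullback_hom G H g ` (?cU K `` {\<rho>})) = ?cU H `` {pullback_hom G H g \<rho>}"
      using equiv_conj_rel[OF group_unitary_group] \<rho>(1)
      by (intro image_equiv_class[OF equiv_conj_rel[OF group_unitary_group]] pullback_hom_conj_rel[OF G sub g ad])
        (auto simp: equiv_def refl_on_def)
    moreover have "pullback_Rep_U n G H g (\<alpha> K) = \<alpha> H"
      using \<alpha> HK f g fH unfolding lim_Rep_U_def orbit_lim_def by blast
    ultimately have "\<alpha> H = ?cU H `` {pullback_hom G H g \<rho>}"
      unfolding pullback_Rep_U_def \<rho>(2) by simp
    then have H: "lim_Rep_U_incl G \<alpha> H = groth_incl (rep_monoid (sub G H)) (rep_class (sub G H) (pullback_hom G H g \<rho>))"
      using incl[OF HK(1) pullback_hom_Hom[OF G sub g ad \<rho>(1)]] by blast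
    have "rep_class (sub G K) \<rho> \<in> carrier (rep_monoid (sub G K))"
      unfolding carrier_rep_monoid using Hom_unitary_reps[OF \<rho>(1)] by blast
    then show ?thesis
      unfolding H incl[OF HK(2) \<rho>] pullback_rep_ring_def
      using groth_map_groth_incl[OF comm_monoid_rep_monoid[OF group_sub[OF G HK(2)]]
          comm_monoid_rep_monoid[OF group_sub[OF G HK(1)]] pullback_rep_monoid_hom[OF G HK g ad]]
        pullback_rep_class[OF G HK g ad Hom_unitary_reps[OF \<rho>(1)]] by simp
  qed
  moreover have "lim_Rep_U_incl G \<alpha> \<in> extensional (finite_subgroups G)"
    by (simp add: lim_Rep_U_incl_def)
  ultimately show ?thesis
    unfolding lim_rep_ring_def orbit_lim_def PiE_def by blast
qed

subsection \<open>Frames and their transition matrices\<close>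

text \<open>The transition matrix between two frames. It is allowed to be rectangular, since
  uniqueness of the rank is itself derived from it.\<close>

definition fmat :: "nat \<Rightarrow> nat \<Rightarrow> (complex Matrix.vec \<Rightarrow> 'e) \<Rightarrow> (complex Matrix.vec \<Rightarrow> 'e) \<Rightarrow> complex Matrix.mat" where
  "fmat n m \<phi> \<phi>' = mat n m (\<lambda>(i, j). inv_into (carrier_vec n) \<phi> (\<phi>' (unit_vec m j)) $ i)"

lemma fmat_carrier_mat: "fmat n m \<phi> \<phi>' \<in> carrier_mat n m"
  by (simp add: fmat_def)

lemma linear_eq_mult_mat_vec:
  fixes L :: "complex Matrix.vec \<Rightarrow> complex Matrix.vec"
  assumes c: "\<And>v. v \<in> carrier_vec m \<Longrightarrow> L v \<in> carrier_vec n"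
    and add: "\<And>u v. u \<in> carrier_vec m \<Longrightarrow> v \<in> carrier_vec m \<Longrightarrow> L (u + v) = L u + L v"
    and smult: "\<And>a v. v \<in> carrier_vec m \<Longrightarrow> L (a \<cdot>\<^sub>v v) = a \<cdot>\<^sub>v L v"
    and v: "v \<in> carrier_vec m"
  shows "L v = mat n m (\<lambda>(i, j). L (unit_vec m j) $ i) *\<^sub>v v"
proof -
  have zero: "L (0\<^sub>v m) = 0\<^sub>v n"
  proof -
    have "0\<^sub>v m = 0 \<cdot>\<^sub>v (0\<^sub>v m :: complex Matrix.vec)" by (intro eq_vecI) auto
    then have "L (0\<^sub>v m) = 0 \<cdot>\<^sub>v L (0\<^sub>v m)" using smult[of "0\<^sub>v m" 0] by simp
    also have "\<dots> = 0\<^sub>v n" using c[of "0\<^sub>v m"] by (intro eq_vecI) auto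
    finally show ?thesis .
  qed
  \<comment> \<open>Induction on the number \<open>k\<close> of leading coordinates that may be
    nonzero; the last of them is split off as a multiple of a unit vector.\<close>
  have part: "L v $ i = (\<Sum>j<k. v $ j * L (unit_vec m j) $ i)"
    if "k \<le> m" "v \<in> carrier_vec m" "\<And>j. k \<le> j \<Longrightarrow> j < m \<Longrightarrow> v $ j = 0" "i < n" for k v i
    using that(1-3)
  proof (induction k arbitrary: v)
    case 0
    then have "v = 0\<^sub>v m" by (intro eq_vecI) auto
    then show ?case using zero \<open>i < n\<close> by simp
  next
    case (Suc k)
    define w where "w = v + (- (v $ k)) \<cdot>\<^sub>v unit_vec m k"
    have w: "w \<in> carrier_vec m" using Suc.prems by (simp add: w_def)
    have wi: "w $ j = (if j = k then 0 else v $ j)" if "j < m" for j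
      using that Suc.prems by (auto simp: w_def)
    have w0: "w $ j = 0" if "k \<le> j" "j < m" for j
      using wi[OF that(2)] Suc.prems(3)[of j] that by (cases "j = k") auto
    have "v = w + (v $ k) \<cdot>\<^sub>v unit_vec m k"
      using Suc.prems by (intro eq_vecI) (auto simp: w_def)
    then have "L v = L w + (v $ k) \<cdot>\<^sub>v L (unit_vec m k)"
      using add[OF w, of "(v $ k) \<cdot>\<^sub>v unit_vec m k"] smult[of "unit_vec m k" "v $ k"] by simp
    then have "L v $ i = L w $ i + v $ k * L (unit_vec m k) $ i"
      using c[of "unit_vec m k"] c[OF w] \<open>i < n\<close> by simp
    also have "L w $ i = (\<Sum>j<k. w $ j * L (unit_vec m j) $ i)"
      using Suc.prems(1) w w0 by (intro Suc.IH) auto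
    also have "\<dots> = (\<Sum>j<k. v $ j * L (unit_vec m j) $ i)"
      using Suc.prems wi by (intro sum.cong) auto
    finally show ?case by simp
  qed
  show ?thesis
  proof (rule eq_vecI)
    fix i assume "i < dim_vec (mat n m (\<lambda>(i, j). L (unit_vec m j) $ i) *\<^sub>v v)"
    then have i: "i < n" by simp
    show "L v $ i = (mat n m (\<lambda>(i, j). L (unit_vec m j) $ i) *\<^sub>v v) $ i"
      using part[of m v i] i v by (simp add: scalar_prod_def lessThan_atLeast0 mult.commute)
  qed (use c[OF v] in simp)
qed

lemma frame_inv:
  assumes "frame E x n \<phi>" "e \<in> fibre E x"
  shows "inv_into (carrier_vec n) \<phi> e \<in> carrier_vec n" "\<phi> (inv_into (carrier_vec n) \<phi> e) = e"
  using assms by (auto simp: frame_def bij_betw_def inv_into_into f_inv_into_f)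

lemma frame_inj: "frame E x n \<phi> \<Longrightarrow> u \<in> carrier_vec n \<Longrightarrow> v \<in> carrier_vec n \<Longrightarrow> \<phi> u = \<phi> v \<longleftrightarrow> u = v"
  by (auto simp: frame_def bij_betw_def inj_on_eq_iff)

lemma frame_fibre: "frame E x n \<phi> \<Longrightarrow> v \<in> carrier_vec n \<Longrightarrow> \<phi> v \<in> fibre E x"
  by (auto simp: frame_def bij_betw_def)

lemma frame_change:
  assumes \<phi>: "frame E x n \<phi>" and \<phi>': "frame E x m \<phi>'" and v: "v \<in> carrier_vec m"
  shows "\<phi>' v = \<phi> (fmat n m \<phi> \<phi>' *\<^sub>v v)"
proof -
  define L where "L v = inv_into (carrier_vec n) \<phi> (\<phi>' v)" for v
  have L: "L v \<in> carrier_vec n" "\<phi> (L v) = \<phi>' v" if "v \<in> carrier_vec m" for v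
    using frame_inv[OF \<phi> frame_fibre[OF \<phi>' that]] by (auto simp: L_def)
  have "L v = mat n m (\<lambda>(i, j). L (unit_vec m j) $ i) *\<^sub>v v"
  proof (rule linear_eq_mult_mat_vec[OF L(1) _ _ v])
    fix u v :: "complex Matrix.vec" assume uv: "u \<in> carrier_vec m" "v \<in> carrier_vec m"
    have "\<phi> (L (u + v)) = \<phi> (L u + L v)"
      using uv L[OF uv(1)] L[OF uv(2)] L[of "u + v"] \<phi> \<phi>' by (simp add: frame_def)
    then show "L (u + v) = L u + L v"
      using frame_inj[OF \<phi>] uv L(1) by (meson add_carrier_vec)
  next
    fix a and v :: "complex Matrix.vec" assume v: "v \<in> carrier_vec m"
    have "\<phi> (L (a \<cdot>\<^sub>v v)) = \<phi> (a \<cdot>\<^sub>v L v)"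
      using v L[OF v] L[of "a \<cdot>\<^sub>v v"] \<phi> \<phi>' by (simp add: frame_def)
    then show "L (a \<cdot>\<^sub>v v) = a \<cdot>\<^sub>v L v"
      using frame_inj[OF \<phi>] v L(1) by (meson smult_carrier_vec)
  qed
  then have "L v = fmat n m \<phi> \<phi>' *\<^sub>v v" by (simp add: fmat_def L_def)
  then show ?thesis using L(2)[OF v] by simp
qed

lemma fmat_unique:
  assumes \<phi>: "frame E x n \<phi>" and A: "A \<in> carrier_mat n m" and eq: "\<And>v. v \<in> carrier_vec m \<Longrightarrow> \<phi>' v = \<phi> (A *\<^sub>v v)"
  shows "fmat n m \<phi> \<phi>' = A"
proof (rule eq_matI)
  fix i j assume "i < dim_row A" "j < dim_col A"
  then have ij: "i < n" "j < m" using A by auto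
  have "inv_into (carrier_vec n) \<phi> (\<phi>' (unit_vec m j)) = A *\<^sub>v unit_vec m j"
    using \<phi> A eq[of "unit_vec m j"] by (simp add: frame_def bij_betw_def inv_into_f_f)
  then show "fmat n m \<phi> \<phi>' $$ (i, j) = A $$ (i, j)"
    using ij A by (simp add: fmat_def)
qed (use A in \<open>auto simp: fmat_def\<close>)

lemma fmat_self: "frame E x n \<phi> \<Longrightarrow> fmat n n \<phi> \<phi> = 1\<^sub>m n"
  by (rule fmat_unique) auto

lemma fmat_mult:
  assumes \<phi>: "frame E x n \<phi>" and \<phi>': "frame E x m \<phi>'" and \<phi>'': "frame E x k \<phi>''"
  shows "fmat n k \<phi> \<phi>'' = fmat n m \<phi> \<phi>' * fmat m k \<phi>' \<phi>''"
proof (rule fmat_unique[OF \<phi>])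
  show "fmat n m \<phi> \<phi>' * fmat m k \<phi>' \<phi>'' \<in> carrier_mat n k"
    using fmat_carrier_mat by (rule mult_carrier_mat) (rule fmat_carrier_mat)
  fix v :: "complex Matrix.vec" assume v: "v \<in> carrier_vec k"
  have "\<phi>'' v = \<phi> (fmat n m \<phi> \<phi>' *\<^sub>v (fmat m k \<phi>' \<phi>'' *\<^sub>v v))"
    using frame_change[OF \<phi>' \<phi>'' v] frame_change[OF \<phi> \<phi>' mult_mat_vec_carrier[OF fmat_carrier_mat v]] by simp
  also have "\<dots> = \<phi> (fmat n m \<phi> \<phi>' * fmat m k \<phi>' \<phi>'' *\<^sub>v v)"
    using assoc_mult_mat_vec[OF fmat_carrier_mat[of n m \<phi> \<phi>'] fmat_carrier_mat[of m k \<phi>' \<phi>''] v] by simp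
  finally show "\<phi>'' v = \<phi> (fmat n m \<phi> \<phi>' * fmat m k \<phi>' \<phi>'' *\<^sub>v v)" .
qed

text \<open>Both products have the same trace, and the complex numbers have characteristic
  zero.\<close>

lemma mutually_inverse_imp_dim_eq:
  fixes A B :: "complex Matrix.mat"
  assumes "A \<in> carrier_mat n m" "B \<in> carrier_mat m n" "A * B = 1\<^sub>m n" "B * A = 1\<^sub>m m"
  shows "n = m"
proof -
  have "complex_of_nat n = (\<Sum>i<n. (A * B) $$ (i, i))" using assms(3) by simp
  also have "\<dots> = (\<Sum>i<n. \<Sum>k<m. A $$ (i, k) * B $$ (k, i))"
    using assms(1,2) by (intro sum.cong) (auto simp: scalar_prod_def lessThan_atLeast0)
  also have "\<dots> = (\<Sum>k<m. \<Sum>i<n. A $$ (i, k) * B $$ (k, i))" by (rule sum.swap)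
  also have "\<dots> = (\<Sum>k<m. (B * A) $$ (k, k))"
    using assms(1,2) by (intro sum.cong) (auto simp: scalar_prod_def lessThan_atLeast0 mult.commute)
  also have "\<dots> = complex_of_nat m" using assms(4) by simp
  finally show ?thesis by simp
qed

lemma frame_rank_unique:
  assumes "frame E x n \<phi>" "frame E x m \<phi>'"
  shows "n = m"
  using mutually_inverse_imp_dim_eq[OF fmat_carrier_mat fmat_carrier_mat, of n m \<phi> \<phi>' \<phi>' \<phi>]
    fmat_mult[OF assms(1,2,1)] fmat_mult[OF assms(2,1,2)] fmat_self[OF assms(1)] fmat_self[OF assms(2)] by simp

subsection \<open>The determinant line of an equivariant bundle\<close>

text \<open>Chosen in each fibre separately, without continuity. It provides the fixed, possibly
  discontinuous section against which the charts of a \<open>line_bundle_atlas\<close> are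
  measured.\<close>

definition ref_frame :: "('g, 'x, 'e) vbundle \<Rightarrow> 'x \<Rightarrow> nat \<times> (complex Matrix.vec \<Rightarrow> 'e)" where
  "ref_frame E x = (SOME p. frame E x (fst p) (snd p))"

text \<open>The coordinate of the top exterior power of the frame \<phi> in the basis given by the
  reference frame.\<close>

definition frame_det :: "('g, 'x, 'e) vbundle \<Rightarrow> 'x \<Rightarrow> (complex Matrix.vec \<Rightarrow> 'e) \<Rightarrow> complex" where
  "frame_det E x \<phi> = (let (n, \<phi>\<^sub>0) = ref_frame E x in det (fmat n n \<phi>\<^sub>0 \<phi>))"

lemma ref_frame:
  assumes "frame E x n \<phi>"
  shows "frame E x n (snd (ref_frame E x))" "fst (ref_frame E x) = n"
proof -
  have "frame E x (fst (ref_frame E x)) (snd (ref_frame E x))"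
    unfolding ref_frame_def by (rule someI[of _ "(n, \<phi>)"]) (use assms in simp)
  with frame_rank_unique[OF this assms] show "frame E x n (snd (ref_frame E x))" "fst (ref_frame E x) = n"
    by auto
qed

lemma frame_det_change:
  assumes "frame E x n \<phi>" "frame E x n \<phi>'"
  shows "frame_det E x \<phi>' = frame_det E x \<phi> * det (fmat n n \<phi> \<phi>')"
  using fmat_mult[OF ref_frame(1)[OF assms(1)] assms] ref_frame(2)[OF assms(1)]
  by (simp add: frame_det_def case_prod_unfold det_mult[OF fmat_carrier_mat fmat_carrier_mat])

lemma det_fmat_nonzero:
  assumes "frame E x n \<phi>" "frame E x n \<phi>'"
  shows "det (fmat n n \<phi> \<phi>') \<noteq> 0"
proof -
  have "det (fmat n n \<phi> \<phi>') * det (fmat n n \<phi>' \<phi>) = det (fmat n n \<phi> \<phi>)"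
    using fmat_mult[OF assms assms(1)] by (simp add: det_mult[OF fmat_carrier_mat fmat_carrier_mat])
  also have "\<dots> = 1" using fmat_self[OF assms(1)] by simp
  finally show ?thesis by auto
qed

lemma frame_det_nonzero:
  assumes "frame E x n \<phi>"
  shows "frame_det E x \<phi> \<noteq> 0"
  using det_fmat_nonzero[OF ref_frame(1)[OF assms] assms] ref_frame(2)[OF assms]
  by (simp add: frame_det_def case_prod_unfold)

lemma frame_det_matrix:
  assumes "frame E x n \<phi>" "frame E x n \<phi>'" "A \<in> carrier_mat n n" "\<And>v. v \<in> carrier_vec n \<Longrightarrow> \<phi>' v = \<phi> (A *\<^sub>v v)"
  shows "frame_det E x \<phi>' = frame_det E x \<phi> * det A"
  using frame_det_change[OF assms(1,2)] fmat_unique[OF assms(1,3,4)] by simp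

lemma frame_det_cong:
  assumes "frame E x n \<phi>" "\<And>v. v \<in> carrier_vec n \<Longrightarrow> \<phi>' v = \<phi> v"
  shows "frame_det E x \<phi>' = frame_det E x \<phi>"
proof -
  have "fmat n n (snd (ref_frame E x)) \<phi>' = fmat n n (snd (ref_frame E x)) \<phi>"
    unfolding fmat_def by (rule cong_mat) (simp_all add: assms(2))
  then show ?thesis by (simp add: frame_det_def case_prod_unfold ref_frame(2)[OF assms(1)])
qed

locale equivariant_bundle =
  fixes G :: "('g, 'm) monoid_scheme" (structure) and S :: "'x::topological_space set" and act :: "'g \<Rightarrow> 'x \<Rightarrow> 'x"
    and E :: "('g, 'x, 'e) vbundle"
  assumes space_G: "G_space G (top_of_set S) act"
    and vb: "G_vector_bundle G (top_of_set S) act E"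
begin

sublocale base: group_action G S act
  using space_G by (simp add: G_space_def)

sublocale total: group_action G "topspace (total E)" "action E"
  using vb by (simp add: G_vector_bundle_def G_space_def)

lemma group_G: "group G"
  using total.group_hom by (simp add: group_hom_def)

lemma act_closed: "g \<in> carrier G \<Longrightarrow> x \<in> S \<Longrightarrow> act g x \<in> S"
  by (rule base.element_image[OF _ _ refl])

lemma continuous_act: "g \<in> carrier G \<Longrightarrow> continuous_on S (act g)"
  using space_G by (simp add: G_space_def)

lemma continuous_action: "g \<in> carrier G \<Longrightarrow> continuous_map (total E) (total E) (action E g)"
  using vb by (simp add: G_vector_bundle_def G_space_def)

lemma proj_action: "g \<in> carrier G \<Longrightarrow> e \<in> topspace (total E) \<Longrightarrow> proj E (action E g e) = act g (proj E e)"
  using vb by (simp add: G_vector_bundle_def)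

lemma action_fibre: "g \<in> carrier G \<Longrightarrow> e \<in> fibre E x \<Longrightarrow> action E g e \<in> fibre E (act g x)"
  using total.element_image[of g e] proj_action[of g e] by (simp add: fibre_def)

lemma action_inv:
  assumes "g \<in> carrier G" "e \<in> topspace (total E)"
  shows "action E (inv g) (action E g e) = e" "action E g (action E (inv g) e) = e"
proof -
  interpret group G by (rule group_G)
  have "action E \<one> e = e" using fun_cong[OF total.id_eq_one, of e] assms(2) by simp
  then show "action E (inv g) (action E g e) = e" "action E g (action E (inv g) e) = e"
    using total.composition_rule[OF assms(2), of "inv g" g] total.composition_rule[OF assms(2), of g "inv g"] assms(1)
    by simp_all
qed

lemma act_inv:
  assumes "g \<in> carrier G" "x \<in> S"
  shows "act (inv g) (act g x) = x" "act g (act (inv g) x) = x"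
proof -
  interpret group G by (rule group_G)
  have "act \<one> x = x" using fun_cong[OF base.id_eq_one, of x] assms(2) by simp
  then show "act (inv g) (act g x) = x" "act g (act (inv g) x) = x"
    using base.composition_rule[OF assms(2), of "inv g" g] base.composition_rule[OF assms(2), of g "inv g"] assms(1)
    by simp_all
qed

lemma frame_action:
  assumes g: "g \<in> carrier G" and x: "x \<in> S" and \<phi>: "frame E x n \<phi>"
  shows "frame E (act g x) n (\<lambda>v. action E g (\<phi> v))"
proof -
  interpret group G by (rule group_G)
  have "bij_betw (action E g) (fibre E x) (fibre E (act g x))"
  proof (rule bij_betw_byWitness[where f' = "action E (inv g)"])
    show "action E g ` fibre E x \<subseteq> fibre E (act g x)" using action_fibre[OF g] by blast
    show "action E (inv g) ` fibre E (act g x) \<subseteq> fibre E x"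
      using action_fibre[OF inv_closed[OF g], of _ "act g x"] act_inv[OF g x] by auto
  qed (use action_inv[OF g] in \<open>auto simp: fibre_def\<close>)
  then have "bij_betw (action E g \<circ> \<phi>) (carrier_vec n) (fibre E (act g x))"
    using \<phi> by (auto simp: frame_def intro: bij_betw_trans)
  moreover have "\<forall>e\<in>fibre E x. (\<forall>e'\<in>fibre E x. action E g (add E e e') = add E (action E g e) (action E g e')) \<and>
        (\<forall>c. action E g (scale E c e) = scale E c (action E g e))"
    using vb g x by (simp add: G_vector_bundle_def)
  ultimately show ?thesis
    using \<phi> frame_fibre[OF \<phi>] by (simp add: frame_def comp_def)
qed

text \<open>The scalar by which \<open>g\<close> maps the determinant line at \<open>x\<close> to
  the one at \<open>act g x\<close>, in the reference bases.\<close>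

definition \<theta> :: "'g \<Rightarrow> 'x \<Rightarrow> complex" where
  "\<theta> g x = frame_det E (act g x) (\<lambda>v. action E g (snd (ref_frame E x) v))"

text \<open>Since \<open>g\<close> is linear on fibres, the transition matrix from the reference
  frame to \<phi> is unchanged by the action; so the scalar is the same for every frame.\<close>

lemma frame_det_action:
  assumes g: "g \<in> carrier G" and x: "x \<in> S" and \<phi>: "frame E x n \<phi>"
  shows "frame_det E (act g x) (\<lambda>v. action E g (\<phi> v)) = frame_det E x \<phi> * \<theta> g x"
proof -
  note r = ref_frame[OF \<phi>]
  have "frame_det E (act g x) (\<lambda>v. action E g (\<phi> v)) = \<theta> g x * det (fmat n n (snd (ref_frame E x)) \<phi>)"
    unfolding \<theta>_def
    by (rule frame_det_matrix[OF frame_action[OF g x r(1)] frame_action[OF g x \<phi>] fmat_carrier_mat])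
      (simp add: frame_change[OF r(1) \<phi>])
  then show ?thesis by (simp add: frame_det_def case_prod_unfold r(2))
qed

lemma ex_frame:
  assumes "x \<in> S"
  obtains n \<phi> where "frame E x n \<phi>"
  using vb assms unfolding G_vector_bundle_def topspace_euclidean_subtopology by blast

lemma \<theta>_nonzero:
  assumes "g \<in> carrier G" "x \<in> S"
  shows "\<theta> g x \<noteq> 0"
  using ex_frame[OF assms(2)] frame_det_action[OF assms] frame_det_nonzero frame_action[OF assms]
  by (metis mult_eq_0_iff)

text \<open>A frame moved by \<open>h\<close> is again a frame, at \<open>act h x\<close>, so
  \<open>frame_det_action\<close> applies twice. Through this cocycle identity the relations of the
  group become relations between the factors.\<close>

lemma \<theta>_mult:
  assumes g: "g \<in> carrier G" and h: "h \<in> carrier G" and x: "x \<in> S"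
  shows "\<theta> (g \<otimes> h) x = \<theta> g (act h x) * \<theta> h x"
proof -
  interpret group G by (rule group_G)
  obtain n \<phi> where \<phi>: "frame E x n \<phi>" using ex_frame[OF x] .
  have "frame_det E x \<phi> * \<theta> (g \<otimes> h) x = frame_det E (act (g \<otimes> h) x) (\<lambda>v. action E (g \<otimes> h) (\<phi> v))"
    using frame_det_action[OF _ x \<phi>] g h by simp
  also have "\<dots> = frame_det E (act g (act h x)) (\<lambda>v. action E g (action E h (\<phi> v)))"
    unfolding base.composition_rule[OF x g h]
    by (rule frame_det_cong[OF frame_action[OF g act_closed[OF h x] frame_action[OF h x \<phi>]]])
      (use frame_fibre[OF \<phi>] total.composition_rule[OF _ g h] in \<open>auto simp: fibre_def\<close>)
  also have "\<dots> = frame_det E x \<phi> * \<theta> h x * \<theta> g (act h x)"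
    using frame_det_action[OF g act_closed[OF h x] frame_action[OF h x \<phi>]] frame_det_action[OF h x \<phi>] by simp
  finally show ?thesis using frame_det_nonzero[OF \<phi>] by simp
qed

text \<open>At a fixed point source and target have the same reference frame, so the scalar is the
  determinant of an endomorphism and does not depend on the frame.\<close>

lemma det_fibre_rep:
  assumes \<rho>: "\<rho> \<in> fibre_rep G H E x" and h: "h \<in> H" "H \<subseteq> carrier G" and x: "x \<in> S" "act h x = x"
  shows "det (\<rho> h) = \<theta> h x"
proof -
  obtain n \<phi> where *: "\<rho> \<in> Hom (sub G H) (GL n)" "frame E x n \<phi>"
      "\<And>v. v \<in> carrier_vec n \<Longrightarrow> action E h (\<phi> v) = \<phi> (\<rho> h *\<^sub>v v)"
    using \<rho> h by (auto simp: fibre_rep_def)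
  have g: "h \<in> carrier G" using h by blast
  have "\<rho> h \<in> carrier_mat n n" using *(1) h by (auto simp: Hom_def hom_def sub_def dest: GL_carrier_mat)
  moreover have "frame E x n (\<lambda>v. action E h (\<phi> v))" using frame_action[OF g x(1) *(2)] x(2) by simp
  ultimately have "frame_det E x (\<lambda>v. action E h (\<phi> v)) = frame_det E x \<phi> * det (\<rho> h)"
    using frame_det_matrix[OF *(2)] *(3) by blast
  then show ?thesis
    using frame_det_action[OF g x(1) *(2)] x(2) frame_det_nonzero[OF *(2)] by simp
qed

text \<open>Asks less than a local trivialization: only the basis sections have to be continuous.
  This form is easily carried along by the group action.\<close>

definition frame_field :: "'x set \<Rightarrow> nat \<Rightarrow> ('x \<Rightarrow> complex Matrix.vec \<Rightarrow> 'e) \<Rightarrow> bool" where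
  "frame_field U n s \<longleftrightarrow> openin (top_of_set S) U \<and> (\<forall>y\<in>U. frame E y n (s y)) \<and>
     (\<forall>j<n. continuous_map (top_of_set U) (total E) (\<lambda>y. s y (unit_vec n j)))"

lemma frame_field_action:
  assumes g: "g \<in> carrier G" and s: "frame_field U n s"
  shows "frame_field (act g ` U) n (\<lambda>y v. action E g (s (act (inv g) y) v))"
proof -
  interpret group G by (rule group_G)
  have US: "U \<subseteq> S" using s openin_imp_subset by (auto simp: frame_field_def)
  have inv: "act (inv g) (act g y) = y" if "y \<in> U" for y using act_inv[OF g] that US by blast
  have "act g ` U = {y \<in> S. act (inv g) y \<in> U}"
  proof (intro equalityI subsetI)
    fix y assume "y \<in> act g ` U"
    then show "y \<in> {y \<in> S. act (inv g) y \<in> U}" using inv act_closed[OF g] US by auto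
  next
    fix y assume "y \<in> {y \<in> S. act (inv g) y \<in> U}"
    then show "y \<in> act g ` U" using act_inv(2)[OF g, of y] by (intro image_eqI[of _ _ "act (inv g) y"]) auto
  qed
  moreover have "openin (top_of_set S) {y \<in> S. act (inv g) y \<in> U}"
    using openin_continuous_map_preimage[of "top_of_set S" "top_of_set S" "act (inv g)" U] space_G g s
    by (simp add: G_space_def frame_field_def)
  ultimately have op: "openin (top_of_set S) (act g ` U)" by simp
  have "continuous_on (act g ` U) (act (inv g))"
    using continuous_act[OF inv_closed[OF g]] US act_closed[OF g] by (auto elim!: continuous_on_subset)
  then have ci: "continuous_map (top_of_set (act g ` U)) (top_of_set U) (act (inv g))"
    using inv by auto
  show ?thesis
    unfolding frame_field_def
  proof (intro conjI ballI allI impI op)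
    fix y assume "y \<in> act g ` U"
    then obtain x where x: "x \<in> U" "y = act g x" by blast
    then have "frame E x n (s x)" using s by (simp add: frame_field_def)
    then show "frame E y n (\<lambda>v. action E g (s (act (inv g) y) v))"
      using frame_action[OF g, of x n "s x"] x inv US by auto
  next
    fix j assume "j < n"
    then have "continuous_map (top_of_set U) (total E) (\<lambda>y. s y (unit_vec n j))" using s by (simp add: frame_field_def)
    from continuous_map_compose[OF continuous_map_compose[OF ci this] continuous_action[OF g]]
    show "continuous_map (top_of_set (act g ` U)) (total E) (\<lambda>y. action E g (s (act (inv g) y) (unit_vec n j)))"
      by (simp add: comp_def)
  qed
qed

lemma continuous_vec_index: "i < n \<Longrightarrow> continuous_map (cvec_topology n) euclidean (\<lambda>v. vec_index v i)"
proof -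
  assume i: "i < n"
  have "continuous_map (cvec_topology n) euclidean ((\<lambda>f. f i) \<circ> (\<lambda>v. \<lambda>i\<in>{..<n}. vec_index v i))"
    unfolding cvec_topology_def
    by (rule continuous_map_pullback) (use i in \<open>auto intro: continuous_map_product_projection\<close>)
  then show ?thesis by (rule continuous_map_eq) (use i in auto)
qed

lemma topspace_cvec: "topspace (cvec_topology n) = carrier_vec n"
  by (auto simp: cvec_topology_def topspace_pullback_topology)

text \<open>The inverse homeomorphism of the trivialization yields continuous coordinates, so any
  other frame field of the same rank is expressed in \<open>t\<close> with continuous
  entries.\<close>

lemma local_trivialization:
  assumes "x \<in> S"
  obtains U n t where "x \<in> U" "frame_field U n t"
    "\<And>V s j i. frame_field V n s \<Longrightarrow> j < n \<Longrightarrow> i < n \<Longrightarrow>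
      continuous_on (U \<inter> V) (\<lambda>y. inv_into (carrier_vec n) (t y) (s y (unit_vec n j)) $ i)"
proof -
  obtain U n \<psi> where U: "openin (top_of_set S) U" "x \<in> U"
      and hom: "homeomorphic_map (prod_topology (subtopology (top_of_set S) U) (cvec_topology n)) (subtopology (total E) {e. proj E e \<in> U}) \<psi>"
      and fr: "\<forall>y\<in>U. frame E y n (\<lambda>v. \<psi> (y, v))"
    using vb assms unfolding G_vector_bundle_def topspace_euclidean_subtopology by metis
  have US: "U \<subseteq> S" using U(1) openin_imp_subset by blast
  then have sub: "subtopology (top_of_set S) U = top_of_set U"
    by (simp add: subtopology_subtopology Int_absorb1)
  note hom = hom[unfolded sub]
  let ?T = "subtopology (total E) {e. proj E e \<in> U}"
  obtain \<eta> where \<eta>: "homeomorphic_maps (prod_topology (top_of_set U) (cvec_topology n)) ?T \<psi> \<eta>"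
    using hom homeomorphic_map_maps by blast
  have ff: "frame_field U n (\<lambda>y v. \<psi> (y, v))"
    unfolding frame_field_def
  proof (intro conjI U(1) fr allI impI)
    fix j
    have "continuous_map (top_of_set U) (prod_topology (top_of_set U) (cvec_topology n)) (\<lambda>y. (y, unit_vec n j))"
      by (intro continuous_map_pairedI) (auto simp: topspace_cvec)
    moreover have "continuous_map (prod_topology (top_of_set U) (cvec_topology n)) (total E) \<psi>"
      using \<eta> by (simp add: homeomorphic_maps_def continuous_map_in_subtopology)
    ultimately show "continuous_map (top_of_set U) (total E) (\<lambda>y. \<psi> (y, unit_vec n j))"
      using continuous_map_compose by (fastforce simp: comp_def)
  qed
  have "continuous_on (U \<inter> V) (\<lambda>y. inv_into (carrier_vec n) (\<lambda>v. \<psi> (y, v)) (s y (unit_vec n j)) $ i)"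
    if s: "frame_field V n s" and j: "j < n" and i: "i < n" for V s j i
  proof -
    have sf: "s y (unit_vec n j) \<in> fibre E y" if "y \<in> V" for y
      using s that frame_fibre[of E y n "s y"] by (simp add: frame_field_def)
    have "continuous_map (top_of_set V) (total E) (\<lambda>y. s y (unit_vec n j))"
      using s j by (simp add: frame_field_def)
    then have "continuous_map (top_of_set (U \<inter> V)) (total E) (\<lambda>y. s y (unit_vec n j))"
      using continuous_map_from_subtopology[of "top_of_set V" "total E" _ "U \<inter> V"]
      by (simp add: subtopology_subtopology Int_absorb1)
    then have 1: "continuous_map (top_of_set (U \<inter> V)) ?T (\<lambda>y. s y (unit_vec n j))"
      using sf by (auto simp: continuous_map_in_subtopology fibre_def)
    have "continuous_map ?T (prod_topology (top_of_set U) (cvec_topology n)) \<eta>"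
      using \<eta> unfolding homeomorphic_maps_def by blast
    from continuous_map_compose[OF this continuous_map_snd]
    have 2: "continuous_map ?T (cvec_topology n) (\<lambda>e. snd (\<eta> e))" by (simp add: comp_def)
    have "continuous_map (top_of_set (U \<inter> V)) euclidean (\<lambda>y. snd (\<eta> (s y (unit_vec n j))) $ i)"
      using continuous_map_compose[OF continuous_map_compose[OF 1 2] continuous_vec_index[OF i]]
      by (simp add: comp_def)
    then have "continuous_on (U \<inter> V) (\<lambda>y. snd (\<eta> (s y (unit_vec n j))) $ i)" by simp
    then show ?thesis
    proof (rule continuous_on_eq)
      fix y assume y: "y \<in> U \<inter> V"
      let ?e = "s y (unit_vec n j)"
      have e: "?e \<in> fibre E y" using sf y by blast
      let ?v = "inv_into (carrier_vec n) (\<lambda>v. \<psi> (y, v)) ?e"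
      have v: "?v \<in> carrier_vec n" "\<psi> (y, ?v) = ?e" using frame_inv[OF bspec[OF fr] e] y by auto
      have "\<eta> (\<psi> (y, ?v)) = (y, ?v)"
        using \<eta> v(1) y by (simp add: homeomorphic_maps_def topspace_cvec)
      then show "snd (\<eta> ?e) $ i = ?v $ i" using v(2) by simp
    qed
  qed
  then show thesis using that[OF U(2) ff] by blast
qed

lemma continuous_on_det:
  fixes f :: "'x \<Rightarrow> nat \<Rightarrow> nat \<Rightarrow> complex"
  assumes "\<And>i j. i < n \<Longrightarrow> j < n \<Longrightarrow> continuous_on U (\<lambda>y. f y i j)"
  shows "continuous_on U (\<lambda>y. det (mat n n (\<lambda>(i, j). f y i j)))"
proof -
  have eq: "det (mat n n (\<lambda>(i, j). f y i j)) = (\<Sum>p\<in>{p. p permutes {0..<n}}. signof p * (\<Prod>i = 0..<n. f y i (p i)))" for y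
    by (subst det_def'[of _ n]) (auto intro!: sum.cong prod.cong arg_cong2[where f = "(*)"] dest: permutes_in_image)
  show ?thesis
    unfolding eq using assms
    by (intro continuous_intros) (auto dest: permutes_in_image)
qed

text \<open>Both frame fields are compared with a local trivialization. The reference frames cancel
  in the quotient, which leaves determinants of continuous transition matrices.\<close>

lemma frame_field_ratio_continuous:
  assumes s: "frame_field U n s" and s': "frame_field V m s'"
  shows "continuous_on (U \<inter> V) (\<lambda>y. frame_det E y (s' y) / frame_det E y (s y))"
proof -
  have US: "U \<subseteq> S" "V \<subseteq> S" using s s' openin_imp_subset by (auto simp: frame_field_def)
  have loc: "\<exists>W. openin (top_of_set S) W \<and> x \<in> W \<and>
      continuous_on (W \<inter> (U \<inter> V)) (\<lambda>y. frame_det E y (s' y) / frame_det E y (s y))" if x: "x \<in> U \<inter> V" for x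
  proof -
    have xS: "x \<in> S" using x US by blast
    obtain W k t where W: "x \<in> W" "frame_field W k t"
      and cont: "\<And>V s j i. frame_field V k s \<Longrightarrow> j < k \<Longrightarrow> i < k \<Longrightarrow>
      continuous_on (W \<inter> V) (\<lambda>y. inv_into (carrier_vec k) (t y) (s y (unit_vec k j)) $ i)"
      using local_trivialization[OF xS] by metis
    have f: "frame E x k (t x)" "frame E x n (s x)" "frame E x m (s' x)"
      using W s s' x by (auto simp: frame_field_def)
    have nm: "n = k" "m = k" using frame_rank_unique[OF f(2,1)] frame_rank_unique[OF f(3,1)] by auto
    have c: "continuous_on (W \<inter> V) (\<lambda>y. det (fmat k k (t y) (s y)))" if "frame_field V k s" for V s
      unfolding fmat_def by (rule continuous_on_det) (rule cont[OF that])
    have "continuous_on (W \<inter> (U \<inter> V)) (\<lambda>y. det (fmat k k (t y) (s' y)) / det (fmat k k (t y) (s y)))"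
    proof (rule continuous_on_divide)
      show "continuous_on (W \<inter> (U \<inter> V)) (\<lambda>y. det (fmat k k (t y) (s' y)))"
        by (rule continuous_on_subset[OF c[of V s']]) (use s' nm in auto)
      show "continuous_on (W \<inter> (U \<inter> V)) (\<lambda>y. det (fmat k k (t y) (s y)))"
        by (rule continuous_on_subset[OF c[of U s]]) (use s nm in auto)
      show "\<forall>y\<in>W \<inter> (U \<inter> V). det (fmat k k (t y) (s y)) \<noteq> 0"
      proof
        fix y assume "y \<in> W \<inter> (U \<inter> V)"
        then have "frame E y k (t y)" "frame E y k (s y)" using W(2) s nm by (auto simp: frame_field_def)
        then show "det (fmat k k (t y) (s y)) \<noteq> 0" by (rule det_fmat_nonzero)
      qed
    qed
    then have "continuous_on (W \<inter> (U \<inter> V)) (\<lambda>y. frame_det E y (s' y) / frame_det E y (s y))"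
    proof (rule continuous_on_eq)
      fix y assume y: "y \<in> W \<inter> (U \<inter> V)"
      then have f: "frame E y k (t y)" "frame E y k (s y)" "frame E y k (s' y)"
        using W s s' nm by (auto simp: frame_field_def)
      show "det (fmat k k (t y) (s' y)) / det (fmat k k (t y) (s y)) = frame_det E y (s' y) / frame_det E y (s y)"
        using frame_det_change[OF f(1,2)] frame_det_change[OF f(1,3)] frame_det_nonzero[OF f(1)] by simp
    qed
    then show ?thesis using W by (auto simp: frame_field_def)
  qed
  show ?thesis
  proof (rule continuous_on_locally)
    fix x assume x: "x \<in> U \<inter> V"
    obtain W where W: "openin (top_of_set S) W" "x \<in> W"
      "continuous_on (W \<inter> (U \<inter> V)) (\<lambda>y. frame_det E y (s' y) / frame_det E y (s y))" using loc[OF x] by blast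
    obtain O' where O: "open O'" "W = S \<inter> O'" using W(1) by (auto simp: openin_open)
    have "U \<inter> V \<inter> O' = W \<inter> (U \<inter> V)" using US O by blast
    then show "\<exists>O'. open O' \<and> x \<in> O' \<and> continuous_on (U \<inter> V \<inter> O') (\<lambda>y. frame_det E y (s' y) / frame_det E y (s y))"
      using O W by (intro exI[of _ O']) auto
  qed
qed

end

subsection \<open>The centre acts with determinant one\<close>

text \<open>Identifies triples of reals, over which the box argument runs, with the model of R^3
  inside the real sequences.\<close>

fun pt :: "real \<times> real \<times> real \<Rightarrow> nat \<Rightarrow> real" where
  "pt (a, b, c) = (\<lambda>i. if i = 0 then a else if i = 1 then b else if i = 2 then c else 0)"

lemma pt_R3: "pt p \<in> R3"
  by (cases p) auto

lemma pt_surj: "v \<in> R3 \<Longrightarrow> v = pt (v 0, v 1, v 2)"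
  by (rule R3_eqI) auto

lemma continuous_pt: "continuous_on U pt"
proof (rule continuous_on_coordinatewise_then_product)
  fix i :: nat
  have eq: "(\<lambda>p. pt p i) = (if i = 0 then fst else if i = 1 then (\<lambda>p. fst (snd p)) else if i = 2 then (\<lambda>p. snd (snd p)) else (\<lambda>_. 0))"
    by (auto simp: fun_eq_iff)
  show "continuous_on U (\<lambda>p. pt p i)"
    unfolding eq by (auto intro!: continuous_on_fst continuous_on_snd continuous_on_id)
qed

lemma act_pt:
  "act (enc (1, 0, 0, False)) (pt (a, b, c)) = pt (a + 1, b, c)"
  "act (enc (0, 1, 0, False)) (pt (a, b, c)) = pt (- a, b + 1, c)"
  "act (enc (0, 0, 1, False)) (pt (a, b, c)) = pt (a, b, c + 1)"
  by (subst act_enc[OF pt_R3]; rule R3_eqI; simp add: sg_def)+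

declare pt.simps [simp del]

text \<open>The determinant line of \<open>E\<close>, measured by \<open>frame_det\<close> and
  pulled back along \<open>pt\<close>, satisfies the hypotheses of
  \<open>central_sign_trivial\<close>: the factors \<theta> inherit the group relations, and at any
  point, since z fixes it, the factor of z is the determinant in question.\<close>

theorem det_centre_trivial:
  fixes E :: "(nat, nat \<Rightarrow> real, 'e) vbundle"
  assumes E: "G_vector_bundle crys E3 act E" and x: "x \<in> R3"
    and \<rho>: "\<rho> \<in> fibre_rep crys centre E x"
  shows "det (\<rho> (enc (0, 0, 0, True))) = 1"
proof -
  interpret B: equivariant_bundle crys R3 act E
    by unfold_locales (use G_space_act E in \<open>simp_all add: Euclidean_space_eq\<close>)
  define D where "D = {(pt -` U, \<lambda>p. frame_det E (pt p) (s (pt p))) | U n s. B.frame_field U n s}"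
  let ?gx = "enc (1, 0, 0, False)" and ?gy = "enc (0, 1, 0, False)" and ?gt = "enc (0, 0, 1, False)" and ?gz = "enc (0, 0, 0, True)"
  have atlas: "line_bundle_atlas D"
  proof
    fix U d assume "(U, d) \<in> D"
    then obtain U' n s where U: "U = pt -` U'" "d = (\<lambda>p. frame_det E (pt p) (s (pt p)))" "B.frame_field U' n s"
      by (auto simp: D_def)
    obtain O' where "open O'" "U' = R3 \<inter> O'" using U(3) by (auto simp: B.frame_field_def openin_open)
    then have "U = pt -` O'" using pt_R3 U(1) by auto
    then show "open U" using open_vimage[OF \<open>open O'\<close> continuous_pt] by simp
    fix p assume "p \<in> U"
    then have "frame E (pt p) n (s (pt p))" using U by (simp add: B.frame_field_def)
    then show "d p \<noteq> 0" unfolding U(2) by (rule frame_det_nonzero)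
  next
    fix U d V e assume "(U, d) \<in> D" "(V, e) \<in> D"
    then obtain U' n s V' m t where U: "U = pt -` U'" "d = (\<lambda>p. frame_det E (pt p) (s (pt p)))" "B.frame_field U' n s"
      and V: "V = pt -` V'" "e = (\<lambda>p. frame_det E (pt p) (t (pt p)))" "B.frame_field V' m t"
      unfolding D_def by blast
    show "continuous_on (U \<inter> V) (\<lambda>p. e p / d p)"
      unfolding U(2) V(2)
      by (rule continuous_on_compose2[OF B.frame_field_ratio_continuous[OF U(3) V(3)] continuous_pt]) (auto simp: U(1) V(1))
  next
    fix p
    obtain U n s where U: "pt p \<in> U" "B.frame_field U n s"
      by (rule B.local_trivialization[OF pt_R3[of p]])
    have "(pt -` U, \<lambda>p. frame_det E (pt p) (s (pt p))) \<in> D"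
      unfolding D_def by (rule CollectI, intro exI[of _ U] exI[of _ n] exI[of _ s] conjI refl U)
    then show "\<exists>(U, d)\<in>D. p \<in> U"
      by (rule rev_bexI) (use U in simp)
  qed
  have atlas_action: "\<exists>(V, e)\<in>D. \<forall>p\<in>U. T p \<in> V \<and> e (T p) = d p * B.\<theta> g (pt p)"
    if T: "\<And>p. pt (T p) = act g (pt p)" and Ud: "(U, d) \<in> D" for T g U d
  proof -
    obtain U' n s where U: "U = pt -` U'" "d = (\<lambda>p. frame_det E (pt p) (s (pt p)))" "B.frame_field U' n s"
      using Ud unfolding D_def by blast
    let ?t = "\<lambda>y v. action E g (s (act (inv\<^bsub>crys\<^esub> g) y) v)"
    have t: "B.frame_field (act g ` U') n ?t" by (rule B.frame_field_action[OF _ U(3)]) simp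
    have eq: "frame_det E (pt (T p)) (?t (pt (T p))) = d p * B.\<theta> g (pt p)" if "p \<in> U" for p
    proof -
      have "frame E (pt p) n (s (pt p))" using U that by (simp add: B.frame_field_def)
      then show ?thesis
        unfolding T U(2) using B.frame_det_action[OF _ pt_R3, of g p n "s (pt p)"] act_inv(2)[OF pt_R3, of g p] by simp
    qed
    have mem: "(pt -` (act g ` U'), \<lambda>p. frame_det E (pt p) (?t (pt p))) \<in> D"
      unfolding D_def
      by (rule CollectI, intro exI[of _ "act g ` U'"] exI[of _ n] exI[of _ ?t] conjI refl t)
    show ?thesis
    proof (rule bexI[OF _ mem], unfold prod.case, intro ballI conjI)
      fix p assume p: "p \<in> U"
      show "T p \<in> pt -` act g ` U'" using p U(1) T by auto
      show "frame_det E (pt (T p)) (?t (pt (T p))) = d p * B.\<theta> g (pt p)" by (rule eq[OF p])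
    qed
  qed
  \<comment> \<open>The cocycle identity makes the factor of the identity idempotent, and it is not
    zero.\<close>
  have one: "B.\<theta> \<one>\<^bsub>crys\<^esub> v = 1" if v: "v \<in> R3" for v
  proof -
    have "B.\<theta> \<one>\<^bsub>crys\<^esub> v = B.\<theta> \<one>\<^bsub>crys\<^esub> v * B.\<theta> \<one>\<^bsub>crys\<^esub> v"
      using B.\<theta>_mult[of "\<one>\<^bsub>crys\<^esub>" "\<one>\<^bsub>crys\<^esub>" v] v group.is_monoid[OF group_crys] act_one[OF v]
      by (simp add: monoid.l_one)
    then show ?thesis using B.\<theta>_nonzero[of "\<one>\<^bsub>crys\<^esub>" v] v by simp
  qed
  have mult: "B.\<theta> (g \<otimes>\<^bsub>crys\<^esub> h) v = B.\<theta> g (act h v) * B.\<theta> h v" if "v \<in> R3" for g h v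
    using B.\<theta>_mult[of g h v] that by simp
  define X :: "real \<times> real \<times> real \<Rightarrow> real \<times> real \<times> real" where "X = (\<lambda>(a, b, c). (a + 1, b, c))"
  define Y :: "real \<times> real \<times> real \<Rightarrow> real \<times> real \<times> real" where "Y = (\<lambda>(a, b, c). (- a, b + 1, c))"
  define T :: "real \<times> real \<times> real \<Rightarrow> real \<times> real \<times> real" where "T = (\<lambda>(a, b, c). (a, b, c + 1))"
  have pX: "pt (X p) = act ?gx (pt p)" for p by (cases p) (simp add: X_def act_pt)
  have pY: "pt (Y p) = act ?gy (pt p)" for p by (cases p) (simp add: Y_def act_pt)
  have pT: "pt (T p) = act ?gt (pt p)" for p by (cases p) (simp add: T_def act_pt)
  have gz: "?gz \<in> centre" by (simp add: centre_eq)
  have pZ: "pt p = act ?gz (pt p)" for p by (rule act_centre[OF gz pt_R3, symmetric])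
  have "B.\<theta> ?gz (pt (x 0, x 1, x 2)) = 1"
  proof (rule central_sign_trivial[OF atlas, where X = X and Y = Y and T = T and \<theta>x = "\<lambda>p. B.\<theta> ?gx (pt p)"
        and \<theta>y = "\<lambda>p. B.\<theta> ?gy (pt p)" and \<theta>t = "\<lambda>p. B.\<theta> ?gt (pt p)" and \<theta>z = "\<lambda>p. B.\<theta> ?gz (pt p)"])
    show "X (a, b, c) = (a + 1, b, c)" "Y (a, b, c) = (- a, b + 1, c)" "T (a, b, c) = (a, b, c + 1)" for a b c
      by (simp_all add: X_def Y_def T_def)
    show "B.\<theta> ?gx (pt p) \<noteq> 0" "B.\<theta> ?gy (pt p) \<noteq> 0" "B.\<theta> ?gt (pt p) \<noteq> 0" "B.\<theta> ?gz (pt p) \<noteq> 0" for p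
      by (rule B.\<theta>_nonzero[OF _ pt_R3]; simp)+
    fix U d assume U: "(U, d) \<in> D"
    show "\<exists>(V, e)\<in>D. \<forall>p\<in>U. X p \<in> V \<and> e (X p) = d p * B.\<theta> ?gx (pt p)" by (rule atlas_action[OF pX U])
    show "\<exists>(V, e)\<in>D. \<forall>p\<in>U. Y p \<in> V \<and> e (Y p) = d p * B.\<theta> ?gy (pt p)" by (rule atlas_action[OF pY U])
    show "\<exists>(V, e)\<in>D. \<forall>p\<in>U. T p \<in> V \<and> e (T p) = d p * B.\<theta> ?gt (pt p)" by (rule atlas_action[OF pT U])
    show "\<exists>(V, e)\<in>D. \<forall>p\<in>U. p \<in> V \<and> e p = d p * B.\<theta> ?gz (pt p)" by (rule atlas_action[OF pZ U])
  next
    fix p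
    \<comment> \<open>The conjugation relation between x and y, written without inverses.\<close>
    have "?gx \<otimes>\<^bsub>crys\<^esub> ?gy \<otimes>\<^bsub>crys\<^esub> ?gx = ?gy" by (simp add: mult_crys sg_def)
    then show "B.\<theta> ?gx (pt (Y (X p))) * B.\<theta> ?gy (pt (X p)) * B.\<theta> ?gx (pt p) = B.\<theta> ?gy (pt p)"
      using mult[OF pt_R3, of "?gx \<otimes>\<^bsub>crys\<^esub> ?gy" ?gx p] mult[OF act_R3[OF pt_R3], of ?gx ?gy ?gx p]
      by (simp only: pX pY)
    have "?gt \<otimes>\<^bsub>crys\<^esub> ?gx = ?gz \<otimes>\<^bsub>crys\<^esub> ?gx \<otimes>\<^bsub>crys\<^esub> ?gt" by (simp add: mult_crys sg_def)
    then show "B.\<theta> ?gt (pt (X p)) * B.\<theta> ?gx (pt p) = B.\<theta> ?gz (pt (X (T p))) * B.\<theta> ?gx (pt (T p)) * B.\<theta> ?gt (pt p)"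
      using mult[OF pt_R3, of ?gt ?gx p] mult[OF pt_R3, of "?gz \<otimes>\<^bsub>crys\<^esub> ?gx" ?gt p] mult[OF act_R3[OF pt_R3], of ?gz ?gx ?gt p]
      by (simp only: pX pT)
    have "?gt \<otimes>\<^bsub>crys\<^esub> ?gy = ?gy \<otimes>\<^bsub>crys\<^esub> ?gt" by (simp add: mult_crys sg_def)
    then show "B.\<theta> ?gt (pt (Y p)) * B.\<theta> ?gy (pt p) = B.\<theta> ?gy (pt (T p)) * B.\<theta> ?gt (pt p)"
      using mult[OF pt_R3, of ?gt ?gy p] mult[OF pt_R3, of ?gy ?gt p] by (simp only: pY pT)
    have "?gz \<otimes>\<^bsub>crys\<^esub> ?gz = \<one>\<^bsub>crys\<^esub>" by (simp add: mult_crys one_crys)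
    then show "B.\<theta> ?gz (pt p) * B.\<theta> ?gz (pt p) = 1"
      using mult[OF pt_R3, of ?gz ?gz p] one[OF pt_R3, of p] pZ[of p] by simp
  qed
  moreover have "det (\<rho> ?gz) = B.\<theta> ?gz x"
    by (rule B.det_fibre_rep[OF \<rho>]) (use x act_centre[OF _ x] in \<open>auto simp: centre_def\<close>)
  ultimately show ?thesis using pt_surj[OF x] by simp
qed

subsection \<open>The sign character of the centre\<close>

text \<open>In the trivial subgroup the exceptional element does not occur, and the same formula
  yields the trivial character.\<close>

definition sign_char :: "nat set \<Rightarrow> nat \<Rightarrow> complex Matrix.mat" where
  "sign_char H = (\<lambda>h\<in>H. mat 1 1 (\<lambda>_. if h = enc (0, 0, 0, True) then - 1 else 1))"

definition sign_family :: "nat set \<Rightarrow> (nat \<Rightarrow> complex Matrix.mat) set" where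
  "sign_family = (\<lambda>H\<in>finite_subgroups crys. conj_rel (sub crys H) (unitary_group 1) `` {sign_char H})"

lemma sign_char_Hom:
  assumes "H \<in> finite_subgroups crys"
  shows "sign_char H \<in> Hom (sub crys H) (unitary_group 1)"
proof -
  have H: "H \<subseteq> centre" "subgroup H crys"
    using assms finite_subgroup_subset_centre by (auto simp: finite_subgroups_def)
  have u: "mat 1 1 (\<lambda>_. c) * mat_adjoint (mat 1 1 (\<lambda>_. c)) = 1\<^sub>m 1" if "c = 1 \<or> c = - 1" for c :: complex
    using that mat_adjoint_carrier_mat[of "mat 1 1 (\<lambda>_. c)" 1]
    by (intro eq_matI) (auto simp: scalar_prod_def mat_adjoint_index[of _ 1])
  have m: "mat 1 1 (\<lambda>_. a) * mat 1 1 (\<lambda>_. b) = mat 1 1 (\<lambda>_. a * b :: complex)" for a b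
    by (rule eq_matI) (auto simp: scalar_prod_def)
  show ?thesis
    unfolding Hom_def hom_def
  proof (intro IntI CollectI conjI funcsetI ballI)
    show "sign_char H \<in> extensional (carrier (sub crys H))" by (simp add: sign_char_def sub_def)
    show "sign_char H h \<in> carrier (unitary_group 1)" if "h \<in> carrier (sub crys H)" for h
      using that u[of "- 1"] u[of 1] by (auto simp: sign_char_def sub_def unitary_group_def)
    fix h k assume "h \<in> carrier (sub crys H)" "k \<in> carrier (sub crys H)"
    then have hk: "h \<in> H" "k \<in> H" by (auto simp: sub_def)
    then have "h \<otimes>\<^bsub>crys\<^esub> k \<in> H" using subgroup.m_closed[OF H(2)] by blast
    moreover have "h \<in> centre" "k \<in> centre" using hk H by auto
    ultimately show "sign_char H (h \<otimes>\<^bsub>sub crys H\<^esub> k) = sign_char H h \<otimes>\<^bsub>unitary_group 1\<^esub> sign_char H k"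
      using hk by (auto simp: sign_char_def sub_def unitary_group_def mult_GL m[unfolded One_nat_def] mult_crys centre_eq)
  qed
qed

text \<open>Finite subgroups are central, so conjugation does nothing and each pullback is a
  restriction; the sign characters restrict to one another.\<close>

lemma sign_family_lim: "sign_family \<in> lim_Rep_U 1 crys"
proof -
  have "sign_family H \<in> Rep_U 1 (sub crys H)" if "H \<in> finite_subgroups crys" for H
    using sign_char_Hom[OF that] that by (auto simp: sign_family_def Rep_U_def intro: quotientI)
  moreover have "pullback_Rep_U 1 crys H g (sign_family K) = sign_family H"
    if HK: "H \<in> finite_subgroups crys" "K \<in> finite_subgroups crys" and f: "f \<in> orbit_maps crys H K"
      and g: "g \<in> carrier crys" and fH: "f H = g <#\<^bsub>crys\<^esub> K" for H K f g
  proof -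
    interpret group crys by (rule group_crys)
    have sub: "subgroup H crys" "subgroup K crys" using HK by (auto simp: finite_subgroups_def)
    have H: "H \<subseteq> centre" using HK finite_subgroup_subset_centre by (auto simp: finite_subgroups_def)
    note ad = orbit_map_conj[OF group_crys sub f g fH]
    have conj: "inv\<^bsub>crys\<^esub> g \<otimes>\<^bsub>crys\<^esub> h \<otimes>\<^bsub>crys\<^esub> g = h" if "h \<in> H" for h
    proof -
      have "inv\<^bsub>crys\<^esub> g \<otimes>\<^bsub>crys\<^esub> h \<otimes>\<^bsub>crys\<^esub> g = inv\<^bsub>crys\<^esub> g \<otimes>\<^bsub>crys\<^esub> (g \<otimes>\<^bsub>crys\<^esub> h)"
        using centre_commutes[of h g] that H by (auto simp: m_assoc)
      also have "\<dots> = h" by (simp add: m_assoc[symmetric])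
      finally show ?thesis .
    qed
    have "pullback_hom crys H g (sign_char K) = sign_char H"
    proof
      fix h
      show "pullback_hom crys H g (sign_char K) h = sign_char H h"
        using conj[of h] ad[of h] by (simp add: pullback_hom_def sign_char_def)
    qed
    moreover have "conj_rel (sub crys H) (unitary_group 1) `` (pullback_hom crys H g ` (conj_rel (sub crys K) (unitary_group 1) `` {sign_char K}))
      = conj_rel (sub crys H) (unitary_group 1) `` {pullback_hom crys H g (sign_char K)}"
      by (rule image_equiv_class[OF equiv_conj_rel[OF group_unitary_group] pullback_hom_conj_rel[OF group_crys sub g ad]])
        (use equiv_conj_rel[OF group_unitary_group] sign_char_Hom[OF HK(2)] in \<open>auto simp: equiv_def refl_on_def\<close>)
    ultimately show ?thesis using HK by (simp add: pullback_Rep_U_def sign_family_def)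
  qed
  ultimately show ?thesis
    unfolding lim_Rep_U_def orbit_lim_def by (auto simp: sign_family_def)
qed

text \<open>Membership in the monoid is a hypothesis because at its use it comes for free from
  \<open>groth_rel\<close>. It supplies a fibre representation to work with and ensures that any one
  of them computes the determinant.\<close>

lemma fibre_rep_class_det:
  assumes C: "C \<in> carrier (Vect crys E3 act)"
    and K: "fibre_rep_class crys E3 act centre C \<in> carrier (rep_monoid (sub crys centre))"
  shows "rep_det (fibre_rep_class crys E3 act centre C) (enc (0, 0, 0, True)) = 1"
proof -
  have fin: "centre \<in> finite_subgroups crys" by (simp add: finite_subgroups_crys)
  note gr = group_sub[OF group_crys fin]
  obtain \<sigma> where "\<sigma> \<in> reps (sub crys centre)"
      "fibre_rep_class crys E3 act centre C = rep_class (sub crys centre) \<sigma>"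
    using K unfolding carrier_rep_monoid by blast
  then have \<sigma>: "\<sigma> \<in> fibre_rep_class crys E3 act centre C" using rep_iso_refl[OF gr] by blast
  then obtain E x where *: "E \<in> C" "x \<in> R3" "\<sigma> \<in> fibre_rep crys centre E x"
    unfolding fibre_rep_class_def fixed_points_act[OF fin] by blast
  have "G_vector_bundle crys E3 act E"
    using *(1) C by (auto simp: Vect_def bundle_class_def G_bundles_def)
  then have "det (\<sigma> (enc (0, 0, 0, True))) = 1" using *(2,3) by (rule det_centre_trivial)
  moreover have "enc (0, 0, 0, True) \<in> carrier (sub crys centre)" by (simp add: sub_def centre_eq)
  ultimately show ?thesis using rep_det_eq[OF gr K \<sigma>] by simp
qed

text \<open>If the family came from a formal difference of bundle classes \<open>C\<close> and
  \<open>D\<close>, its determinant at z would be the quotient of theirs, both equal to 1; but it is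
  -1.\<close>

lemma sign_family_not_realized:
  "lim_Rep_U_incl crys sign_family \<notin> epsilon crys E3 act ` carrier (K0 crys E3 act)"
proof
  let ?X = E3 and ?z = "enc (0, 0, 0, True)" and ?N = "rep_monoid (sub crys centre)"
  let ?\<phi> = "fibre_rep_class crys ?X act centre"
  assume "lim_Rep_U_incl crys sign_family \<in> epsilon crys ?X act ` carrier (K0 crys ?X act)"
  then obtain \<xi> where \<xi>: "\<xi> \<in> carrier (K0 crys ?X act)" "lim_Rep_U_incl crys sign_family = epsilon crys ?X act \<xi>" by blast
  have fin: "centre \<in> finite_subgroups crys" by (simp add: finite_subgroups_crys)
  note gr = group_sub[OF group_crys fin]
  have z: "?z \<in> carrier (sub crys centre)" by (simp add: sub_def centre_eq)
  define c where "c = rep_class (sub crys centre) (sign_char centre)"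
  have reps: "sign_char centre \<in> reps (sub crys centre)" using Hom_unitary_reps sign_char_Hom[OF fin] by blast
  have c: "c \<in> carrier ?N" "sign_char centre \<in> c"
    unfolding c_def carrier_rep_monoid using reps rep_iso_refl[OF gr reps] by auto
  have "groth_incl ?N c = groth_map ?N ?\<phi> \<xi>"
    using fun_cong[OF \<xi>(2), of centre] fin Rep_U_incl_class[OF gr sign_char_Hom[OF fin]]
    by (simp add: lim_Rep_U_incl_def epsilon_def sign_family_def c_def)
  \<comment> \<open>A class contains its representative; unfolding \<open>groth_map\<close> at this
    pair extracts actual bundle classes \<open>C\<close> and \<open>D\<close> from \<xi>.\<close>
  moreover have "(c, \<one>\<^bsub>?N\<^esub>) \<in> groth_incl ?N c"
    using equiv_groth_rel[OF comm_monoid_rep_monoid[OF gr]] c(1) comm_monoid_rep_monoid[OF gr]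
    by (auto simp: groth_incl_def equiv_def refl_on_def comm_monoid_def monoid.one_closed)
  ultimately have "(c, \<one>\<^bsub>?N\<^esub>) \<in> groth_rel ?N `` (map_prod ?\<phi> ?\<phi> ` \<xi>)" by (simp add: groth_map_def)
  then obtain C D where CD: "(C, D) \<in> \<xi>" "((?\<phi> C, ?\<phi> D), (c, \<one>\<^bsub>?N\<^esub>)) \<in> groth_rel ?N" by auto
  have Vect: "C \<in> carrier (Vect crys ?X act)" "D \<in> carrier (Vect crys ?X act)"
    using \<xi>(1) CD(1) unfolding K0_def groth_def by (auto simp: groth_rel_iff elim!: quotientE)
  have N: "?\<phi> C \<in> carrier ?N" "?\<phi> D \<in> carrier ?N" using CD(2) unfolding groth_rel_iff by blast+
  have "rep_det (?\<phi> C) ?z = rep_det c ?z * rep_det (?\<phi> D) ?z" by (rule rep_det_groth_rel[OF gr z CD(2)])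
  then have "rep_det c ?z = 1" by (simp add: fibre_rep_class_det[OF Vect(1) N(1)] fibre_rep_class_det[OF Vect(2) N(2)])
  moreover have "rep_det c ?z = det (sign_char centre ?z)" by (rule rep_det_eq[OF gr c z])
  moreover have "det (sign_char centre ?z) = - 1" by (simp add: sign_char_def centre_eq det_single)
  ultimately show False by simp
qed

theorem mainTheorem1:
  shows "\<exists>(G :: nat monoid) (X :: (nat \<Rightarrow> real) topology) (act :: nat \<Rightarrow> (nat \<Rightarrow> real) \<Rightarrow> (nat \<Rightarrow> real)).
    group G \<and> infinite (carrier G) \<and>
    classifying_space_proper G X act \<and> compact_space (orbit_space G X act) \<and>
    (\<exists>n. \<exists>\<alpha>\<in>lim_Rep_U n G. lim_Rep_U_incl G \<alpha> \<notin> epsilon G X act ` carrier (K0 G X act)) \<and>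
    \<not> lim_rep_ring G \<subseteq> epsilon G X act ` carrier (K0 G X act)"
proof (intro exI[of _ crys] exI[of _ "Euclidean_space 3"] exI[of _ act] conjI)
  let ?im = "epsilon crys (Euclidean_space 3) act ` carrier (K0 crys (Euclidean_space 3) act)"
  show "group crys" by (rule group_crys)
  show "infinite (carrier crys)" by simp
  show "classifying_space_proper crys (Euclidean_space 3) act" by (rule classifying_space_crys)
  show "compact_space (orbit_space crys (Euclidean_space 3) act)" by (rule compact_orbit_space_act)
  show "\<exists>n. \<exists>\<alpha>\<in>lim_Rep_U n crys. lim_Rep_U_incl crys \<alpha> \<notin> ?im"
    using sign_family_lim sign_family_not_realized by blast
  show "\<not> lim_rep_ring crys \<subseteq> ?im"
    using lim_Rep_U_incl_in_lim_rep_ring[OF group_crys sign_family_lim] sign_family_not_realized by blast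
qed

end
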